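(* Using only order two symmetries, it is possible to characterize unambiguously 11 of the 16 symmetry classes of piezoelectricity tensors. More precisely, for a non null piezoelectricity tensor $\mathbf{P}\in\mathbb{P}\mathrm{iez}$ there are two distinct situations: (a) $\mathbf{P}$ has at least one plane symmetry or at least two axial symmetries. This corresponds to the 10 classes $$[\mathbb{Z}_2^{-}],\ [\mathbb{D}_2],\ [\mathbb{D}_2^{v}],\ [\mathbb{D}_3],\ [\mathbb{D}_3^{v}],\ [\mathbb{D}_4^{h}],\ [\mathbb{D}_6^{h}],\ [\mathbb{O}^{-}],\ [\mathrm{O}(2)],\ [\mathrm{O}(2)^{-}].$$ In these 10 cases, the symmetry class of $\mathbf{P}$ is directly characterized by order two symmetries. (b) $\mathbf{P}$ has no plane symmetry, and either it has no order two symmetry at all (classes $[\mathds{1}]$ and $[\mathbb{Z}_3]$) or it has a unique axial symmetry (classes $[\mathbb{Z}_2]$, $[\mathbb{Z}_4^{-}]$ and $[\mathrm{SO}(2)]$). In these two cases further operations are needed to identify the symmetry class: the remaining classes, divided into these two sets, can be distinguished by studying invariance with respect to higher-order rotations. The remaining (eleventh) characterized class is the degenerate one $[\mathrm{O}(3)]$, that is $\mathbf{P}=0$, for which there are infinitely many plane and axial symmetries.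
   Context: $\mathbb{P}\mathrm{iez}$ is the real vector space of piezoelectricity tensors $\{\mathbf{P}\in\otimes^3(\mathbb{R}^3): P_{ijk}=P_{ikj}\}$ (components in an orthonormal basis). The group $\mathrm{O}(3)$ acts on it by $(g\star\mathbf{P})_{ijk}=g_{ip}g_{jq}g_{kr}P_{pqr}$ (summation over repeated indices). The symmetry group of $\mathbf{P}$ is $G_{\mathbf{P}}=\{g\in\mathrm{O}(3): g\star\mathbf{P}=\mathbf{P}\}$, and its symmetry class is the conjugacy class $[G_{\mathbf{P}}]=\{gG_{\mathbf{P}}g^{-1}: g\in\mathrm{O}(3)\}$. For a subgroup $H$ of $\mathrm{O}(3)$, $[H]$ denotes its conjugacy class. The 16 symmetry classes of $\mathbb{P}\mathrm{iez}$ are $[\mathds{1}]$, $[\mathbb{Z}_2]$, $[\mathbb{Z}_3]$, $[\mathbb{D}_2^{v}]$, $[\mathbb{D}_3^{v}]$, $[\mathbb{Z}_2^{-}]$, $[\mathbb{Z}_4^{-}]$, $[\mathbb{D}_2]$, $[\mathbb{D}_3]$, $[\mathbb{D}_4^{h}]$, $[\mathbb{D}_6^{h}]$, $[\mathrm{SO}(2)]$, $[\mathrm{O}(2)]$, $[\mathrm{O}(2)^{-}]$, $[\mathbb{O}^{-}]$, $[\mathrm{O}(3)]$. Let $(\mathbf{e}_1,\mathbf{e}_2,\mathbf{e}_3)$ be the canonical basis of $\mathbb{R}^3$. For a nonzero vector $\mathbf{n}$, $\mathbf{r}(\mathbf{n},\theta)$ is the rotation of angle $\theta$ about the axis generated by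 $\mathbf{n}$, and $\mathbf{s}(\mathbf{n})=-\mathbf{r}(\mathbf{n},\pi)$ is the reflection through the plane orthogonal to $\mathbf{n}$. A plane symmetry is an element of the form $\mathbf{s}(\mathbf{n})$ and an axial symmetry is an element of the form $\mathbf{r}(\mathbf{n},\pi)$. An order two symmetry of $\mathbf{P}$ is a plane symmetry or axial symmetry $g$ such that $g\star\mathbf{P}=\mathbf{P}$. The subgroups are: - $\mathds{1}$: the trivial group. - $\mathbb{Z}_n$ ($n\ge2$): generated by $\mathbf{r}(\mathbf{e}_3,2\pi/n)$. - $\mathbb{D}_n$ ($n\ge2$): generated by $\mathbf{r}(\mathbf{e}_3,2\pi/n)$ and $\mathbf{r}(\mathbf{e}_1,\pi)$. - $\mathbb{D}_n^{v}$ ($n\ge2$): generated by $\mathbf{r}(\mathbf{e}_3,2\pi/n)$ and $\mathbf{s}(\mathbf{e}_1)$. - $\mathbb{Z}_2^{-}$: generated by $\mathbf{s}(\mathbf{e}_3)$. - $\mathbb{Z}_4^{-}$: generated by $-\mathbf{r}(\mathbf{e}_3,\pi/2)$. - $\mathbb{D}_{2n}^{h}$ ($n\ge2$): generated by $-\mathbf{r}(\mathbf{e}_3,\pi/n)$ and $\mathbf{r}(\mathbf{e}_1,\pi)$. - $\mathbb{O}^{-}$ (order 24): generated by $-\mathbf{r}(\mathbf{e}_3,\pi/2)$ and $\mathbf{s}(\mathbf{e}_2-\mathbf{e}_3)$. - $\mathrm{SO}(2)$: all rotations about $\mathbf{e}_3$. - $\mathrm{O}(2)$: generated by $\mathrm{SO}(2)$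 and $\mathbf{r}(\mathbf{e}_1,\pi)$. - $\mathrm{O}(2)^{-}$: generated by $\mathrm{SO}(2)$ and $\mathbf{s}(\mathbf{e}_1)$. *)

theory Defs
  imports "HOL-Analysis.Analysis" "HOL-Analysis.Cross3" "HOL-Algebra.Generated_Groups" "HOL-Algebra.Coset"
begin

type_synonym mat3 = "real^3^3"
type_synonym tensor3 = "real^3^3^3"

subsection \<open>The orthogonal group, conjugacy, and its generators\<close>

definition O3 :: "mat3 monoid" where
  "O3 = \<lparr>carrier = {g. orthogonal_matrix g}, mult = (**), one = mat 1\<rparr>"

lemma group_O3: "group O3"
proof (rule groupI)
  fix x assume "x \<in> carrier O3"
  then show "\<exists>y\<in>carrier O3. y \<otimes>\<^bsub>O3\<^esub> x = \<one>\<^bsub>O3\<^esub>"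
    by (intro bexI[of _ "transpose x"])
      (auto simp: O3_def orthogonal_matrix_transpose orthogonal_matrix_def)
qed (auto simp: O3_def orthogonal_matrix_mul orthogonal_matrix_id matrix_mul_assoc)

definition conjugate_by :: "mat3 \<Rightarrow> mat3 set \<Rightarrow> mat3 set" where
  "conjugate_by g H = g <#\<^bsub>O3\<^esub> H #>\<^bsub>O3\<^esub> inv\<^bsub>O3\<^esub> g"

definition conj_class :: "mat3 set \<Rightarrow> mat3 set set" where
  "conj_class H = {conjugate_by g H | g. g \<in> carrier O3}"

abbreviation e1 :: "real^3" where "e1 \<equiv> axis 1 1"
abbreviation e2 :: "real^3" where "e2 \<equiv> axis 2 1"
abbreviation e3 :: "real^3" where "e3 \<equiv> axis 3 1"

text \<open>Rodrigues' formula for the unit vector \<open>sgn n = n / norm n\<close>. For \<open>n = 0\<close> the value is not a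
  rotation, so every quantifier over axes below requires \<open>n \<noteq> 0\<close>.\<close>

definition rot :: "real^3 \<Rightarrow> real \<Rightarrow> mat3" where
  "rot n \<theta> = matrix (\<lambda>x. cos \<theta> *\<^sub>R x + sin \<theta> *\<^sub>R cross3 (sgn n) x
                          + ((1 - cos \<theta>) * (sgn n \<bullet> x)) *\<^sub>R sgn n)"

definition refl_plane :: "real^3 \<Rightarrow> mat3" where
  "refl_plane n = - rot n pi"

subsection \<open>Piezoelectricity tensors and their symmetry classes\<close>

definition Piez :: "tensor3 set" where
  "Piez = {P. \<forall>i j k. P $ i $ j $ k = P $ i $ k $ j}"

definition act :: "mat3 \<Rightarrow> tensor3 \<Rightarrow> tensor3" (infixr "\<star>" 75) where
  "g \<star> P = (\<chi> i j k. \<Sum>p\<in>UNIV. \<Sum>q\<in>UNIV. \<Sum>r\<in>UNIV.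
                g $ i $ p * g $ j $ q * g $ k $ r * P $ p $ q $ r)"

definition sym_group :: "tensor3 \<Rightarrow> mat3 set" where
  "sym_group P = {g \<in> carrier O3. g \<star> P = P}"

definition sym_class :: "tensor3 \<Rightarrow> mat3 set set" where
  "sym_class P = conj_class (sym_group P)"

definition Piez_classes :: "mat3 set set set" where
  "Piez_classes = sym_class ` Piez"

subsection \<open>Order two symmetries\<close>

definition plane_symmetries :: "tensor3 \<Rightarrow> mat3 set" where
  "plane_symmetries P = {refl_plane n | n. n \<noteq> 0 \<and> refl_plane n \<star> P = P}"

definition axial_symmetries :: "tensor3 \<Rightarrow> mat3 set" where
  "axial_symmetries P = {rot n pi | n. n \<noteq> 0 \<and> rot n pi \<star> P = P}"

definition order_two_symmetries :: "tensor3 \<Rightarrow> mat3 set" where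
  "order_two_symmetries P = plane_symmetries P \<union> axial_symmetries P"

text \<open>A class is characterized by order two symmetries if it can be read off from the set of order
  two symmetries of a tensor, as a configuration of planes and axes up to an orthogonal change of
  frame: no tensor outside the class has the same configuration as a tensor in the class.\<close>

definition characterized_by_order_two :: "mat3 set set \<Rightarrow> bool" where
  "characterized_by_order_two C \<longleftrightarrow>
     (\<forall>P\<in>Piez. \<forall>Q\<in>Piez. sym_class P = C
        \<longrightarrow> (\<exists>h\<in>carrier O3. order_two_symmetries Q = conjugate_by h (order_two_symmetries P))
        \<longrightarrow> sym_class Q = C)"

subsection \<open>The subgroups representing the classes\<close>

definition grp_1 :: "mat3 set" where
  "grp_1 = {mat 1}"

definition grp_Z :: "nat \<Rightarrow> mat3 set" where
  "grp_Z n = generate O3 {rot e3 (2 * pi / real n)}"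

definition grp_D :: "nat \<Rightarrow> mat3 set" where
  "grp_D n = generate O3 {rot e3 (2 * pi / real n), rot e1 pi}"

definition grp_Dv :: "nat \<Rightarrow> mat3 set" where
  "grp_Dv n = generate O3 {rot e3 (2 * pi / real n), refl_plane e1}"

definition grp_Z2m :: "mat3 set" where
  "grp_Z2m = generate O3 {refl_plane e3}"

definition grp_Z4m :: "mat3 set" where
  "grp_Z4m = generate O3 {- rot e3 (pi / 2)}"

text \<open>The argument is half the subscript: \<open>grp_D2nh n\<close> is the group written \<open>D\<close> with subscript
  \<open>2n\<close> and superscript \<open>h\<close>, so \<open>grp_D2nh 2\<close> is the group with subscript 4.\<close>

definition grp_D2nh :: "nat \<Rightarrow> mat3 set" where
  "grp_D2nh n = generate O3 {- rot e3 (pi / real n), rot e1 pi}"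

definition grp_Om :: "mat3 set" where
  "grp_Om = generate O3 {- rot e3 (pi / 2), refl_plane (e2 - e3)}"

definition grp_SO2 :: "mat3 set" where
  "grp_SO2 = range (rot e3)"

definition grp_O2 :: "mat3 set" where
  "grp_O2 = generate O3 (grp_SO2 \<union> {rot e1 pi})"

definition grp_O2m :: "mat3 set" where
  "grp_O2m = generate O3 (grp_SO2 \<union> {refl_plane e1})"

subsection \<open>The two situations\<close>

definition situation_a :: "tensor3 \<Rightarrow> bool" where
  "situation_a P \<longleftrightarrow> plane_symmetries P \<noteq> {} \<or>
     (\<exists>g\<in>axial_symmetries P. \<exists>h\<in>axial_symmetries P. g \<noteq> h)"

definition situation_b_none :: "tensor3 \<Rightarrow> bool" where
  "situation_b_none P \<longleftrightarrow> plane_symmetries P = {} \<and> order_two_symmetries P = {}"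

definition situation_b_axial :: "tensor3 \<Rightarrow> bool" where
  "situation_b_axial P \<longleftrightarrow> plane_symmetries P = {} \<and> (\<exists>!g. g \<in> axial_symmetries P)"

definition classes_a :: "mat3 set set set" where
  "classes_a = {conj_class grp_Z2m, conj_class (grp_D 2), conj_class (grp_Dv 2),
                conj_class (grp_D 3), conj_class (grp_Dv 3), conj_class (grp_D2nh 2),
                conj_class (grp_D2nh 3), conj_class grp_Om, conj_class grp_O2,
                conj_class grp_O2m}"

definition classes_b_none :: "mat3 set set set" where
  "classes_b_none = {conj_class grp_1, conj_class (grp_Z 3)}"

definition classes_b_axial :: "mat3 set set set" where
  "classes_b_axial = {conj_class (grp_Z 2), conj_class grp_Z4m, conj_class grp_SO2}"

end

theory Submission
  imports Defs
begin

text \<open>A rotation by an angle whose cosine is none of \<open>1\<close>, \<open>-1\<close>, \<open>-1/2\<close> has no nonzero fixed vector on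
  the components of weight 1, 2 and 3 about its axis, so every tensor fixed by it is axisymmetric.
  Otherwise the rotations in the symmetry group have order at most 3. Two threefold axes must meet
  at the tetrahedral angle (by the trace of the product of the two rotations) and force the tensor to
  be a multiple of \<open>xyz\<close>; a single threefold axis is preserved by the whole group, which can then be
  read off a normal form with five parameters; without threefold rotations, the rotations form an
  elementary abelian 2-group. All classes are realized by explicit tensors, whose quadratic and
  linear covariants (Gram matrix and trace vectors) confine their symmetry groups, and they are
  separated by the pairs of determinant and trace that occur in the groups.

  The groups of situation (a) are generated by their elements of order two, so the order two
  symmetries determine them. In situation (b) the order two symmetries are the same for \<open>1\<close> and
  \<open>Z_3\<close>, and the same for \<open>Z_2\<close>, \<open>Z_4^-\<close> and \<open>SO(2)\<close>.\<close>

text \<open>The obstacle is to bound symmetry groups from above, because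
  \<open>g \<star> P = P\<close> is cubic in the entries of \<open>g\<close>. Trace vectors and Gram
  matrices replace it by conditions linear in \<open>g\<close>, usually strong enough to show that
  the third axis is preserved; then \<open>g\<close> is some \<open>ax e s t\<close>, under which
  the weights of \<open>wt\<close> turn separately. A component of weight k turns by k t and has a
  fixed vector only if cos (k t) = 1; the weights stop at 3 because the tensor has order 3, which is
  where the exceptional cosines come from. The order being odd matters too: the central inversion
  acts as -1 and fixes no nonzero tensor, which restricts the improper elements. Frames can be
  changed at will, since conjugate groups have the same class. The closing theorem is a finite
  comparison of lists of booleans, because determinant and trace fix an orthogonal matrix up to
  conjugacy. The negative claims of (b) rest on pairs of realized groups of different classes that
  contain literally the same elements of order two.\<close>

declare transpose_matrix_vector [simp del]

section \<open>Coordinates of vectors and matrices\<close>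

definition m3 :: "real \<Rightarrow> real \<Rightarrow> real \<Rightarrow> real \<Rightarrow> real \<Rightarrow> real \<Rightarrow> real \<Rightarrow> real \<Rightarrow> real \<Rightarrow> mat3" where
  "m3 a b c d e f g h i = vector [vector [a, b, c], vector [d, e, f], vector [g, h, i]]"

lemma m3_nth [simp]:
  "m3 a b c d e f g h i $ 1 $ 1 = a" "m3 a b c d e f g h i $ 1 $ 2 = b" "m3 a b c d e f g h i $ 1 $ 3 = c"
  "m3 a b c d e f g h i $ 2 $ 1 = d" "m3 a b c d e f g h i $ 2 $ 2 = e" "m3 a b c d e f g h i $ 2 $ 3 = f"
  "m3 a b c d e f g h i $ 3 $ 1 = g" "m3 a b c d e f g h i $ 3 $ 2 = h" "m3 a b c d e f g h i $ 3 $ 3 = i"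
  by (simp_all add: m3_def)

lemma mat3_eq_iff:
  "(A::mat3) = (B::mat3) \<longleftrightarrow>
     A$1$1 = B$1$1 \<and> A$1$2 = B$1$2 \<and> A$1$3 = B$1$3 \<and> A$2$1 = B$2$1 \<and> A$2$2 = B$2$2 \<and> A$2$3 = B$2$3 \<and>
     A$3$1 = B$3$1 \<and> A$3$2 = B$3$2 \<and> A$3$3 = B$3$3"
  by (auto simp: vec_eq_iff forall_3)

lemma vec3_eq_iff: "(x::real^3) = y \<longleftrightarrow> x$1 = y$1 \<and> x$2 = y$2 \<and> x$3 = y$3"
  by (auto simp: vec_eq_iff forall_3)

lemma index3_neq [simp]: "(1::3) \<noteq> 2" "(2::3) \<noteq> 1" "(1::3) \<noteq> 3" "(3::3) \<noteq> 1" "(2::3) \<noteq> 3" "(3::3) \<noteq> 2"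
  using exhaust_3 by auto

lemma axis3_nth [simp]: "axis (i::3) (x::real) $ i = x" "i \<noteq> j \<Longrightarrow> axis i x $ j = 0"
  by (simp_all add: axis_def)

lemma mat_1_m3: "mat 1 = m3 1 0 0 0 1 0 0 0 1"
  by (simp add: mat3_eq_iff mat_def)

lemma mult3_nth: "((A::mat3) ** B) $ i $ j = A$i$1 * B$1$j + A$i$2 * B$2$j + A$i$3 * B$3$j"
  by (simp add: matrix_matrix_mult_def sum_3)

lemma mv3_nth: "((A::mat3) *v x) $ i = A$i$1 * x$1 + A$i$2 * x$2 + A$i$3 * x$3"
  by (simp add: matrix_vector_mult_def sum_3)

lemma transpose3_nth [simp]: "transpose (A::mat3) $ i $ j = A $ j $ i"
  by (simp add: transpose_def)

lemma trace3: "trace (A::mat3) = A$1$1 + A$2$2 + A$3$3"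
  by (simp add: trace_def sum_3)

lemma det_minus3: "det (- (A::mat3)) = - det A"
  by (simp add: det_3)

lemma trace_minus3: "trace (- (A::mat3)) = - trace A"
  by (simp add: trace3)

lemma minus_mult3: "(- (A::mat3)) ** (B::mat3) = - (A ** B)" "(A::mat3) ** (- (B::mat3)) = - (A ** B)"
  unfolding mat3_eq_iff by (simp_all add: mult3_nth)

lemma minus_minus_mult3: "(- (A::mat3)) ** (- (B::mat3)) = A ** B"
  by (simp add: minus_mult3)

lemma transpose_minus3: "transpose (- (A::mat3)) = - transpose A"
  by (simp add: mat3_eq_iff)

lemma orthogonal_matrix_minus3: "orthogonal_matrix (- (A::mat3)) \<longleftrightarrow> orthogonal_matrix A"
  by (simp add: orthogonal_matrix_def transpose_minus3 minus_minus_mult3)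

text \<open>Stated with \<open>transpose g *v x\<close>, a form that the library's simp rule
  \<open>transpose_matrix_vector\<close> would rewrite away; hence its removal from the simpset
  above.\<close>

lemma orth_cancel [simp]:
  assumes "orthogonal_matrix (g::mat3)"
  shows "g ** transpose g = mat 1" "transpose g ** g = mat 1"
    "g ** (transpose g ** X) = X" "transpose g ** (g ** X) = X"
    "Y ** g ** transpose g = Y" "Y ** transpose g ** g = Y"
    "transpose g *v (g *v x) = x" "g *v (transpose g *v x) = x"
  using assms
  by (simp_all add: orthogonal_matrix_def matrix_mul_assoc matrix_vector_mul_assoc)
     (simp_all add: matrix_mul_assoc[symmetric])

lemma orthogonal_transpose [simp]: "orthogonal_matrix (g::mat3) \<Longrightarrow> orthogonal_matrix (transpose g)"
  by (simp add: orthogonal_matrix_transpose)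

lemma orthogonal_matrix_det: "orthogonal_matrix (g::mat3) \<Longrightarrow> det g = 1 \<or> det g = -1"
  by (rule det_orthogonal_matrix)

lemma det_orthogonal_conj: "orthogonal_matrix (g::mat3) \<Longrightarrow> det (g ** h ** transpose g) = det h"
  using orthogonal_matrix_det[of g] by (auto simp: det_mul)

lemma trace_orthogonal_conj: "orthogonal_matrix (g::mat3) \<Longrightarrow> trace (g ** h ** transpose g) = trace h"
  by (subst trace_mul_sym) (simp add: matrix_mul_assoc)

lemma orthogonal_rows:
  assumes "orthogonal_matrix (g::mat3)"
  shows "g$i$1 * g$j$1 + g$i$2 * g$j$2 + g$i$3 * g$j$3 = (if i = j then 1 else 0)"
proof -
  have "(g ** transpose g) $ i $ j = (mat 1 :: mat3) $ i $ j" using assms by simp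
  then show ?thesis by (simp add: mult3_nth mat_def)
qed

lemma orthogonal_cols:
  assumes "orthogonal_matrix (g::mat3)"
  shows "g$1$i * g$1$j + g$2$i * g$2$j + g$3$i * g$3$j = (if i = j then 1 else 0)"
proof -
  have "(transpose g ** g) $ i $ j = (mat 1 :: mat3) $ i $ j" using assms by simp
  then show ?thesis by (simp add: mult3_nth mat_def)
qed

section \<open>The orthogonal group and conjugacy of its subsets\<close>

lemma carrier_O3 [simp]: "g \<in> carrier O3 \<longleftrightarrow> orthogonal_matrix g"
  and mult_O3 [simp]: "g \<otimes>\<^bsub>O3\<^esub> h = g ** h"
  and one_O3 [simp]: "\<one>\<^bsub>O3\<^esub> = mat 1"
  by (simp_all add: O3_def)

lemma inv_O3 [simp]: "orthogonal_matrix g \<Longrightarrow> inv\<^bsub>O3\<^esub> g = transpose g"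
  by (rule group.inv_equality[OF group_O3]) auto

lemma conjugate_by_eq:
  "orthogonal_matrix g \<Longrightarrow> conjugate_by g H = (\<lambda>h. g ** h ** transpose g) ` H"
  by (auto simp: conjugate_by_def l_coset_def r_coset_def)

lemma conjugate_by_compose:
  assumes "orthogonal_matrix g" "orthogonal_matrix h"
  shows "conjugate_by g (conjugate_by h H) = conjugate_by (g ** h) H"
  using assms by (simp add: conjugate_by_eq orthogonal_matrix_mul image_image matrix_transpose_mul matrix_mul_assoc)

lemma conjugate_by_1 [simp]: "conjugate_by (mat 1) H = H"
  by (simp add: conjugate_by_eq orthogonal_matrix_id)

text \<open>Right translation by \<open>g\<close> permutes O(3), so both classes collect the same
  conjugates of \<open>H\<close>.\<close>

lemma conj_class_conjugate_by:
  assumes "orthogonal_matrix g"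
  shows "conj_class (conjugate_by g H) = conj_class H"
proof -
  have "conj_class (conjugate_by g H) = {conjugate_by (k ** g) H | k. orthogonal_matrix k}"
    unfolding conj_class_def carrier_O3 using conjugate_by_compose[OF _ assms] by (intro Collect_cong) metis
  also have "\<dots> = conj_class H"
  proof (intro Set.set_eqI iffI)
    fix X assume "X \<in> conj_class H"
    then obtain k where k: "orthogonal_matrix k" "X = conjugate_by k H" by (auto simp: conj_class_def)
    then have "X = conjugate_by ((k ** transpose g) ** g) H" using assms by simp
    then show "X \<in> {conjugate_by (k ** g) H | k. orthogonal_matrix k}"
      using k assms by (blast intro: orthogonal_matrix_mul orthogonal_transpose)
  next
    fix X assume "X \<in> {conjugate_by (k ** g) H | k. orthogonal_matrix k}"
    then show "X \<in> conj_class H"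
      using assms orthogonal_matrix_mul unfolding conj_class_def carrier_O3 by blast
  qed
  finally show ?thesis .
qed

lemma conj_class_eq_iff: "conj_class H = conj_class K \<longleftrightarrow> (\<exists>g. orthogonal_matrix g \<and> H = conjugate_by g K)"
proof
  assume "conj_class H = conj_class K"
  moreover have "H \<in> conj_class H"
    unfolding conj_class_def by (intro CollectI exI[of _ "mat 1"]) (simp add: orthogonal_matrix_id)
  ultimately show "\<exists>g. orthogonal_matrix g \<and> H = conjugate_by g K" by (auto simp: conj_class_def)
qed (auto simp: conj_class_conjugate_by)

subsection \<open>Subgroups of the orthogonal group\<close>

lemma subgroup_O3_mult: "subgroup H O3 \<Longrightarrow> x \<in> H \<Longrightarrow> y \<in> H \<Longrightarrow> x ** y \<in> H"
  using subgroup.m_closed[of H O3 x y] by simp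

lemma subgroup_O3_orth: "subgroup H O3 \<Longrightarrow> x \<in> H \<Longrightarrow> orthogonal_matrix x"
  using subgroup.subset[of H O3] by auto

lemma subgroup_O3_transpose: "subgroup H O3 \<Longrightarrow> x \<in> H \<Longrightarrow> transpose x \<in> H"
  using subgroup.m_inv_closed[of H O3 x] subgroup_O3_orth[of H x] by simp

lemma subgroup_O3_one: "subgroup H O3 \<Longrightarrow> mat 1 \<in> H"
  using subgroup.one_closed[of H O3] by simp

lemma subgroup_generate_O3: "(\<And>x. x \<in> X \<Longrightarrow> orthogonal_matrix x) \<Longrightarrow> subgroup (generate O3 X) O3"
  by (intro group.generate_is_subgroup[OF group_O3]) auto

lemma generate_O3_subset: "subgroup H O3 \<Longrightarrow> X \<subseteq> H \<Longrightarrow> generate O3 X \<subseteq> H"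
  using group.generate_subgroup_incl[OF group_O3] by blast

subsection \<open>Orthogonal matrices preserving the third axis\<close>

text \<open>\<open>e\<close> is the determinant on the plane, \<open>d\<close> the eigenvalue on the axis.\<close>

definition ax :: "real \<Rightarrow> real \<Rightarrow> real \<Rightarrow> mat3" where
  "ax e d t = m3 (cos t) (- e * sin t) 0 (sin t) (e * cos t) 0 0 0 d"

abbreviation sgn1 :: "real \<Rightarrow> bool" where "sgn1 e \<equiv> e = 1 \<or> e = -1"

text \<open>The planar block of \<open>ax e d t\<close> is the rotation by \<open>t\<close> applied
  after diag(1, \<open>e\<close>), and moving diag(1, \<open>e\<close>) past a rotation multiplies
  its angle by \<open>e\<close>.\<close>

lemma ax_mult: "sgn1 e \<Longrightarrow> ax e d t ** ax e' d' t' = ax (e * e') (d * d') (t + e * t')"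
  by (auto simp: ax_def mat3_eq_iff mult3_nth cos_add sin_add cos_diff sin_diff algebra_simps)

lemma ax_transpose: "sgn1 e \<Longrightarrow> transpose (ax e d t) = ax e d (- e * t)"
  by (auto simp: ax_def mat3_eq_iff)

lemma ax_1: "ax 1 1 0 = mat 1"
  by (simp add: ax_def mat_1_m3)

lemma ax_orth [simp]: "sgn1 e \<Longrightarrow> sgn1 d \<Longrightarrow> orthogonal_matrix (ax e d t)"
  by (auto simp: orthogonal_matrix_def ax_transpose ax_mult simp flip: ax_1)

lemma ax_det: "det (ax e d t) = e * d"
proof -
  have "det (ax e d t) = e * d * ((sin t)\<^sup>2 + (cos t)\<^sup>2)"
    unfolding ax_def det_3 m3_nth by algebra
  then show ?thesis by simp
qed

lemma ax_trace: "trace (ax e d t) = (1 + e) * cos t + d"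
  by (simp add: ax_def trace3 algebra_simps)

lemma ax_eq_iff: "ax e d t = ax e' d' t' \<longleftrightarrow>
    e * cos t = e' * cos t' \<and> cos t = cos t' \<and> sin t = sin t' \<and> e * sin t = e' * sin t' \<and> d = d'"
  by (auto simp: ax_def mat3_eq_iff)

lemma ax_e3: "ax e d t *v e3 = d *\<^sub>R e3"
  by (simp add: vec3_eq_iff mv3_nth ax_def)

lemma minus_ax: "- ax e d t = ax e (- d) (t + pi)"
  by (simp add: ax_def mat3_eq_iff)

text \<open>Orthonormal columns force a block form. The first column is then a point of the unit
  circle, and the second, orthogonal to it in the plane, is \<open>e\<close> times its quarter
  turn.\<close>

lemma orth_preserving_e3:
  assumes g: "orthogonal_matrix g" and d: "g *v e3 = d *\<^sub>R e3"
  obtains e t where "sgn1 e" "sgn1 d" "g = ax e d t"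
proof -
  have col: "g$1$3 = 0" "g$2$3 = 0" "g$3$3 = d"
    using d by (auto simp: vec3_eq_iff mv3_nth)
  have dd: "d * d = 1" using orthogonal_cols[OF g, of 3 3] col by simp
  then have sd: "sgn1 d" by (metis square_eq_1_iff)
  have row: "g$3$1 = 0" "g$3$2 = 0"
    using orthogonal_cols[OF g, of 1 3] orthogonal_cols[OF g, of 2 3] col sd by auto
  have c1: "(g$1$1)\<^sup>2 + (g$2$1)\<^sup>2 = 1" using orthogonal_cols[OF g, of 1 1] row by (simp add: power2_eq_square)
  then obtain t where t: "g$1$1 = cos t" "g$2$1 = sin t" using sincos_total_2pi by blast
  have c2: "g$1$2 * g$1$2 + g$2$2 * g$2$2 = 1" using orthogonal_cols[OF g, of 2 2] row by simp
  have c3: "cos t * g$1$2 + sin t * g$2$2 = 0" using orthogonal_cols[OF g, of 1 2] row t by simp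
  \<comment> \<open>The determinant of the planar block, whose first column is (cos t, sin
    t).\<close>
  define e where "e = cos t * g$2$2 - sin t * g$1$2"
  have sc: "sin t * sin t + cos t * cos t = 1" by (metis sin_cos_squared_add power2_eq_square)
  have e1: "g$1$2 = - e * sin t" using c3 sc unfolding e_def by algebra
  have e2: "g$2$2 = e * cos t" using c3 sc unfolding e_def by algebra
  have "e * e = 1" using c2 sc unfolding e1 e2 by algebra
  then have "sgn1 e" by (metis square_eq_1_iff)
  moreover have "g = ax e d t" by (simp add: ax_def mat3_eq_iff col row e1 e2 t)
  ultimately show ?thesis using that sd by blast
qed

subsection \<open>Rotations\<close>

lemma rot_eq_m3:
  assumes "norm n = 1"
  shows "rot n t = m3
    (cos t + (1 - cos t) * n$1 * n$1) ((1 - cos t) * n$1 * n$2 - sin t * n$3) ((1 - cos t) * n$1 * n$3 + sin t * n$2)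
    ((1 - cos t) * n$1 * n$2 + sin t * n$3) (cos t + (1 - cos t) * n$2 * n$2) ((1 - cos t) * n$2 * n$3 - sin t * n$1)
    ((1 - cos t) * n$1 * n$3 - sin t * n$2) ((1 - cos t) * n$2 * n$3 + sin t * n$1) (cos t + (1 - cos t) * n$3 * n$3)"
proof -
  have s: "sgn n = n" using assms by (simp add: sgn_div_norm)
  show ?thesis
    by (simp add: rot_def s mat3_eq_iff matrix_def cross3_def inner_vec_def sum_3 algebra_simps)
qed

lemma rot_sgn: "rot (sgn n) t = rot n t"
  by (cases "n = 0") (simp_all add: rot_def sgn_div_norm)

lemma rot_e3: "rot e3 t = ax 1 1 t"
  by (simp add: rot_eq_m3 ax_def mat3_eq_iff)

lemma rot_e1_pi: "rot e1 pi = ax (-1) (-1) 0"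
  by (simp add: rot_eq_m3 ax_def mat3_eq_iff)

lemma refl_e1: "refl_plane e1 = ax (-1) 1 pi"
  by (simp add: refl_plane_def rot_e1_pi minus_ax)

lemma refl_e3: "refl_plane e3 = ax 1 (-1) 0"
  by (simp add: refl_plane_def rot_e3 minus_ax ax_eq_iff)

lemma rot_mv:
  assumes "norm n = 1"
  shows "rot n t *v x = cos t *\<^sub>R x + sin t *\<^sub>R cross3 n x + ((1 - cos t) * (n \<bullet> x)) *\<^sub>R n"
  by (simp add: rot_eq_m3[OF assms] vec3_eq_iff mv3_nth cross3_def inner_vec_def sum_3 algebra_simps)

lemma inner_orthogonal_mv: "orthogonal_matrix (g::mat3) \<Longrightarrow> (g *v x) \<bullet> (g *v y) = x \<bullet> y"
  by (metis dot_lmul_matrix orth_cancel(7) transpose_matrix_vector)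

lemma norm_orthogonal_mv: "orthogonal_matrix (g::mat3) \<Longrightarrow> norm (g *v x) = norm x"
  by (simp add: norm_eq_sqrt_inner inner_orthogonal_mv)

lemma mat3_eqI: "(\<And>x. A *v x = B *v x) \<Longrightarrow> (A::mat3) = B"
  by (metis matrix_eq)

text \<open>An orthogonal matrix carries the cross product along only up to the factor
  \<open>det g\<close>, so an improper \<open>g\<close> reverses the angle.\<close>

lemma conj_rot:
  assumes g: "orthogonal_matrix g" and n: "norm n = 1"
  shows "g ** rot n t ** transpose g = rot (g *v n) (det g * t)"
proof (rule mat3_eqI)
  fix x
  define y where "y = transpose g *v x"
  have x: "x = g *v y" using g by (simp add: y_def)
  have c: "cos (det g * t) = cos t" "sin (det g * t) = det g * sin t"
    using orthogonal_matrix_det[OF g] by auto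
  have gn: "norm (g *v n) = 1" using g n by (simp add: norm_orthogonal_mv)
  have cr: "cross3 (g *v n) (g *v y) = det g *\<^sub>R (g *v cross3 n y)"
    using cross_orthogonal_matrix[OF g] by (simp add: scaleR_matrix_vector_assoc)
  have dd: "det g * det g = 1" using orthogonal_matrix_det[OF g] by auto
  have "(g ** rot n t ** transpose g) *v x = g *v (rot n t *v y)"
    using g by (simp add: y_def matrix_vector_mul_assoc[symmetric])
  also have "\<dots> = rot (g *v n) (det g * t) *v (g *v y)"
    by (simp add: rot_mv n gn c cr inner_orthogonal_mv[OF g] matrix_vector_right_distrib matrix_vector_mult_scaleR
        mult.assoc[symmetric] mult.commute[of "det g * sin t" "det g"] dd)
  finally show "(g ** rot n t ** transpose g) *v x = rot (g *v n) (det g * t) *v x" by (simp add: x)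
qed

lemma rot_minus: "rot (- n) t = rot n (- t)"
  by (simp add: rot_def sgn_minus)

lemma ex_orth_e3:
  assumes "norm (n::real^3) = 1"
  obtains Q where "orthogonal_matrix Q" "det Q = 1" "Q *v e3 = n"
  using rotation_matrix_exists_basis[OF _ assms, of 3] by (auto simp: rotation_matrix_def)

text \<open>Choosing \<open>Q\<close> of determinant 1 keeps the sign of the angle when the axis is
  moved to \<open>e3\<close>.\<close>

lemma rot_conj_ax:
  assumes "norm n = 1"
  obtains Q where "orthogonal_matrix Q" "det Q = 1" "Q *v e3 = n" "\<And>t. rot n t = Q ** ax 1 1 t ** transpose Q"
proof -
  obtain Q where Q: "orthogonal_matrix Q" "det Q = 1" "Q *v e3 = n" using ex_orth_e3[OF assms] .
  have "Q ** ax 1 1 t ** transpose Q = rot n t" for t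
    using conj_rot[OF Q(1), of e3 t] Q by (simp add: rot_e3)
  then show ?thesis using that Q by metis
qed

lemma rot_orth: "norm n = 1 \<Longrightarrow> orthogonal_matrix (rot n t)"
  by (erule rot_conj_ax[of n]) (simp add: orthogonal_matrix_mul)

lemma rot_det: "norm n = 1 \<Longrightarrow> det (rot n t) = 1"
  by (erule rot_conj_ax[of n]) (simp add: det_orthogonal_conj ax_det)

lemma rot_trace: "norm n = 1 \<Longrightarrow> trace (rot n t) = 1 + 2 * cos t"
  by (erule rot_conj_ax[of n]) (simp add: trace_orthogonal_conj ax_trace)

text \<open>Since \<open>transpose g ** (g - mat 1)\<close> is minus the transpose of
  \<open>g - mat 1\<close> and the dimension is odd, \<open>g - mat 1\<close> is singular, which
  gives an axis. In a frame with this axis as \<open>e3\<close>, determinant 1 leaves only a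
  rotation of the plane.\<close>

lemma euler_rotation:
  assumes g: "orthogonal_matrix (g::mat3)" and d: "det g = 1"
  obtains n t where "norm n = 1" "g = rot n t"
proof -
  have tg: "det (transpose g) = 1" using d by simp
  have "det (g - mat 1) = det (transpose g ** (g - mat 1))" using tg by (simp add: det_mul)
  also have "transpose g ** (g - mat 1) = - transpose (g - mat 1)"
    using orthogonal_cols[OF g] by (simp add: mat3_eq_iff mat_1_m3 mult3_nth algebra_simps)
  also have "det \<dots> = - det (g - mat 1)" by (simp add: det_minus3 det_transpose)
  finally have "det (g - mat 1) = 0" by simp
  then have "\<not> invertible (g - mat 1)" by (simp add: invertible_det_nz)
  then obtain x where x: "x \<noteq> 0" "(g - mat 1) *v x = 0"
    unfolding invertible_left_inverse matrix_left_invertible_ker by blast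
  then have gx: "g *v x = x" by (simp add: matrix_vector_mult_diff_rdistrib)
  define n where "n = sgn x"
  have n: "norm n = 1" "g *v n = n"
    using x gx by (simp_all add: n_def norm_sgn sgn_div_norm matrix_vector_mult_scaleR)
  obtain Q where Q: "orthogonal_matrix Q" "Q *v e3 = n" "\<And>t. rot n t = Q ** ax 1 1 t ** transpose Q"
    using rot_conj_ax[OF n(1)] by metis
  define h where "h = transpose Q ** g ** Q"
  have h: "orthogonal_matrix h" using g Q by (simp add: h_def orthogonal_matrix_mul)
  have "h *v e3 = transpose Q *v (g *v (Q *v e3))" by (simp add: h_def matrix_vector_mul_assoc matrix_mul_assoc)
  also have "\<dots> = e3" using Q n by (metis orth_cancel(7))
  finally have he: "h *v e3 = 1 *\<^sub>R e3" by simp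
  obtain e t where et: "sgn1 e" "h = ax e 1 t" using orth_preserving_e3[OF h he] by metis
  have "det h = det g" using det_orthogonal_conj[of "transpose Q" g] Q by (simp add: h_def)
  then have "e = 1" using d et by (simp add: ax_det)
  moreover have "g = Q ** h ** transpose Q" using Q by (simp add: h_def matrix_mul_assoc)
  ultimately have "g = rot n t" using et Q by simp
  then show ?thesis using that n by blast
qed

subsection \<open>The action on tensors\<close>

text \<open>The action on the last two indices; with it \<open>act\<close> is computed slice by
  slice, each slice \<open>P$p\<close> being a matrix.\<close>

definition conj_mat :: "mat3 \<Rightarrow> mat3 \<Rightarrow> mat3" where
  "conj_mat g X = g ** X ** transpose g"

lemma conj_mat_nth: "conj_mat g X $ i $ j = (\<Sum>q\<in>UNIV. \<Sum>r\<in>UNIV. g$i$q * g$j$r * X$q$r)"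
  by (simp add: conj_mat_def mult3_nth sum_3 algebra_simps)

lemma conj_mat_add: "conj_mat g (X + Y) = conj_mat g X + conj_mat g Y"
  by (simp add: vec_eq_iff conj_mat_nth sum.distrib distrib_left)

lemma conj_mat_scaleR: "conj_mat g (r *\<^sub>R X) = r *\<^sub>R conj_mat g X"
  by (simp add: vec_eq_iff conj_mat_nth sum_distrib_left mult_ac)

lemma conj_mat_mult: "conj_mat (g ** h) X = conj_mat g (conj_mat h X)"
  by (simp add: conj_mat_def matrix_transpose_mul matrix_mul_assoc)

lemma act_nth: "(g \<star> P) $ i = (\<Sum>p\<in>UNIV. g$i$p *\<^sub>R conj_mat g (P$p))"
  by (simp add: vec_eq_iff act_def conj_mat_nth sum_distrib_left mult.assoc)

lemma act_nth3:
  "(g \<star> P) $ i = g$i$1 *\<^sub>R conj_mat g (P$1) + g$i$2 *\<^sub>R conj_mat g (P$2) + g$i$3 *\<^sub>R conj_mat g (P$3)"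
  by (simp add: act_nth sum_3)

lemma act_mult: "(g ** h) \<star> P = g \<star> (h \<star> P)"
proof -
  have "((g ** h) \<star> P) $ i = (g \<star> (h \<star> P)) $ i" for i
    by (simp add: act_nth3 conj_mat_mult conj_mat_add conj_mat_scaleR mult3_nth scaleR_add_left scaleR_add_right algebra_simps)
  then show ?thesis by (simp add: vec_eq_iff)
qed

lemma act_1 [simp]: "mat 1 \<star> P = P"
proof -
  have "(mat 1 \<star> P) $ i = P $ i" for i
  proof -
    have "conj_mat (mat 1) X = X" for X by (simp add: conj_mat_def)
    then show ?thesis using exhaust_3[of i] by (auto simp: act_nth3) (simp_all add: mat_1_m3)
  qed
  then show ?thesis by (simp add: vec_eq_iff)
qed

lemma act_uminus: "(- g) \<star> P = - (g \<star> P)"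
  by (simp add: vec_eq_iff act_def sum_negf)

lemma act_0 [simp]: "g \<star> 0 = 0"
  by (simp add: vec_eq_iff act_def)

lemma act_cancel [simp]:
  assumes "orthogonal_matrix g"
  shows "transpose g \<star> (g \<star> P) = P" "g \<star> (transpose g \<star> P) = P"
  using assms by (simp_all flip: act_mult)

lemma act_Piez [simp]: "P \<in> Piez \<Longrightarrow> g \<star> P \<in> Piez"
proof -
  assume "P \<in> Piez"
  then have s: "P$p$q$r = P$p$r$q" for p q r by (simp add: Piez_def)
  have "(g \<star> P) $ i $ j $ k = (g \<star> P) $ i $ k $ j" for i j k
    unfolding act_nth sum_component vector_scaleR_component conj_mat_nth
    by (subst sum.swap, subst s) (simp add: mult_ac)
  then show ?thesis by (simp add: Piez_def)
qed

lemma act_eq_0_iff: "orthogonal_matrix g \<Longrightarrow> g \<star> P = 0 \<longleftrightarrow> P = 0"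
  by (metis act_0 act_cancel(1))

lemma mem_sym_group: "g \<in> sym_group P \<longleftrightarrow> orthogonal_matrix g \<and> g \<star> P = P"
  by (simp add: sym_group_def)

lemma sym_group_act:
  assumes g: "orthogonal_matrix g"
  shows "sym_group (g \<star> P) = conjugate_by g (sym_group P)"
proof (intro Set.set_eqI iffI)
  fix h assume h: "h \<in> sym_group (g \<star> P)"
  have "(transpose g ** h ** g) \<star> P = P" using h g by (simp add: mem_sym_group act_mult)
  then have "transpose g ** h ** g \<in> sym_group P" using h g by (simp add: mem_sym_group orthogonal_matrix_mul)
  moreover have "h = g ** (transpose g ** h ** g) ** transpose g" using g by (simp add: matrix_mul_assoc)
  ultimately show "h \<in> conjugate_by g (sym_group P)" using g by (auto simp: conjugate_by_eq)
next
  fix h assume "h \<in> conjugate_by g (sym_group P)"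
  then show "h \<in> sym_group (g \<star> P)"
    using g by (auto simp: conjugate_by_eq mem_sym_group orthogonal_matrix_mul act_mult)
qed

lemma sym_class_act: "orthogonal_matrix g \<Longrightarrow> sym_class (g \<star> P) = sym_class P"
  by (simp add: sym_class_def sym_group_act conj_class_conjugate_by)

lemma subgroup_sym_group: "subgroup (sym_group P) O3"
proof (rule group.subgroupI[OF group_O3])
  show "sym_group P \<subseteq> carrier O3" by (auto simp: mem_sym_group)
  have "mat 1 \<in> sym_group P" by (simp add: mem_sym_group orthogonal_matrix_id)
  then show "sym_group P \<noteq> {}" by blast
  fix a assume a: "a \<in> sym_group P"
  then have "transpose a \<star> P = P" by (metis mem_sym_group act_cancel(1))
  then show "inv\<^bsub>O3\<^esub> a \<in> sym_group P" using a by (simp add: mem_sym_group)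
  fix b assume b: "b \<in> sym_group P"
  then show "a \<otimes>\<^bsub>O3\<^esub> b \<in> sym_group P"
    using a by (simp add: mem_sym_group act_mult orthogonal_matrix_mul)
qed

lemmas sym_group_mult = subgroup_O3_mult[OF subgroup_sym_group]
  and sym_group_transpose = subgroup_O3_transpose[OF subgroup_sym_group]
  and sym_group_one = subgroup_O3_one[OF subgroup_sym_group]

lemma sym_group_orth: "g \<in> sym_group P \<Longrightarrow> orthogonal_matrix g"
  by (simp add: mem_sym_group)

lemma tensor_neg_eq: "- (P::tensor3) = P \<Longrightarrow> P = 0"
  by (simp add: vec_eq_iff)

text \<open>The tensors have odd order, so the central inversion acts as minus the identity.\<close>

lemma minus_1_notin_sym_group: "P \<noteq> 0 \<Longrightarrow> - mat 1 \<notin> sym_group P"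
  using tensor_neg_eq by (auto simp: mem_sym_group act_uminus)

subsection \<open>Covariants\<close>

definition trace_vec :: "tensor3 \<Rightarrow> real^3" where
  "trace_vec P = (\<chi> i. trace (P$i))"

definition gram_mat :: "tensor3 \<Rightarrow> mat3" where
  "gram_mat P = (\<chi> i j. P$i \<bullet> P$j)"

text \<open>A shift of the indices commutes with the action, so \<open>cyc P\<close> supplies a
  second trace vector and a second Gram matrix, both contracting the first two indices of
  \<open>P\<close> instead of the last two.\<close>

definition cyc :: "tensor3 \<Rightarrow> tensor3" where
  "cyc P = (\<chi> i j k. P$j$k$i)"

lemma conj_mat_inner: "orthogonal_matrix g \<Longrightarrow> conj_mat g X \<bullet> conj_mat g Y = X \<bullet> Y"
proof -
  assume g: "orthogonal_matrix g"
  have tr: "A \<bullet> B = trace (A ** transpose B)" for A B :: mat3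
    by (simp add: inner_vec_def sum_3 trace3 mult3_nth)
  have "conj_mat g X ** transpose (conj_mat g Y) = g ** (X ** transpose Y) ** transpose g"
    using g by (simp add: conj_mat_def matrix_transpose_mul matrix_mul_assoc)
  then show ?thesis using g by (simp add: tr trace_orthogonal_conj)
qed

lemma trace_vec_act: "orthogonal_matrix g \<Longrightarrow> trace_vec (g \<star> P) = g *v trace_vec P"
proof -
  assume g: "orthogonal_matrix g"
  have t: "trace (conj_mat g X) = trace X" for X using g by (simp add: conj_mat_def trace_orthogonal_conj)
  have l: "trace (r *\<^sub>R A) = r * trace A" for r and A :: mat3 by (simp add: trace3 algebra_simps)
  show ?thesis by (simp add: trace_vec_def vec_eq_iff act_nth3 trace_add l t mv3_nth)
qed

lemma gram_mat_act: "orthogonal_matrix g \<Longrightarrow> gram_mat (g \<star> P) = g ** gram_mat P ** transpose g"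
proof -
  assume g: "orthogonal_matrix g"
  have "gram_mat (g \<star> P) $ i $ j = (g ** gram_mat P ** transpose g) $ i $ j" for i j
    by (simp add: gram_mat_def act_nth3 inner_add_left inner_add_right conj_mat_inner[OF g] mult3_nth algebra_simps)
  then show ?thesis by (simp add: vec_eq_iff)
qed

lemma cyc_act: "cyc (g \<star> P) = g \<star> cyc P"
proof -
  have "cyc (g \<star> P) $ i $ j $ k = (g \<star> cyc P) $ i $ j $ k" for i j k
    by (simp add: cyc_def act_def sum_3 mult_ac add_ac)
  then show ?thesis by (simp add: vec_eq_iff)
qed

lemma sym_group_trace_vec: "g \<in> sym_group P \<Longrightarrow> g *v trace_vec P = trace_vec P"
  by (metis mem_sym_group trace_vec_act)

lemma sym_group_cyc: "g \<in> sym_group P \<Longrightarrow> g \<in> sym_group (cyc P)"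
  by (metis mem_sym_group cyc_act)

text \<open>This condition is linear in \<open>g\<close>, whereas invariance of \<open>P\<close> is
  cubic.\<close>

lemma sym_group_gram_mat: "g \<in> sym_group P \<Longrightarrow> g ** gram_mat P = gram_mat P ** g"
proof -
  assume g: "g \<in> sym_group P"
  then have "g ** gram_mat P ** transpose g ** g = gram_mat P ** g" by (metis mem_sym_group gram_mat_act)
  then show ?thesis using sym_group_orth[OF g] by simp
qed

subsection \<open>Tensors of weights 0, 2 and 3 about the third axis\<close>

text \<open>\<open>a b c d\<close> span the axisymmetric tensors, \<open>p q\<close> is the planar cubic
  \<open>Re ((p + i q) (x - i y)\<^sup>3)\<close> of weight 3, and \<open>m\<close>, \<open>n\<close> are the two components of weight 2.\<close>

definition wt :: "real \<Rightarrow> real \<Rightarrow> real \<Rightarrow> real \<Rightarrow> real \<Rightarrow> real \<Rightarrow> real \<Rightarrow> real \<Rightarrow> real \<Rightarrow> real \<Rightarrow> tensor3" where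
  "wt a b c d p q m1 m2 n1 n2 = vector [
     m3 p q (c + n1)  q (- p) (n2 + d)  (c + n1) (n2 + d) 0,
     m3 q (- p) (n2 - d)  (- p) (- q) (c - n1)  (n2 - d) (c - n1) 0,
     m3 (b + m1) m2 0  m2 (b - m1) 0  0 0 a]"

lemma wt_nth [simp]:
  "wt a b c d p q m1 m2 n1 n2 $ 1 = m3 p q (c + n1)  q (- p) (n2 + d)  (c + n1) (n2 + d) 0"
  "wt a b c d p q m1 m2 n1 n2 $ 2 = m3 q (- p) (n2 - d)  (- p) (- q) (c - n1)  (n2 - d) (c - n1) 0"
  "wt a b c d p q m1 m2 n1 n2 $ 3 = m3 (b + m1) m2 0  m2 (b - m1) 0  0 0 a"
  by (simp_all add: wt_def)

lemma wt_Piez [simp]: "wt a b c d p q m1 m2 n1 n2 \<in> Piez"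
  by (simp add: Piez_def forall_3)

lemma tensor3_eq_iff: "(P::tensor3) = Q \<longleftrightarrow> P$1 = Q$1 \<and> P$2 = Q$2 \<and> P$3 = Q$3"
  by (auto simp: vec_eq_iff forall_3)

lemma wt_eq_iff: "wt a b c d p q m1 m2 n1 n2 = wt a' b' c' d' p' q' m1' m2' n1' n2' \<longleftrightarrow>
   a = a' \<and> b = b' \<and> c = c' \<and> d = d' \<and> p = p' \<and> q = q' \<and> m1 = m1' \<and> m2 = m2' \<and> n1 = n1' \<and> n2 = n2'"
  by (auto simp: tensor3_eq_iff mat3_eq_iff)

lemma wt_0: "wt 0 0 0 0 0 0 0 0 0 0 = 0"
  by (simp add: tensor3_eq_iff mat3_eq_iff)

lemma wt_eq_0_iff: "wt a b c d p q m1 m2 n1 n2 = 0 \<longleftrightarrow>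
   a = 0 \<and> b = 0 \<and> c = 0 \<and> d = 0 \<and> p = 0 \<and> q = 0 \<and> m1 = 0 \<and> m2 = 0 \<and> n1 = 0 \<and> n2 = 0"
  unfolding wt_0[symmetric] wt_eq_iff ..

lemma cos_3t: "cos (3 * t) = cos t * cos t * cos t - 3 * cos t * sin t * sin (t::real)"
proof -
  have "cos (3 * t) = cos (2 * t + t)" by simp
  also have "\<dots> = cos t * cos t * cos t - 3 * cos t * sin t * sin t"
    unfolding cos_add cos_double sin_double by (simp add: power2_eq_square algebra_simps)
  finally show ?thesis .
qed

lemma sin_3t: "sin (3 * t) = 3 * cos t * cos t * sin t - sin t * sin t * sin (t::real)"
proof -
  have "sin (3 * t) = sin (2 * t + t)" by simp
  also have "\<dots> = 3 * cos t * cos t * sin t - sin t * sin t * sin t"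
    unfolding sin_add cos_double sin_double by (simp add: power2_eq_square algebra_simps)
  finally show ?thesis .
qed

lemma ax_act_nth: "(ax e d' t \<star> P) $ 1 = cos t *\<^sub>R conj_mat (ax e d' t) (P$1) - (e * sin t) *\<^sub>R conj_mat (ax e d' t) (P$2)"
  "(ax e d' t \<star> P) $ 2 = sin t *\<^sub>R conj_mat (ax e d' t) (P$1) + (e * cos t) *\<^sub>R conj_mat (ax e d' t) (P$2)"
  "(ax e d' t \<star> P) $ 3 = d' *\<^sub>R conj_mat (ax e d' t) (P$3)"
  by (simp_all add: act_nth3 ax_def)

lemma ax_conj_mat: "conj_mat (ax e d t) (m3 x11 x12 x13 x21 x22 x23 x31 x32 x33) =
  m3 (cos t * cos t * x11 - e * cos t * sin t * (x12 + x21) + e * e * sin t * sin t * x22)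
     (cos t * sin t * x11 + e * (cos t * cos t * x12 - sin t * sin t * x21) - e * e * cos t * sin t * x22)
     (d * (cos t * x13 - e * sin t * x23))
     (cos t * sin t * x11 + e * (cos t * cos t * x21 - sin t * sin t * x12) - e * e * cos t * sin t * x22)
     (sin t * sin t * x11 + e * cos t * sin t * (x12 + x21) + e * e * cos t * cos t * x22)
     (d * (sin t * x13 + e * cos t * x23))
     (d * (cos t * x31 - e * sin t * x32)) (d * (sin t * x31 + e * cos t * x32)) (d * d * x33)"
  by (simp add: conj_mat_def mat3_eq_iff mult3_nth ax_def algebra_simps)

text \<open>A rotation by \<open>t\<close> turns a pair of weight k by k t. The sign
  \<open>s\<close> appears on components with an odd number of indices along the axis; the factor
  \<open>e\<close> appears on the second entry of each pair and on \<open>d\<close>, which is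
  antisymmetric in the plane.\<close>

lemma ax_act_wt:
  assumes e: "sgn1 e" and s: "sgn1 s"
  shows "ax e s t \<star> wt a b c d p q m1 m2 n1 n2 =
    wt (s * a) (s * b) (s * c) (e * s * d)
       (cos (3 * t) * p - e * sin (3 * t) * q) (sin (3 * t) * p + e * cos (3 * t) * q)
       (s * (cos (2 * t) * m1 - e * sin (2 * t) * m2)) (s * (sin (2 * t) * m1 + e * cos (2 * t) * m2))
       (s * (cos (2 * t) * n1 - e * sin (2 * t) * n2)) (s * (sin (2 * t) * n1 + e * cos (2 * t) * n2))"
proof -
  have sc: "sin t * sin t + cos t * cos t = 1" by (metis sin_cos_squared_add power2_eq_square)
  have ee: "e * e = 1" and ss: "s * s = 1" using e s by auto
  have c2: "cos (2 * t) = cos t * cos t - sin t * sin t" "sin (2 * t) = 2 * sin t * cos t"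
    by (simp_all add: cos_double sin_double power2_eq_square)
  note defs = ax_act_nth wt_nth ax_conj_mat mat3_eq_iff m3_nth vector_scaleR_component vector_add_component
     vector_minus_component real_scaleR_def c2 cos_3t sin_3t
  show ?thesis
    unfolding tensor3_eq_iff
    unfolding defs
    by (insert sc ee ss, intro conjI) (algebra | simp)+
qed

text \<open>The rotation minus the identity has determinant \<open>2 * (1 - C)\<close>; the two
  identities are the product with its adjugate.\<close>

lemma rotation2_fixed:
  fixes x y :: real
  assumes "C * x - S * y = x" "S * x + C * y = y" "C \<noteq> 1" "S * S + C * C = 1"
  shows "x = 0 \<and> y = 0"
proof -
  have "2 * (1 - C) * x = (C - 1) * (C * x - S * y - x) + S * (S * x + C * y - y) + x * (1 - (S * S + C * C))"
    by (simp add: algebra_simps)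
  moreover have "2 * (1 - C) * y = (C - 1) * (S * x + C * y - y) - S * (C * x - S * y - x) + y * (1 - (S * S + C * C))"
    by (simp add: algebra_simps)
  ultimately show ?thesis using assms by simp
qed

lemma Piez_slices:
  assumes "P \<in> Piez"
  obtains a1 a2 a3 a4 a5 a6 b1 b2 b3 b4 b5 b6 k1 k2 k3 k4 k5 k6 where
    "P$1 = m3 a1 a2 a3 a2 a4 a5 a3 a5 a6" "P$2 = m3 b1 b2 b3 b2 b4 b5 b3 b5 b6"
    "P$3 = m3 k1 k2 k3 k2 k4 k5 k3 k5 k6"
proof -
  have s: "P$i$j$k = P$i$k$j" for i j k using assms by (simp add: Piez_def)
  have "P$i = m3 (P$i$1$1) (P$i$1$2) (P$i$1$3) (P$i$1$2) (P$i$2$2) (P$i$2$3) (P$i$1$3) (P$i$2$3) (P$i$3$3)" for i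
    by (simp add: mat3_eq_iff s[of i 2 1] s[of i 3 1] s[of i 3 2])
  then show ?thesis using that by blast
qed

text \<open>The 18 components consist of four invariants, four pairs of weight 1 (\<open>w1\<close>
  to \<open>w4\<close>), two of weight 2 (\<open>w5\<close>, \<open>w6\<close>) and one of weight 3.
  The assumptions on \<open>t\<close> leave no nonzero fixed pair in weights 1 and 2.\<close>

lemma rotation_invariant_form:
  assumes P: "P \<in> Piez" and inv: "ax 1 1 t \<star> P = P" and t: "cos t \<noteq> 1" "cos (2 * t) \<noteq> 1"
  obtains a b c d p q where "P = wt a b c d p q 0 0 0 0" "cos (3 * t) \<noteq> 1 \<Longrightarrow> p = 0 \<and> q = 0"
proof -
  obtain a1 a2 a3 a4 a5 a6 b1 b2 b3 b4 b5 b6 k1 k2 k3 k4 k5 k6 where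
    P_eq: "P$1 = m3 a1 a2 a3 a2 a4 a5 a3 a5 a6" "P$2 = m3 b1 b2 b3 b2 b4 b5 b3 b5 b6"
    "P$3 = m3 k1 k2 k3 k2 k4 k5 k3 k5 k6" using Piez_slices[OF P] by metis
  define c where "c = cos t"
  define s where "s = sin t"
  have sc: "s * s + c * c = 1" unfolding c_def s_def by (metis sin_cos_squared_add power2_eq_square)
  have c2: "cos (2 * t) = c * c - s * s" "sin (2 * t) = 2 * s * c"
    by (simp_all add: cos_double sin_double power2_eq_square c_def s_def)
  have c3: "cos (3 * t) = c * c * c - 3 * c * s * s" "sin (3 * t) = 3 * c * c * s - s * s * s"
    by (simp_all add: cos_3t sin_3t c_def s_def)
  have sc2: "sin (2 * t) * sin (2 * t) + cos (2 * t) * cos (2 * t) = 1"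
    and sc3: "sin (3 * t) * sin (3 * t) + cos (3 * t) * cos (3 * t) = 1"
    by (metis sin_cos_squared_add power2_eq_square)+
  have slices: "(ax 1 1 t \<star> P) $ 1 = P $ 1" "(ax 1 1 t \<star> P) $ 2 = P $ 2" "(ax 1 1 t \<star> P) $ 3 = P $ 3"
    using inv by simp_all
  note eqs = slices[unfolded ax_act_nth P_eq ax_conj_mat mat3_eq_iff m3_nth vector_scaleR_component
     vector_minus_component vector_add_component real_scaleR_def mult_1 mult_1_right, folded c_def s_def]
  note E111 = eqs(1)[THEN conjunct1]
    and E112 = eqs(1)[THEN conjunct2, THEN conjunct1]
    and E113 = eqs(1)[THEN conjunct2, THEN conjunct2, THEN conjunct1]
    and E122 = eqs(1)[THEN conjunct2, THEN conjunct2, THEN conjunct2, THEN conjunct2, THEN conjunct1]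
    and E123 = eqs(1)[THEN conjunct2, THEN conjunct2, THEN conjunct2, THEN conjunct2, THEN conjunct2, THEN conjunct1]
    and E211 = eqs(2)[THEN conjunct1]
    and E212 = eqs(2)[THEN conjunct2, THEN conjunct1]
    and E213 = eqs(2)[THEN conjunct2, THEN conjunct2, THEN conjunct1]
    and E222 = eqs(2)[THEN conjunct2, THEN conjunct2, THEN conjunct2, THEN conjunct2, THEN conjunct1]
    and E223 = eqs(2)[THEN conjunct2, THEN conjunct2, THEN conjunct2, THEN conjunct2, THEN conjunct2, THEN conjunct1]
    and E311 = eqs(3)[THEN conjunct1]
    and E312 = eqs(3)[THEN conjunct2, THEN conjunct1]
    and E322 = eqs(3)[THEN conjunct2, THEN conjunct2, THEN conjunct2, THEN conjunct2, THEN conjunct1]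
  have Q: "c * x - s * y = x \<Longrightarrow> s * x + c * y = y \<Longrightarrow> x = 0 \<and> y = 0" for x y
    using rotation2_fixed[OF _ _ t(1), of x "sin t" y] sc by (simp add: c_def s_def)
  have Q2: "(c * c - s * s) * x - 2 * s * c * y = x \<Longrightarrow> 2 * s * c * x + (c * c - s * s) * y = y \<Longrightarrow> x = 0 \<and> y = 0" for x y
    using rotation2_fixed[OF _ _ t(2), of x "sin (2 * t)" y] sc2 by (simp add: c2)
  have w1: "a6 = 0 \<and> b6 = 0" by (rule Q) (use eqs in simp_all)
  have w2: "k3 = 0 \<and> k5 = 0" by (rule Q) (use eqs in simp_all)
  \<comment> \<open>Contracting two indices over the plane leaves a planar vector, of weight 1: the
    last two indices here, the first and the third in \<open>w4\<close>.\<close>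
  have w3: "a1 + a4 = 0 \<and> b1 + b4 = 0"
  proof (rule Q)
    \<comment> \<open>The slice equations are cubic in \<open>c\<close> and \<open>s\<close>. The
      factor \<open>s * s + c * c\<close>, which is 1, lifts the wanted linear relation to that
      degree, where it is the sum of \<open>E111\<close> and \<open>E122\<close>.\<close>
    have "(c * (a1 + a4) - s * (b1 + b4)) * (s * s + c * c) = a1 + a4"
      using E111 E122 by (simp only: algebra_simps; linarith)
    then show "c * (a1 + a4) - s * (b1 + b4) = a1 + a4" by (simp add: sc)
    have "(s * (a1 + a4) + c * (b1 + b4)) * (s * s + c * c) = b1 + b4"
      using E211 E222 by (simp only: algebra_simps; linarith)
    then show "s * (a1 + a4) + c * (b1 + b4) = b1 + b4" by (simp add: sc)
  qed
  have w4: "a1 + b2 = 0 \<and> a2 + b4 = 0"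
  proof (rule Q)
    have "(c * (a1 + b2) - s * (a2 + b4)) * (s * s + c * c) = a1 + b2"
      using E111 E212 by (simp only: algebra_simps; linarith)
    then show "c * (a1 + b2) - s * (a2 + b4) = a1 + b2" by (simp add: sc)
    have "(s * (a1 + b2) + c * (a2 + b4)) * (s * s + c * c) = a2 + b4"
      using E112 E222 by (simp only: algebra_simps; linarith)
    then show "s * (a1 + b2) + c * (a2 + b4) = a2 + b4" by (simp add: sc)
  qed
  \<comment> \<open>The trace-free planar part of \<open>P$3\<close> and, in \<open>w6\<close>, that
    of the symmetrized components with last index 3; both turn by \<open>2 * t\<close>.\<close>
  have w5: "k1 - k4 = 0 \<and> 2 * k2 = 0"
    by (rule Q2; insert E311 E322 E312; simp only: algebra_simps; linarith)
  have w6: "a3 - b5 = 0 \<and> a5 + b3 = 0"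
    by (rule Q2; insert E113 E223 E123 E213; simp only: algebra_simps; linarith)
  have P': "P = wt k6 k1 a3 a5 a1 a2 0 0 0 0"
    using w1 w2 w3 w4 w5 w6 by (simp add: tensor3_eq_iff P_eq mat3_eq_iff)
  moreover have "a1 = 0 \<and> a2 = 0" if "cos (3 * t) \<noteq> 1"
  proof (rule rotation2_fixed[OF _ _ that sc3])
    have "wt k6 k1 a3 a5 (cos (3 * t) * a1 - sin (3 * t) * a2) (sin (3 * t) * a1 + cos (3 * t) * a2) 0 0 0 0
        = wt k6 k1 a3 a5 a1 a2 0 0 0 0"
      using inv unfolding P' by (simp add: ax_act_wt)
    then show "cos (3 * t) * a1 - sin (3 * t) * a2 = a1" "sin (3 * t) * a1 + cos (3 * t) * a2 = a2"
      unfolding wt_eq_iff by simp_all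
  qed
  ultimately show ?thesis using that by blast
qed

section \<open>Symmetry groups described by two signs and an angle\<close>

definition AX :: "(real \<Rightarrow> real \<Rightarrow> real \<Rightarrow> bool) \<Rightarrow> mat3 set" where
  "AX \<Phi> = {ax e s t | e s t. sgn1 e \<and> sgn1 s \<and> \<Phi> e s t}"

lemma AX_I: "sgn1 e \<Longrightarrow> sgn1 s \<Longrightarrow> \<Phi> e s t \<Longrightarrow> ax e s t \<in> AX \<Phi>"
  by (auto simp: AX_def)

text \<open>The axis is the eigenspace of the simple eigenvalue \<open>y\<close>, and a commuting
  matrix preserves eigenspaces.\<close>

lemma commute_diag_axis:
  assumes "g ** m3 x 0 0 0 x 0 0 0 y = m3 x 0 0 0 x 0 0 0 y ** g" "x \<noteq> y"
  shows "g *v e3 = (g$3$3) *\<^sub>R e3"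
  using assms by (simp add: mat3_eq_iff vec3_eq_iff mult3_nth mv3_nth)

text \<open>The numbers compared are the eigenvalues of the Gram matrix, on the plane and on the axis.\<close>

lemma sym_group_wt_axis:
  assumes g: "g \<in> sym_group (wt a b c d p q m1 m2 n1 n2)"
    and z: "c * n2 = d * n1" "c * n1 + d * n2 = 0" "p * m1 + q * m2 = 0" "q * m1 = p * m2"
    and ne: "2 * (p * p + q * q + c * c + d * d + n1 * n1 + n2 * n2) \<noteq> a * a + 2 * (b * b + m1 * m1 + m2 * m2)"
  shows "g *v e3 = (g$3$3) *\<^sub>R e3"
proof -
  let ?P = "wt a b c d p q m1 m2 n1 n2"
  \<comment> \<open>The equations \<open>z\<close> are, in order: entry (1,2) vanishes, the two
    planar diagonal entries agree, entries (1,3) and (2,3) vanish.\<close>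
  have "gram_mat ?P = m3 (2 * (p * p + q * q + c * c + d * d + n1 * n1 + n2 * n2)) 0 0
      0 (2 * (p * p + q * q + c * c + d * d + n1 * n1 + n2 * n2)) 0
      0 0 (a * a + 2 * (b * b + m1 * m1 + m2 * m2))"
    unfolding gram_mat_def mat3_eq_iff vec_lambda_beta wt_nth inner_vec_def sum_3 m3_nth inner_real_def
    by (insert z, intro conjI) (algebra | simp add: algebra_simps)+
  then show ?thesis using commute_diag_axis sym_group_gram_mat[OF g] ne by metis
qed

lemma AX_cong: "(\<And>e s t. sgn1 e \<Longrightarrow> sgn1 s \<Longrightarrow> \<Phi> e s t \<longleftrightarrow> \<Psi> e s t) \<Longrightarrow> AX \<Phi> = AX \<Psi>"
  unfolding AX_def by (rule Collect_cong) metis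

text \<open>Once every symmetry preserves the axis it is some \<open>ax e s t\<close>, and
  \<open>ax_act_wt\<close> turns invariance into the ten scalar equations on the left of
  \<open>iff\<close>.\<close>

lemma sym_group_wt_eqI:
  assumes axis: "\<forall>g\<in>sym_group (wt a b c d p q m1 m2 n1 n2). \<exists>s. g *v e3 = s *\<^sub>R e3"
    and iff: "\<And>e s t. sgn1 e \<Longrightarrow> sgn1 s \<Longrightarrow>
     (s * a = a \<and> s * b = b \<and> s * c = c \<and> e * s * d = d \<and>
     cos (3 * t) * p - e * sin (3 * t) * q = p \<and> sin (3 * t) * p + e * cos (3 * t) * q = q \<and>
     s * (cos (2 * t) * m1 - e * sin (2 * t) * m2) = m1 \<and> s * (sin (2 * t) * m1 + e * cos (2 * t) * m2) = m2 \<and>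
     s * (cos (2 * t) * n1 - e * sin (2 * t) * n2) = n1 \<and> s * (sin (2 * t) * n1 + e * cos (2 * t) * n2) = n2)
     \<longleftrightarrow> \<Phi> e s t"
  shows "sym_group (wt a b c d p q m1 m2 n1 n2) = AX \<Phi>"
proof (intro Set.set_eqI iffI)
  fix g assume g: "g \<in> sym_group (wt a b c d p q m1 m2 n1 n2)"
  then obtain s where "g *v e3 = s *\<^sub>R e3" using axis by blast
  then obtain e t where est: "sgn1 e" "sgn1 s" "g = ax e s t" using orth_preserving_e3 sym_group_orth[OF g] by metis
  have "\<Phi> e s t"
    using g iff[OF est(1,2), of t] unfolding mem_sym_group est(3) ax_act_wt[OF est(1,2)] wt_eq_iff by blast
  then show "g \<in> AX \<Phi>" using est by (auto simp: AX_def)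
next
  fix g assume "g \<in> AX \<Phi>"
  then obtain e s t where est: "sgn1 e" "sgn1 s" "g = ax e s t" "\<Phi> e s t" unfolding AX_def by blast
  then show "g \<in> sym_group (wt a b c d p q m1 m2 n1 n2)"
    unfolding mem_sym_group est(3) ax_act_wt[OF est(1,2)] wt_eq_iff using iff[OF est(1,2), of t] ax_orth by blast
qed

lemma sym_group_wt:
  assumes "c * n2 = d * n1" "c * n1 + d * n2 = 0" "p * m1 + q * m2 = 0" "q * m1 = p * m2"
    and "2 * (p * p + q * q + c * c + d * d + n1 * n1 + n2 * n2) \<noteq> a * a + 2 * (b * b + m1 * m1 + m2 * m2)"
    and "\<And>e s t. sgn1 e \<Longrightarrow> sgn1 s \<Longrightarrow>
     (s * a = a \<and> s * b = b \<and> s * c = c \<and> e * s * d = d \<and>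
     cos (3 * t) * p - e * sin (3 * t) * q = p \<and> sin (3 * t) * p + e * cos (3 * t) * q = q \<and>
     s * (cos (2 * t) * m1 - e * sin (2 * t) * m2) = m1 \<and> s * (sin (2 * t) * m1 + e * cos (2 * t) * m2) = m2 \<and>
     s * (cos (2 * t) * n1 - e * sin (2 * t) * n2) = n1 \<and> s * (sin (2 * t) * n1 + e * cos (2 * t) * n2) = n2)
     \<longleftrightarrow> \<Phi> e s t"
  shows "sym_group (wt a b c d p q m1 m2 n1 n2) = AX \<Phi>"
proof (rule sym_group_wt_eqI)
  show "\<forall>g\<in>sym_group (wt a b c d p q m1 m2 n1 n2). \<exists>s. g *v e3 = s *\<^sub>R e3"
    using sym_group_wt_axis[OF _ assms(1-5)] by blast
qed (rule assms(6))

lemma cos_1_imp_sin_0: "cos x = 1 \<Longrightarrow> sin x = (0::real)"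
  by (metis cos_one_sin_zero)

lemma cos_pm1_sin_0: "cos x = 1 \<or> cos x = -1 \<Longrightarrow> sin x = (0::real)"
  by (metis sin_zero_abs_cos_one abs_minus abs_one sin_cos_squared_add3 mult_minus_left mult_1 minus_minus add_cancel_right_right mult_eq_0_iff)

subsection \<open>The groups fixing the third axis\<close>

lemma subgroup_ax_int:
  assumes H: "subgroup H O3" and t: "ax 1 1 t \<in> H"
  shows "ax 1 1 (of_int k * t) \<in> H"
proof -
  have n: "ax 1 1 (real n * t) \<in> H" for n
  proof (induction n)
    case 0 then show ?case using subgroup_O3_one[OF H] by (simp add: ax_1)
  next
    case (Suc n)
    have "ax 1 1 (real (Suc n) * t) = ax 1 1 (real n * t) ** ax 1 1 t"
      by (simp add: ax_mult algebra_simps)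
    then show ?case using subgroup_O3_mult[OF H Suc t] by simp
  qed
  show ?thesis
  proof (cases k rule: int_cases2)
    case (nonneg n) then show ?thesis using n[of n] by simp
  next
    case (nonpos n) then show ?thesis using subgroup_O3_transpose[OF H n[of n]] by (simp add: ax_transpose)
  qed
qed

text \<open>The cosine condition says that \<open>x\<close> is an integer multiple of
  \<open>2 * pi / real m\<close>; cosines thus serve as membership tests for the finite rotation
  groups.\<close>

lemma subgroup_ax_root:
  assumes H: "subgroup H O3" and m: "m \<noteq> 0" and t: "ax 1 1 (2 * pi / real m) \<in> H" and c: "cos (real m * x) = 1"
  shows "ax 1 1 x \<in> H"
proof -
  obtain k :: int where "real m * x = of_int k * 2 * pi" using iffD1[OF cos_one_2pi_int c] by blast
  then have "x = of_int k * (2 * pi / real m)" using m by (simp add: field_simps)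
  then show ?thesis using subgroup_ax_int[OF H t] by metis
qed

lemma ax_2pi: "ax e s (t + 2 * pi) = ax e s t"
  by (simp add: ax_eq_iff)

text \<open>Closure of \<open>AX \<Phi>\<close> under products and inverses is inherited from a
  tensor \<open>P\<close> with this symmetry group instead of being checked by trigonometry.\<close>

lemma AX_generate:
  assumes eq: "sym_group P = AX \<Phi>" and X: "\<And>x. x \<in> X \<Longrightarrow> x \<in> AX \<Phi>"
    and ge: "\<And>H e s t. subgroup H O3 \<Longrightarrow> X \<subseteq> H \<Longrightarrow> sgn1 e \<Longrightarrow> sgn1 s \<Longrightarrow> \<Phi> e s t \<Longrightarrow> ax e s t \<in> H"
  shows "generate O3 X = AX \<Phi>"
proof
  show "generate O3 X \<subseteq> AX \<Phi>"
    using generate_O3_subset[OF subgroup_sym_group, of X P] X eq by blast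
  have "subgroup (generate O3 X) O3"
    by (rule subgroup_generate_O3) (use X eq sym_group_orth in blast)
  moreover have "X \<subseteq> generate O3 X" by (auto intro: generate.incl)
  ultimately show "AX \<Phi> \<subseteq> generate O3 X" using ge unfolding AX_def by blast
qed

section \<open>Model tensors for the groups about the third axis\<close>

lemma sym_Z2: "sym_group (wt 0 0 1 1 0 0 1 0 0 0) = AX (\<lambda>e s t. e = 1 \<and> s = 1 \<and> cos (2 * t) = 1)"
  by (rule sym_group_wt; use cos_1_imp_sin_0 in force)

lemma sym_Z3: "sym_group (wt 0 0 1 1 1 0 0 0 0 0) = AX (\<lambda>e s t. e = 1 \<and> s = 1 \<and> cos (3 * t) = 1)"
  by (rule sym_group_wt; use cos_1_imp_sin_0 in force)

text \<open>The entry 2, here and in \<open>sym_D2v\<close> and \<open>sym_Z4m\<close>, separates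
  the Gram eigenvalues: with 1 in its place both would be 2 and the axis would go
  undetected.\<close>

lemma sym_D2: "sym_group (wt 0 0 0 1 0 0 0 2 0 0) = AX (\<lambda>e s t. s = e \<and> cos (2 * t) = 1)"
  by (rule sym_group_wt; use cos_1_imp_sin_0 in force)

lemma sym_D3: "sym_group (wt 0 0 0 1 1 0 0 0 0 0) = AX (\<lambda>e s t. s = e \<and> cos (3 * t) = 1)"
  by (rule sym_group_wt; use cos_1_imp_sin_0 in force)

lemma sym_D2v: "sym_group (wt 0 0 1 0 0 0 2 0 0 0) = AX (\<lambda>e s t. s = 1 \<and> cos (2 * t) = 1)"
  by (rule sym_group_wt; use cos_1_imp_sin_0 cos_pm1_sin_0 in force)

lemma sym_D3v: "sym_group (wt 0 0 1 0 0 1 0 0 0 0) = AX (\<lambda>e s t. s = 1 \<and> cos (3 * t) = e)"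
  by (rule sym_group_wt; use cos_1_imp_sin_0 cos_pm1_sin_0 in force)

text \<open>The weight 2 pairs (2, 0) and (0, 1) are linearly independent, which excludes
  \<open>e = -1\<close>; parallel pairs would be fixed by a planar reflection up to sign.\<close>

lemma sym_Z4m: "sym_group (wt 0 0 0 0 0 0 2 0 0 1) = AX (\<lambda>e s t. e = 1 \<and> cos (2 * t) = s)"
  by (rule sym_group_wt; use cos_1_imp_sin_0 cos_pm1_sin_0 in force)

lemma sym_D4h: "sym_group (wt 0 0 0 0 0 0 0 1 0 0) = AX (\<lambda>e s t. cos (2 * t) = e * s)"
  by (rule sym_group_wt; use cos_1_imp_sin_0 cos_pm1_sin_0 in force)

lemma sym_D6h: "sym_group (wt 0 0 0 0 1 0 0 0 0 0) = AX (\<lambda>e s t. cos (3 * t) = 1)"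
  by (rule sym_group_wt; use cos_1_imp_sin_0 cos_pm1_sin_0 in force)

lemma sym_SO2: "sym_group (wt 0 0 1 1 0 0 0 0 0 0) = AX (\<lambda>e s t. e = 1 \<and> s = 1)"
  by (rule sym_group_wt; use cos_1_imp_sin_0 cos_pm1_sin_0 in force)

lemma sym_O2: "sym_group (wt 0 0 0 1 0 0 0 0 0 0) = AX (\<lambda>e s t. s = e)"
  by (rule sym_group_wt; use cos_1_imp_sin_0 cos_pm1_sin_0 in force)

lemma sym_O2m: "sym_group (wt 0 0 1 0 0 0 0 0 0 0) = AX (\<lambda>e s t. s = 1)"
  by (rule sym_group_wt; use cos_1_imp_sin_0 cos_pm1_sin_0 in force)

lemma grp_Z2_eq: "grp_Z 2 = AX (\<lambda>e s t. e = 1 \<and> s = 1 \<and> cos (2 * t) = 1)"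
  unfolding grp_Z_def rot_e3
proof (rule AX_generate[OF sym_Z2])
  fix H and e s t :: real assume "subgroup H O3" "{ax 1 1 (2 * pi / real 2)} \<subseteq> H" "e = 1 \<and> s = 1 \<and> cos (2 * t) = 1"
  then show "ax e s t \<in> H" using subgroup_ax_root[of H 2 t] by simp
qed (auto intro!: AX_I)

lemma grp_Z3_eq: "grp_Z 3 = AX (\<lambda>e s t. e = 1 \<and> s = 1 \<and> cos (3 * t) = 1)"
  unfolding grp_Z_def rot_e3
proof (rule AX_generate[OF sym_Z3])
  fix H and e s t :: real assume "subgroup H O3" "{ax 1 1 (2 * pi / real 3)} \<subseteq> H" "e = 1 \<and> s = 1 \<and> cos (3 * t) = 1"
  then show "ax e s t \<in> H" using subgroup_ax_root[of H 3 t] by simp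
qed (auto intro!: AX_I)

lemma grp_D_eq_aux:
  assumes n: "n = 2 \<or> n = 3" and sym: "sym_group P = AX (\<lambda>e s t. s = e \<and> cos (real n * t) = 1)"
  shows "grp_D n = AX (\<lambda>e s t. s = e \<and> cos (real n * t) = 1)"
  unfolding grp_D_def rot_e3 rot_e1_pi
proof (rule AX_generate[OF sym])
  fix H and e s t :: real assume H: "subgroup H O3" "{ax 1 1 (2 * pi / real n), ax (-1) (-1) 0} \<subseteq> H"
    and e: "sgn1 e" and c: "s = e \<and> cos (real n * t) = 1"
  have "ax 1 1 t \<in> H" using subgroup_ax_root[of H n t] H c n by auto
  then show "ax e s t \<in> H" using subgroup_O3_mult[OF H(1), of "ax 1 1 t" "ax (-1) (-1) 0"] H(2) e c
    by (auto simp: ax_mult)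
qed (use n in \<open>auto intro!: AX_I\<close>)

lemma grp_D2_eq: "grp_D 2 = AX (\<lambda>e s t. s = e \<and> cos (2 * t) = 1)"
  using grp_D_eq_aux[of 2] sym_D2 by simp

lemma grp_D3_eq: "grp_D 3 = AX (\<lambda>e s t. s = e \<and> cos (3 * t) = 1)"
  using grp_D_eq_aux[of 3] sym_D3 by simp

text \<open>The generator \<open>refl_plane e1\<close> is \<open>ax (-1) 1 pi\<close>, so the
  elements with \<open>e = -1\<close> come from rotations by \<open>t - pi\<close>. The shift is
  invisible to twofold conditions and changes the sign in threefold ones.\<close>

lemma cos_n_shift_pi: "cos (2 * (t - pi)) = cos (2 * t)" "cos (3 * (t - pi)) = - cos (3 * t)"
  "sin (2 * (t - pi)) = sin (2 * t)"
proof -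
  have "cos (2 * (t - pi)) = cos (2 * t - 2 * pi)" "sin (2 * (t - pi)) = sin (2 * t - 2 * pi)" by (simp_all add: algebra_simps)
  then show "cos (2 * (t - pi)) = cos (2 * t)" "sin (2 * (t - pi)) = sin (2 * t)" by (simp_all add: cos_diff sin_diff)
  have "cos (3 * (t - pi)) = cos ((3 * t - pi) - 2 * pi)" by (simp add: algebra_simps)
  then show "cos (3 * (t - pi)) = - cos (3 * t)" by (simp only: cos_diff cos_two_pi sin_two_pi) (simp add: cos_diff)
qed

lemma grp_D2v_eq: "grp_Dv 2 = AX (\<lambda>e s t. s = 1 \<and> cos (2 * t) = 1)"
  unfolding grp_Dv_def rot_e3 refl_e1
proof (rule AX_generate[OF sym_D2v])
  fix H and e s t :: real assume H: "subgroup H O3" "{ax 1 1 (2 * pi / real 2), ax (-1) 1 pi} \<subseteq> H"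
    and e: "sgn1 e" and c: "s = 1 \<and> cos (2 * t) = 1"
  have "ax 1 1 t \<in> H" "ax 1 1 (t - pi) \<in> H"
    using subgroup_ax_root[of H 2 t] subgroup_ax_root[of H 2 "t - pi"] H c cos_n_shift_pi(1)[of t] by auto
  then show "ax e s t \<in> H" using subgroup_O3_mult[OF H(1), of "ax 1 1 (t - pi)" "ax (-1) 1 pi"] H(2) e c
    by (auto simp: ax_mult)
qed (auto intro!: AX_I)

lemma grp_D3v_eq: "grp_Dv 3 = AX (\<lambda>e s t. s = 1 \<and> cos (3 * t) = e)"
  unfolding grp_Dv_def rot_e3 refl_e1
proof (rule AX_generate[OF sym_D3v])
  fix H and e s t :: real assume H: "subgroup H O3" "{ax 1 1 (2 * pi / real 3), ax (-1) 1 pi} \<subseteq> H"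
    and e: "sgn1 e" and c: "s = 1 \<and> cos (3 * t) = e"
  have "ax 1 1 t \<in> H" if "e = 1" using subgroup_ax_root[of H 3 t] H c that by auto
  moreover have "ax 1 1 (t - pi) \<in> H" if "e = -1"
    using subgroup_ax_root[of H 3 "t - pi"] H c that cos_n_shift_pi(2)[of t] by auto
  ultimately show "ax e s t \<in> H" using subgroup_O3_mult[OF H(1), of "ax 1 1 (t - pi)" "ax (-1) 1 pi"] H(2) e c
    by (auto simp: ax_mult)
next
  have "cos (3 * pi) = - 1" using cos_n_shift_pi(2)[of "2 * pi"] cos_2npi[of 3] by (simp add: mult.assoc)
  then show "\<And>x. x \<in> {ax 1 1 (2 * pi / real 3), ax (-1) 1 pi} \<Longrightarrow> x \<in> AX (\<lambda>e s t. s = 1 \<and> cos (3 * t) = e)"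
    by (auto intro!: AX_I)
qed

lemma minus_rot_e3: "- rot e3 t = ax 1 (-1) (t + pi)"
  by (simp add: rot_e3 minus_ax)

text \<open>The square of the generator is the half turn, which yields the elements with
  \<open>s = 1\<close>; those with \<open>s = -1\<close> are such an element times the
  generator.\<close>

lemma Z4m_gen: assumes H: "subgroup H O3" "ax 1 (-1) (pi / 2 + pi) \<in> H" and s: "sgn1 s" and c: "cos (2 * t) = s"
  shows "ax 1 s t \<in> H"
proof -
  have "ax 1 1 pi = ax 1 (-1) (pi / 2 + pi) ** ax 1 (-1) (pi / 2 + pi)"
    by (simp add: ax_mult) (simp add: ax_eq_iff cos_add sin_add)
  then have pi: "ax 1 1 pi \<in> H" using subgroup_O3_mult[OF H(1) H(2) H(2)] by simp
  have even: "ax 1 1 u \<in> H" if "cos (2 * u) = 1" for u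
    using subgroup_ax_root[OF H(1), of 2 u] pi that by simp
  have "ax 1 (-1) t \<in> H" if "cos (2 * t) = -1"
  proof -
    have "cos (2 * (t - (pi / 2 + pi))) = cos ((2 * t - pi) - 2 * pi)" by (simp add: algebra_simps)
    also have "\<dots> = 1" using that by (simp only: cos_diff cos_two_pi sin_two_pi) (simp add: cos_diff)
    finally have "ax 1 1 (t - (pi / 2 + pi)) \<in> H" using even by blast
    then show ?thesis using subgroup_O3_mult[OF H(1) _ H(2)] by (fastforce simp: ax_mult)
  qed
  then show ?thesis using s c even by auto
qed

lemma cos_3pi: "cos (2 * (pi / 2 + pi)) = -1"
proof -
  have "cos (2 * (pi / 2 + pi)) = cos (pi + 2 * pi)" by (simp add: algebra_simps)
  then show ?thesis by (simp only: cos_add) simp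
qed

lemma grp_Z4m_eq: "grp_Z4m = AX (\<lambda>e s t. e = 1 \<and> cos (2 * t) = s)"
  unfolding grp_Z4m_def minus_rot_e3
proof (rule AX_generate[OF sym_Z4m])
  fix H and e s t :: real assume "subgroup H O3" "{ax 1 (- 1) (pi / 2 + pi)} \<subseteq> H" "sgn1 s" "e = 1 \<and> cos (2 * t) = s"
  then show "ax e s t \<in> H" using Z4m_gen by simp
qed (use cos_3pi in \<open>auto intro!: AX_I\<close>)

lemma grp_D4h_eq: "grp_D2nh 2 = AX (\<lambda>e s t. cos (2 * t) = e * s)"
  unfolding grp_D2nh_def minus_rot_e3 rot_e1_pi
proof (rule AX_generate[OF sym_D4h])
  fix H and e s t :: real assume H: "subgroup H O3" "{ax 1 (- 1) (pi / real 2 + pi), ax (-1) (-1) 0} \<subseteq> H"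
    and e: "sgn1 e" "sgn1 s" and c: "cos (2 * t) = e * s"
  have "ax 1 (e * s) t \<in> H" using Z4m_gen[OF H(1), of "e * s" t] H(2) e c by auto
  then show "ax e s t \<in> H" using subgroup_O3_mult[OF H(1), of "ax 1 (e * s) t" "ax (-1) (-1) 0"] H(2) e
    by (auto simp: ax_mult)
qed (use cos_3pi in \<open>auto intro!: AX_I\<close>)

lemma grp_D6h_eq: "grp_D2nh 3 = AX (\<lambda>e s t. cos (3 * t) = 1)"
  unfolding grp_D2nh_def minus_rot_e3 rot_e1_pi
proof (rule AX_generate[OF sym_D6h])
  have c4: "cos (3 * (pi / real 3 + pi)) = 1"
  proof -
    have "3 * (pi / real 3 + pi) = 2 * pi + 2 * pi" by simp
    then show ?thesis by (simp only: cos_add) simp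
  qed
  then show "\<And>x. x \<in> {ax 1 (- 1) (pi / real 3 + pi), ax (-1) (-1) 0} \<Longrightarrow> x \<in> AX (\<lambda>e s t. cos (3 * t) = 1)"
    by (auto intro!: AX_I)
  fix H and e s t :: real assume H: "subgroup H O3" "{ax 1 (- 1) (pi / real 3 + pi), ax (-1) (-1) 0} \<subseteq> H"
    and e: "sgn1 e" "sgn1 s" and c: "cos (3 * t) = 1"
  let ?g = "ax 1 (- 1) (pi / real 3 + pi)"
  have g: "?g \<in> H" using H by simp
  have "?g ** ?g = ax 1 1 (2 * pi / real 3 + 2 * pi)" by (simp add: ax_mult algebra_simps)
  then have r: "ax 1 1 (2 * pi / real 3) \<in> H" using subgroup_O3_mult[OF H(1) g g] by (simp only: ax_2pi)
  have rt: "ax 1 1 u \<in> H" if "cos (3 * u) = 1" for u using subgroup_ax_root[OF H(1) _ r] that by simp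
  have "cos (3 * (t - (pi / real 3 + pi))) = 1"
  proof -
    have "3 * (t - (pi / real 3 + pi)) = (3 * t - 2 * pi) - 2 * pi" by (simp add: algebra_simps)
    then show ?thesis using c by (simp only: cos_diff cos_two_pi sin_two_pi) simp
  qed
  then have "ax 1 1 (t - (pi / real 3 + pi)) \<in> H" using rt by blast
  then have "ax 1 (-1) t \<in> H" using subgroup_O3_mult[OF H(1) _ g] by (fastforce simp: ax_mult)
  moreover have "ax 1 1 t \<in> H" using rt c by blast
  ultimately have "ax 1 (e * s) t \<in> H" using e by auto
  then show "ax e s t \<in> H" using subgroup_O3_mult[OF H(1), of "ax 1 (e * s) t" "ax (-1) (-1) 0"] H(2) e
    by (auto simp: ax_mult)
qed

lemma grp_SO2_eq: "grp_SO2 = AX (\<lambda>e s t. e = 1 \<and> s = 1)"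
  by (auto simp: grp_SO2_def rot_e3 AX_def)

lemma grp_O2_eq: "grp_O2 = AX (\<lambda>e s t. s = e)"
  unfolding grp_O2_def rot_e1_pi
proof (rule AX_generate[OF sym_O2])
  fix H and e s t :: real assume H: "subgroup H O3" "grp_SO2 \<union> {ax (- 1) (- 1) 0} \<subseteq> H" and e: "sgn1 e" "s = e"
  then have "ax 1 1 t \<in> H" by (auto simp: grp_SO2_def rot_e3)
  then show "ax e s t \<in> H" using subgroup_O3_mult[OF H(1), of "ax 1 1 t" "ax (-1) (-1) 0"] H(2) e
    by (auto simp: ax_mult)
qed (auto simp: grp_SO2_def rot_e3 intro!: AX_I)

lemma grp_O2m_eq: "grp_O2m = AX (\<lambda>e s t. s = 1)"
  unfolding grp_O2m_def refl_e1
proof (rule AX_generate[OF sym_O2m])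
  fix H and e s t :: real assume H: "subgroup H O3" "grp_SO2 \<union> {ax (- 1) 1 pi} \<subseteq> H" and e: "sgn1 e" "s = 1"
  then have "ax 1 1 t \<in> H" "ax 1 1 (t - pi) \<in> H" by (auto simp: grp_SO2_def rot_e3)
  then show "ax e s t \<in> H" using subgroup_O3_mult[OF H(1), of "ax 1 1 (t - pi)" "ax (-1) 1 pi"] H(2) e
    by (auto simp: ax_mult)
qed (auto simp: grp_SO2_def rot_e3 intro!: AX_I)

subsection \<open>The remaining three groups\<close>

definition tens_1 :: tensor3 where
  "tens_1 = vector [m3 1 0 0 0 0 0 0 0 0, m3 1 0 0 0 0 0 0 0 0, m3 0 0 0 0 0 0 0 0 1]"

definition tens_Z2m :: tensor3 where
  "tens_Z2m = vector [m3 1 0 0 0 0 0 0 0 0, m3 1 0 0 0 0 0 0 0 0, 0]"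

text \<open>The polarization of the cubic form \<open>xyz\<close>, up to a factor.\<close>

definition tens_Om :: tensor3 where
  "tens_Om = vector [m3 0 0 0 0 0 1 0 1 0, m3 0 0 1 0 0 0 1 0 0, m3 0 1 0 1 0 0 0 0 0]"

lemma tens_nth [simp]:
  "tens_1 $ 1 = m3 1 0 0 0 0 0 0 0 0" "tens_1 $ 2 = m3 1 0 0 0 0 0 0 0 0" "tens_1 $ 3 = m3 0 0 0 0 0 0 0 0 1"
  "tens_Z2m $ 1 = m3 1 0 0 0 0 0 0 0 0" "tens_Z2m $ 2 = m3 1 0 0 0 0 0 0 0 0" "tens_Z2m $ 3 = 0"
  "tens_Om $ 1 = m3 0 0 0 0 0 1 0 1 0" "tens_Om $ 2 = m3 0 0 1 0 0 0 1 0 0" "tens_Om $ 3 = m3 0 1 0 1 0 0 0 0 0"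
  by (simp_all add: tens_1_def tens_Z2m_def tens_Om_def)

lemma tens_Piez [simp]: "tens_1 \<in> Piez" "tens_Z2m \<in> Piez" "tens_Om \<in> Piez"
  by (simp_all add: Piez_def forall_3)

text \<open>The fixed trace vectors (1, 1, 1) and (1, 0, 1) leave only the identity and the
  reflection in their plane, and this reflection does not commute with the Gram matrix. All these
  conditions are linear in \<open>g\<close>.\<close>

lemma sym_1: "sym_group tens_1 = grp_1"
proof -
  have "g = mat 1" if g: "g \<in> sym_group tens_1" for g
  proof -
    have v: "g *v trace_vec tens_1 = trace_vec tens_1" "g *v trace_vec (cyc tens_1) = trace_vec (cyc tens_1)"
      using sym_group_trace_vec g sym_group_cyc by blast+
    have b: "g ** gram_mat tens_1 = gram_mat tens_1 ** g" using sym_group_gram_mat[OF g] .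
    have "trace_vec tens_1 = vector [1, 1, 1]" "trace_vec (cyc tens_1) = vector [1, 0, 1]"
      by (simp_all add: vec3_eq_iff trace_vec_def trace3 cyc_def)
    moreover have "gram_mat tens_1 = m3 1 1 0 1 1 0 0 0 1"
      by (simp add: mat3_eq_iff gram_mat_def inner_vec_def sum_3)
    ultimately have V: "(g *v vector [1, 1, 1]) $ i = vector [1, 1, 1] $ i" "(g *v vector [1, 0, 1]) $ i = vector [1, 0, 1] $ i"
      and B: "(g ** m3 1 1 0 1 1 0 0 0 1) $ i $ j = (m3 1 1 0 1 1 0 0 0 1 ** g) $ i $ j" for i j
      using v b by simp_all
    have "g$1$1 + g$1$2 + g$1$3 = 1" "g$2$1 + g$2$2 + g$2$3 = 1" "g$3$1 + g$3$2 + g$3$3 = 1"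
      using V(1)[of 1] V(1)[of 2] V(1)[of 3] unfolding mv3_nth by simp_all
    moreover have "g$1$1 + g$1$3 = 1" "g$2$1 + g$2$3 = 0" "g$3$1 + g$3$3 = 1"
      using V(2)[of 1] V(2)[of 2] V(2)[of 3] unfolding mv3_nth by simp_all
    moreover have "g$1$2 = g$2$1" using B[of 1 1] unfolding mult3_nth by simp
    moreover have "g$2$3 = 0" using B[of 1 3] unfolding mult3_nth by simp
    moreover have "g$1$1 = g$2$2" using B[of 1 2] unfolding mult3_nth by simp
    moreover have "g$3$1 = 0" using B[of 3 2] unfolding mult3_nth by simp
    ultimately
    show ?thesis unfolding mat3_eq_iff mat_1_m3 m3_nth by linarith
  qed
  then show ?thesis using sym_group_one by (auto simp: grp_1_def)
qed

text \<open>The trace vectors (1, 1, 0) and (1, 0, 0) are fixed, so only the sign on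
  \<open>e3\<close> is free, and no nonzero component of \<open>tens_Z2m\<close> has an index
  3.\<close>

lemma grp_Z2m_eq: "grp_Z2m = {mat 1, ax 1 (-1) 0}" and sym_Z2m: "sym_group tens_Z2m = grp_Z2m"
proof -
  have "g = mat 1 \<or> g = ax 1 (-1) 0" if g: "g \<in> sym_group tens_Z2m" for g
  proof -
    have v: "g *v trace_vec tens_Z2m = trace_vec tens_Z2m" "g *v trace_vec (cyc tens_Z2m) = trace_vec (cyc tens_Z2m)"
      using sym_group_trace_vec g sym_group_cyc by blast+
    have "trace_vec tens_Z2m = vector [1, 1, 0]" "trace_vec (cyc tens_Z2m) = vector [1, 0, 0]"
      by (simp_all add: vec3_eq_iff trace_vec_def trace3 cyc_def)
    then have c: "g$1$1 = 1" "g$2$1 = 0" "g$3$1 = 0" "g$1$2 = 0" "g$2$2 = 1" "g$3$2 = 0"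
      using v by (simp_all add: vec3_eq_iff mv3_nth)
    then have "g$1$3 = 0" "g$2$3 = 0" "g$3$3 * g$3$3 = 1"
      using orthogonal_cols[OF sym_group_orth[OF g], of 1 3] orthogonal_cols[OF sym_group_orth[OF g], of 2 3]
        orthogonal_cols[OF sym_group_orth[OF g], of 3 3] by auto
    then show ?thesis using c by (auto simp: mat3_eq_iff mat_1_m3 ax_def square_eq_1_iff)
  qed
  then have 1: "sym_group tens_Z2m \<subseteq> {mat 1, ax 1 (-1) 0}" by blast
  have "ax 1 (-1) 0 \<star> tens_Z2m = tens_Z2m"
    by (simp add: tensor3_eq_iff ax_act_nth ax_conj_mat) (simp add: conj_mat_def mat3_eq_iff mult3_nth)
  then have "ax 1 (-1) 0 \<in> sym_group tens_Z2m" by (simp add: mem_sym_group)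
  then have 2: "grp_Z2m \<subseteq> sym_group tens_Z2m"
    unfolding grp_Z2m_def refl_e3 by (intro generate_O3_subset subgroup_sym_group) simp
  have 3: "{mat 1, ax 1 (-1) 0} \<subseteq> grp_Z2m"
    unfolding grp_Z2m_def refl_e3 using generate.one[of O3] by (auto intro: generate.incl)
  show "grp_Z2m = {mat 1, ax 1 (-1) 0}" "sym_group tens_Z2m = grp_Z2m" using 1 2 3 by blast+
qed

lemma m3_mult: "m3 a b c d e f g h i ** m3 a' b' c' d' e' f' g' h' i' =
  m3 (a*a' + b*d' + c*g') (a*b' + b*e' + c*h') (a*c' + b*f' + c*i')
     (d*a' + e*d' + f*g') (d*b' + e*e' + f*h') (d*c' + e*f' + f*i')
     (g*a' + h*d' + i*g') (g*b' + h*e' + i*h') (g*c' + h*f' + i*i')"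
  by (simp add: mat3_eq_iff mult3_nth)

text \<open>A half turn depends only on the line of its axis, so the norm of \<open>n\<close> enters
  through \<open>n \<bullet> n\<close> and no square root appears.\<close>

lemma rot_pi_nth:
  assumes "n \<noteq> 0"
  shows "rot n pi $ i $ j = 2 * (n$i * n$j) / (n \<bullet> n) - (if i = j then 1 else 0)"
proof -
  have s: "norm (sgn n) = 1" using assms by (simp add: norm_sgn)
  have k: "sgn n $ k * sgn n $ l = n$k * n$l / (n \<bullet> n)" for k l
    by (simp add: sgn_div_norm dot_square_norm power2_eq_square divide_inverse mult_ac)
  have "rot (sgn n) pi $ i $ j = 2 * (sgn n $ i * sgn n $ j) - (if i = j then 1 else 0)"
    using exhaust_3[of i] exhaust_3[of j] unfolding rot_eq_m3[OF s] by auto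
  then show ?thesis by (simp add: k rot_sgn)
qed

lemma Om_gen_eq: "- rot e3 (pi / 2) = m3 0 1 0 (-1) 0 0 0 0 (-1)"
  "refl_plane (e2 - e3) = m3 1 0 0 0 0 1 0 1 0"
proof -
  show "- rot e3 (pi / 2) = m3 0 1 0 (-1) 0 0 0 0 (-1)"
    by (simp add: rot_e3 ax_def mat3_eq_iff)
  have n: "e2 - e3 \<noteq> (0 :: real^3)" by (simp add: vec3_eq_iff)
  show "refl_plane (e2 - e3) = m3 1 0 0 0 0 1 0 1 0"
    unfolding mat3_eq_iff refl_plane_def vector_uminus_component rot_pi_nth[OF n]
    by (simp add: inner_vec_def sum_3)
qed

text \<open>The signed permutation matrices that preserve the cubic form \<open>xyz\<close>.\<close>

definition OM :: "mat3 set" where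
  "OM = (\<Union>(x,y,z)\<in>{(x,y,z). sgn1 x \<and> sgn1 y \<and> sgn1 z \<and> x * y * z = 1}.
     {m3 x 0 0 0 y 0 0 0 z, m3 x 0 0 0 0 y 0 z 0, m3 0 x 0 y 0 0 0 0 z,
      m3 0 0 x 0 y 0 z 0 0, m3 0 x 0 0 0 y z 0 0, m3 0 0 x y 0 0 0 z 0})"

lemma orth_kernel: "orthogonal_matrix (g::mat3) \<Longrightarrow> g *v u = 0 \<Longrightarrow> u = 0"
  by (metis orth_cancel(7) matrix_vector_mult_0_right)

text \<open>The vector \<open>u\<close> is the gradient of xyz at row \<open>i\<close> of
  \<open>g\<close>. Invariance makes \<open>g *v u\<close> proportional to the components of
  \<open>tens_Om\<close> with a repeated index \<open>i\<close>, which vanish; hence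
  \<open>u = 0\<close>.\<close>

lemma sym_Om_monomial:
  assumes g: "g \<in> sym_group tens_Om"
  shows "g$i$1 * g$i$2 = 0" "g$i$1 * g$i$3 = 0" "g$i$2 * g$i$3 = 0"
proof -
  have o: "orthogonal_matrix g" and act: "g \<star> tens_Om = tens_Om" using g by (simp_all add: mem_sym_group)
  define u where "u = (vector [g$i$2 * g$i$3, g$i$1 * g$i$3, g$i$1 * g$i$2] :: real^3)"
  have "(g *v u) $ j = 0" for j
  proof -
    have "(g \<star> tens_Om) $ j $ i $ i = 2 * (g *v u) $ j"
      by (simp add: u_def mv3_nth act_def sum_3 algebra_simps)
    moreover have "tens_Om $ j $ i $ i = 0" using exhaust_3[of i] exhaust_3[of j] by auto
    ultimately show ?thesis using act by simp
  qed
  then have "g *v u = 0" by (simp add: vec_eq_iff)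
  then have "u = 0" using orth_kernel[OF o] by blast
  then show "g$i$1 * g$i$2 = 0" "g$i$1 * g$i$3 = 0" "g$i$2 * g$i$3 = 0" by (simp_all add: u_def vec3_eq_iff)
qed

text \<open>Each row is left with a single nonzero entry, a sign, and orthogonality of the rows puts
  these entries into different columns.\<close>

lemma monomial_forms:
  assumes o: "orthogonal_matrix (g::mat3)"
    and z: "\<And>i. g$i$1 * g$i$2 = 0" "\<And>i. g$i$1 * g$i$3 = 0" "\<And>i. g$i$2 * g$i$3 = 0"
  obtains x y z where "sgn1 x" "sgn1 y" "sgn1 z"
    "g \<in> {m3 x 0 0 0 y 0 0 0 z, m3 x 0 0 0 0 y 0 z 0, m3 0 x 0 y 0 0 0 0 z,
      m3 0 0 x 0 y 0 z 0 0, m3 0 x 0 0 0 y z 0 0, m3 0 0 x y 0 0 0 z 0}"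
proof -
  have row: "(sgn1 (g$i$1) \<and> g$i$2 = 0 \<and> g$i$3 = 0) \<or> (g$i$1 = 0 \<and> sgn1 (g$i$2) \<and> g$i$3 = 0) \<or>
     (g$i$1 = 0 \<and> g$i$2 = 0 \<and> sgn1 (g$i$3))" for i
    using orthogonal_rows[OF o, of i i] z[of i] by (auto simp: square_eq_1_iff)
  have r12: "g$1$1 * g$2$1 + g$1$2 * g$2$2 + g$1$3 * g$2$3 = 0"
    and r13: "g$1$1 * g$3$1 + g$1$2 * g$3$2 + g$1$3 * g$3$3 = 0"
    and r23: "g$2$1 * g$3$1 + g$2$2 * g$3$2 + g$2$3 * g$3$3 = 0"
    using orthogonal_rows[OF o, of 1 2] orthogonal_rows[OF o, of 1 3] orthogonal_rows[OF o, of 2 3] by simp_all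
  have sn: "sgn1 x \<Longrightarrow> x \<noteq> 0" for x by auto
  define k where "k i = g$i$1 + g$i$2 + g$i$3" for i
  have k: "sgn1 (k i)" for i using row[of i] by (auto simp: k_def)
  have "g \<in> {m3 (k 1) 0 0 0 (k 2) 0 0 0 (k 3), m3 (k 1) 0 0 0 0 (k 2) 0 (k 3) 0, m3 0 (k 1) 0 (k 2) 0 0 0 0 (k 3),
      m3 0 0 (k 1) 0 (k 2) 0 (k 3) 0 0, m3 0 (k 1) 0 0 0 (k 2) (k 3) 0 0, m3 0 0 (k 1) (k 2) 0 0 0 (k 3) 0}"
  proof -
    have row': "(g$i$1 = k i \<and> g$i$2 = 0 \<and> g$i$3 = 0) \<or> (g$i$1 = 0 \<and> g$i$2 = k i \<and> g$i$3 = 0) \<or>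
       (g$i$1 = 0 \<and> g$i$2 = 0 \<and> g$i$3 = k i)" for i
      using row[of i] by (auto simp: k_def)
    have "k 1 \<noteq> 0" "k 2 \<noteq> 0" "k 3 \<noteq> 0" using k sn by blast+
    then show ?thesis
      using row'[of 1] row'[of 2] row'[of 3] r12 r13 r23
      unfolding insert_iff mat3_eq_iff m3_nth by (elim disjE conjE) simp_all
  qed
  then show ?thesis using that[of "k 1" "k 2" "k 3"] k by blast
qed

lemma sym_Om_subset: "sym_group tens_Om \<subseteq> OM"
proof
  fix g assume g: "g \<in> sym_group tens_Om"
  have o: "orthogonal_matrix g" and act: "g \<star> tens_Om = tens_Om" using g by (simp_all add: mem_sym_group)
  obtain x y z where xyz: "sgn1 x" "sgn1 y" "sgn1 z" and f:
    "g \<in> {m3 x 0 0 0 y 0 0 0 z, m3 x 0 0 0 0 y 0 z 0, m3 0 x 0 y 0 0 0 0 z,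
      m3 0 0 x 0 y 0 z 0 0, m3 0 x 0 0 0 y z 0 0, m3 0 0 x y 0 0 0 z 0}"
    using monomial_forms[OF o sym_Om_monomial[OF g]] by blast
  \<comment> \<open>The right-hand side is the permanent of \<open>g\<close>, which for a monomial
    matrix is the product of its nonzero entries.\<close>
  have "(g \<star> tens_Om) $ 1 $ 2 $ 3 =
      g$1$1 * (g$2$2 * g$3$3 + g$2$3 * g$3$2) + g$1$2 * (g$2$1 * g$3$3 + g$2$3 * g$3$1) + g$1$3 * (g$2$1 * g$3$2 + g$2$2 * g$3$1)"
    by (simp add: act_def sum_3 algebra_simps)
  then have p: "g$1$1 * (g$2$2 * g$3$3 + g$2$3 * g$3$2) + g$1$2 * (g$2$1 * g$3$3 + g$2$3 * g$3$1) + g$1$3 * (g$2$1 * g$3$2 + g$2$2 * g$3$1) = 1"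
    by (simp add: act)
  have "x * y * z = 1" using f p unfolding insert_iff by (elim disjE) (simp_all only: m3_nth mult_zero_left mult_zero_right add_0_left add_0_right mult_ac empty_iff)
  then show "g \<in> OM" unfolding OM_def using xyz f by blast
qed

text \<open>Modulo its four diagonal elements, \<open>OM\<close> permutes the three axes, and 1,
  \<open>b\<close>, \<open>a\<close>, \<open>bab\<close>, \<open>ba\<close>, \<open>ab\<close>
  represent the six permutations.\<close>

lemma Om_generated:
  assumes H: "subgroup H O3" and a: "m3 0 1 0 (-1) 0 0 0 0 (-1) \<in> H" and b: "m3 1 0 0 0 0 1 0 1 0 \<in> H"
  shows "OM \<subseteq> H"
proof -
  note mult = subgroup_O3_mult[OF H]
  have a2: "m3 (-1) 0 0 0 (-1) 0 0 0 1 \<in> H" using mult[OF a a] by (simp add: m3_mult)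
  have c: "m3 (-1) 0 0 0 1 0 0 0 (-1) \<in> H" using mult[OF mult[OF b a2] b] by (simp add: m3_mult)
  have d: "m3 1 0 0 0 (-1) 0 0 0 (-1) \<in> H" using mult[OF a2 c] by (simp add: m3_mult)
  have diag: "m3 x 0 0 0 y 0 0 0 z \<in> H" if "sgn1 x" "sgn1 y" "sgn1 z" "x * y * z = 1" for x y z
    using that a2 c d subgroup_O3_one[OF H] by (auto simp: mat_1_m3)
  note ab = mult[OF a b] and ba = mult[OF b a] and bab = mult[OF mult[OF b a] b]
  have "m3 x 0 0 0 0 y 0 z 0 \<in> H" "m3 0 x 0 y 0 0 0 0 z \<in> H" "m3 0 0 x 0 y 0 z 0 0 \<in> H"
    "m3 0 x 0 0 0 y z 0 0 \<in> H" "m3 0 0 x y 0 0 0 z 0 \<in> H"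
    if xyz: "sgn1 x" "sgn1 y" "sgn1 z" "x * y * z = 1" for x y z
  proof -
    \<comment> \<open>The signs in \<open>d2\<close> cancel the row signs 1, -1, -1 that
      \<open>a\<close>, \<open>ab\<close>, \<open>ba\<close> and \<open>bab\<close> share.\<close>
    have d1: "m3 x 0 0 0 y 0 0 0 z \<in> H" and d2: "m3 x 0 0 0 (- y) 0 0 0 (- z) \<in> H" using diag xyz by auto
    show "m3 x 0 0 0 0 y 0 z 0 \<in> H" using mult[OF d1 b] by (simp add: m3_mult)
    show "m3 0 x 0 y 0 0 0 0 z \<in> H" using mult[OF d2 a] by (simp add: m3_mult)
    show "m3 0 0 x 0 y 0 z 0 0 \<in> H" using mult[OF d2 bab] by (simp add: m3_mult)
    show "m3 0 x 0 0 0 y z 0 0 \<in> H" using mult[OF d2 ba] by (simp add: m3_mult)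
    show "m3 0 0 x y 0 0 0 z 0 \<in> H" using mult[OF d2 ab] by (simp add: m3_mult)
  qed
  then show ?thesis using diag unfolding OM_def by auto
qed

lemma orth_m3_Om: "orthogonal_matrix (m3 0 1 0 (-1) 0 0 0 0 (-1))" "orthogonal_matrix (m3 1 0 0 0 0 1 0 1 0)"
  unfolding orthogonal_matrix_def mat3_eq_iff by (simp_all add: mult3_nth mat_1_m3)

lemma conj_mat_m3: "conj_mat (m3 a b c d e f g h i) X = m3 a b c d e f g h i ** X ** m3 a d g b e h c f i"
  by (simp add: conj_mat_def mat3_eq_iff mult3_nth)

lemma Om_gens_sym: "m3 0 1 0 (-1) 0 0 0 0 (-1) \<in> sym_group tens_Om" "m3 1 0 0 0 0 1 0 1 0 \<in> sym_group tens_Om"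
  by (simp_all add: mem_sym_group orth_m3_Om tensor3_eq_iff act_nth3 conj_mat_m3 m3_mult)
     (simp_all add: mat3_eq_iff)

lemma grp_Om_eq: "grp_Om = OM" and sym_Om: "sym_group tens_Om = grp_Om"
proof -
  have s: "subgroup grp_Om O3"
    unfolding grp_Om_def Om_gen_eq by (rule subgroup_generate_O3) (use orth_m3_Om in blast)
  have "m3 0 1 0 (-1) 0 0 0 0 (-1) \<in> grp_Om" "m3 1 0 0 0 0 1 0 1 0 \<in> grp_Om"
    unfolding grp_Om_def Om_gen_eq by (auto intro: generate.incl)
  then have 1: "OM \<subseteq> grp_Om" by (rule Om_generated[OF s])
  have 2: "grp_Om \<subseteq> sym_group tens_Om"
    unfolding grp_Om_def Om_gen_eq by (intro generate_O3_subset subgroup_sym_group) (use Om_gens_sym in blast)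
  show "grp_Om = OM" "sym_group tens_Om = grp_Om" using 1 2 sym_Om_subset by blast+
qed

subsection \<open>Determinants and traces\<close>

text \<open>By Euler's theorem the trace gives the cosine of the angle, hence the angle up to sign,
  and reversing the axis absorbs the sign.\<close>

lemma rot_iff_trace:
  assumes "orthogonal_matrix g"
  shows "(\<exists>n. n \<noteq> 0 \<and> g = rot n t) \<longleftrightarrow> det g = 1 \<and> trace g = 1 + 2 * cos t"
proof
  assume "\<exists>n. n \<noteq> 0 \<and> g = rot n t"
  then obtain n where n: "norm (sgn n) = 1" "g = rot (sgn n) t" by (auto simp: rot_sgn norm_sgn)
  show "det g = 1 \<and> trace g = 1 + 2 * cos t" unfolding n(2) using n(1) by (simp add: rot_det rot_trace)
next
  assume "det g = 1 \<and> trace g = 1 + 2 * cos t"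
  moreover obtain n u where n: "norm n = 1" "g = rot n u"
    using euler_rotation[OF assms] calculation by metis
  ultimately have c: "cos u = cos t" using rot_trace[OF n(1), of u] by simp
  then have "(sin u)\<^sup>2 = (sin t)\<^sup>2" by (simp add: sin_squared_eq)
  then have "sin u = sin t \<or> sin u = - sin t" by (simp add: power2_eq_iff)
  then have "g = rot n t \<or> g = rot (- n) t"
    unfolding n(2) rot_minus using c by (auto simp: rot_def)
  moreover have "n \<noteq> 0" "- n \<noteq> 0" using n(1) by auto
  ultimately show "\<exists>n. n \<noteq> 0 \<and> g = rot n t" by blast
qed

definition has_el :: "mat3 set \<Rightarrow> real \<Rightarrow> real \<Rightarrow> bool" where
  "has_el H d \<tau> \<longleftrightarrow> (\<exists>g\<in>H. det g = d \<and> trace g = \<tau>)"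

definition two_half_turns :: "mat3 set \<Rightarrow> bool" where
  "two_half_turns H \<longleftrightarrow> (\<exists>g\<in>H. \<exists>h\<in>H. g \<noteq> h \<and> det g = 1 \<and> trace g = -1 \<and> det h = 1 \<and> trace h = -1)"

text \<open>Conjugation invariants that separate the sixteen groups. A half turn is a proper element of
  trace \<open>-1\<close> and a plane reflection an improper element of trace \<open>1\<close>.\<close>

definition signature :: "mat3 set \<Rightarrow> bool list" where
  "signature H = [has_el H 1 0, two_half_turns H, has_el H 1 (-1), has_el H (-1) 1,
     has_el H (-1) (-1), has_el H 1 1, has_el H (-1) (-2)]"

text \<open>The traces single out half turns and plane reflections; the involution
  \<open>- mat 1\<close> has trace -3 and stays out.\<close>

definition ord2 :: "mat3 set \<Rightarrow> mat3 set" where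
  "ord2 H = {g \<in> H. (det g = 1 \<and> trace g = -1) \<or> (det g = -1 \<and> trace g = 1)}"

lemma conj_inj: "orthogonal_matrix (g::mat3) \<Longrightarrow> g ** x ** transpose g = g ** y ** transpose g \<Longrightarrow> x = y"
  by (metis matrix_mul_assoc orth_cancel(4,6))

lemma signature_conjugate_by:
  assumes "orthogonal_matrix g"
  shows "signature (conjugate_by g H) = signature H"
proof -
  have "has_el (conjugate_by g H) d t = has_el H d t" for d t
    unfolding has_el_def conjugate_by_eq[OF assms]
    by (simp add: det_orthogonal_conj[OF assms] trace_orthogonal_conj[OF assms])
  moreover have "two_half_turns (conjugate_by g H) = two_half_turns H"
  proof -
    have "g ** x ** transpose g = g ** y ** transpose g \<longleftrightarrow> x = y" for x y using conj_inj[OF assms] by blast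
    then show ?thesis
      unfolding two_half_turns_def conjugate_by_eq[OF assms]
      by (simp add: det_orthogonal_conj[OF assms] trace_orthogonal_conj[OF assms])
  qed
  ultimately show ?thesis by (simp add: signature_def)
qed

lemma signature_conj_class: "conj_class H = conj_class K \<Longrightarrow> signature H = signature K"
  unfolding conj_class_eq_iff using signature_conjugate_by by blast

text \<open>For \<open>e = 1\<close> the trace determines \<open>cos t\<close>; for
  \<open>e = -1\<close> it equals \<open>s\<close> whatever \<open>t\<close> is, so only the
  existence of an admissible cosine counts. Every point of [-1, 1] is a cosine, which eliminates
  \<open>t\<close>.\<close>

lemma has_el_AX:
  shows "has_el (AX (\<lambda>e s t. \<phi> e s (cos t))) 1 \<tau> \<longleftrightarrow>
      (\<bar>\<tau> - 1\<bar> \<le> 2 \<and> \<phi> 1 1 ((\<tau> - 1) / 2)) \<or> (\<tau> = -1 \<and> (\<exists>c\<in>{-1..1}. \<phi> (-1) (-1) c))" (is ?A)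
    and "has_el (AX (\<lambda>e s t. \<phi> e s (cos t))) (-1) \<tau> \<longleftrightarrow>
      (\<bar>\<tau> + 1\<bar> \<le> 2 \<and> \<phi> 1 (-1) ((\<tau> + 1) / 2)) \<or> (\<tau> = 1 \<and> (\<exists>c\<in>{-1..1}. \<phi> (-1) 1 c))" (is ?B)
proof -
  have h: "has_el (AX (\<lambda>e s t. \<phi> e s (cos t))) d \<tau> \<longleftrightarrow>
    (\<exists>e s t. sgn1 e \<and> sgn1 s \<and> \<phi> e s (cos t) \<and> e * s = d \<and> (1 + e) * cos t + s = \<tau>)" for d
  proof -
    have "(\<exists>g\<in>AX \<Phi>. \<psi> g) \<longleftrightarrow> (\<exists>e s t. sgn1 e \<and> sgn1 s \<and> \<Phi> e s t \<and> \<psi> (ax e s t))" for \<Phi> \<psi>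
      unfolding AX_def by blast
    then show ?thesis unfolding has_el_def by (simp add: ax_det ax_trace)
  qed
  have c: "(\<exists>t. \<psi> (cos t)) \<longleftrightarrow> (\<exists>c\<in>{-1..1}. \<psi> c)" for \<psi> :: "real \<Rightarrow> bool"
  proof
    assume "\<exists>c\<in>{-1..1}. \<psi> c"
    then obtain c where "-1 \<le> c" "c \<le> 1" "\<psi> c" by auto
    then show "\<exists>t. \<psi> (cos t)" by (intro exI[of _ "arccos c"]) simp
  qed auto
  have "has_el (AX (\<lambda>e s t. \<phi> e s (cos t))) 1 \<tau> \<longleftrightarrow>
     (\<exists>t. \<phi> 1 1 (cos t) \<and> 2 * cos t + 1 = \<tau>) \<or> (\<tau> = -1 \<and> (\<exists>t. \<phi> (-1) (-1) (cos t)))"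
    unfolding h by auto (force+)?
  moreover have "(\<exists>c\<in>{-1..1}. \<phi> 1 1 c \<and> 2 * c + 1 = \<tau>) \<longleftrightarrow> \<bar>\<tau> - 1\<bar> \<le> 2 \<and> \<phi> 1 1 ((\<tau> - 1) / 2)"
  proof -
    have "2 * c + 1 = \<tau> \<longleftrightarrow> c = (\<tau> - 1) / 2" for c by (simp add: field_simps; argo)
    moreover have "(\<tau> - 1) / 2 \<in> {-1..1} \<longleftrightarrow> \<bar>\<tau> - 1\<bar> \<le> 2" by auto
    ultimately show ?thesis by metis
  qed
  ultimately show ?A unfolding c[of "\<lambda>c. \<phi> 1 1 c \<and> 2 * c + 1 = \<tau>"] c[of "\<phi> (-1) (-1)"] by blast
  have "has_el (AX (\<lambda>e s t. \<phi> e s (cos t))) (-1) \<tau> \<longleftrightarrow>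
     (\<exists>t. \<phi> 1 (-1) (cos t) \<and> 2 * cos t - 1 = \<tau>) \<or> (\<tau> = 1 \<and> (\<exists>t. \<phi> (-1) 1 (cos t)))"
    unfolding h by auto (force+)?
  moreover have "(\<exists>c\<in>{-1..1}. \<phi> 1 (-1) c \<and> 2 * c - 1 = \<tau>) \<longleftrightarrow> \<bar>\<tau> + 1\<bar> \<le> 2 \<and> \<phi> 1 (-1) ((\<tau> + 1) / 2)"
  proof -
    have "2 * c - 1 = \<tau> \<longleftrightarrow> c = (\<tau> + 1) / 2" for c by (simp add: field_simps; argo)
    moreover have "(\<tau> + 1) / 2 \<in> {-1..1} \<longleftrightarrow> \<bar>\<tau> + 1\<bar> \<le> 2" by auto
    ultimately show ?thesis by metis
  qed
  ultimately show ?B unfolding c[of "\<lambda>c. \<phi> 1 (-1) c \<and> 2 * c - 1 = \<tau>"] c[of "\<phi> (-1) 1"] by blast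
qed

text \<open>Every \<open>ax (-1) (-1) t\<close> is a half turn about a horizontal axis, and
  different cosines give different matrices.\<close>

lemma two_half_turns_AX:
  assumes "\<phi> (-1) (-1) c" "\<phi> (-1) (-1) c'" "c \<noteq> c'" "c \<in> {-1..1}" "c' \<in> {-1..1}"
  shows "two_half_turns (AX (\<lambda>e s t. \<phi> e s (cos t)))"
  unfolding two_half_turns_def
  by (rule bexI[of _ "ax (-1) (-1) (arccos c)"], rule bexI[of _ "ax (-1) (-1) (arccos c')"])
     (use assms in \<open>auto simp: ax_det ax_trace ax_eq_iff intro!: AX_I\<close>)

lemma AX_half_turn:
  assumes "g \<in> AX (\<lambda>e s t. \<phi> e s (cos t))" "det g = 1" "trace g = -1" "\<And>c. \<not> \<phi> (-1) (-1) c"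
  shows "g = ax 1 1 pi"
proof -
  obtain e s t where est: "sgn1 e" "sgn1 s" "g = ax e s t" "\<phi> e s (cos t)" using assms(1) by (auto simp: AX_def)
  then have "e = 1" "s = 1" using assms by (auto simp: ax_det)
  then have "cos t = -1" using assms est by (simp add: ax_trace)
  then show ?thesis using est \<open>e = 1\<close> \<open>s = 1\<close> cos_pm1_sin_0[of t] by (simp add: ax_eq_iff)
qed

lemma not_two_half_turns_AX:
  assumes "\<And>c. \<not> \<phi> (-1) (-1) c"
  shows "\<not> two_half_turns (AX (\<lambda>e s t. \<phi> e s (cos t)))"
  unfolding two_half_turns_def using AX_half_turn[where \<phi> = \<phi>] assms by metis

text \<open>cos (3 t) - 1 and cos (3 t) + 1 are a linear factor times a square in
  \<open>cos t\<close>. The conditions defining the groups thereby take the form in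
  \<open>cos t\<close> that \<open>has_el_AX\<close> expects.\<close>

lemma cos_multiple_angle:
  "cos (2 * t) = 1 \<longleftrightarrow> cos t = 1 \<or> cos t = -1" "cos (2 * t) = -1 \<longleftrightarrow> cos t = 0"
  "cos (3 * t) = 1 \<longleftrightarrow> cos t = 1 \<or> cos t = -1/2" "cos (3 * t) = -1 \<longleftrightarrow> cos t = -1 \<or> cos t = 1/2" for t :: real
proof -
  have c2: "cos (2 * t) = 2 * (cos t)\<^sup>2 - 1" by (simp add: cos_double_cos)
  show "cos (2 * t) = 1 \<longleftrightarrow> cos t = 1 \<or> cos t = -1" unfolding c2 by (auto simp: power2_eq_1_iff)
  show "cos (2 * t) = -1 \<longleftrightarrow> cos t = 0" unfolding c2 by auto
  have c3: "cos (3 * t) = 4 * cos t ^ 3 - 3 * cos t" by (rule cos_treble_cos)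
  have "cos (3 * t) - 1 = (cos t - 1) * (2 * cos t + 1)\<^sup>2" "cos (3 * t) + 1 = (cos t + 1) * (2 * cos t - 1)\<^sup>2"
    unfolding c3 by (simp_all add: power2_eq_square power3_eq_cube algebra_simps)
  then have "cos (3 * t) = 1 \<longleftrightarrow> cos t - 1 = 0 \<or> 2 * cos t + 1 = 0" "cos (3 * t) = -1 \<longleftrightarrow> cos t + 1 = 0 \<or> 2 * cos t - 1 = 0"
    by (metis eq_iff_diff_eq_0 mult_eq_0_iff power2_eq_square, metis add.inverse_inverse add_eq_0_iff mult_eq_0_iff power2_eq_square)
  then show "cos (3 * t) = 1 \<longleftrightarrow> cos t = 1 \<or> cos t = -1/2" "cos (3 * t) = -1 \<longleftrightarrow> cos t = -1 \<or> cos t = 1/2"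
    by auto
qed

subsection \<open>Signatures of the sixteen groups\<close>

lemma Z2_cos: "grp_Z 2 = AX (\<lambda>e s t. e = 1 \<and> s = 1 \<and> (cos t = 1 \<or> cos t = -1))"
  unfolding grp_Z2_eq by (rule AX_cong) (auto simp: cos_multiple_angle)

lemma sig_Z2: "signature (grp_Z 2) = [False, False, True, False, False, False, False]"
  unfolding signature_def Z2_cos has_el_AX[where \<phi> = "(\<lambda>(e::real) (s::real) (c::real). e = 1 \<and> s = 1 \<and> (c = 1 \<or> c = -1))"]
  \<comment> \<open>The values 1, 0 and -1 are the cosines tried as witnesses in
    \<open>has_el_AX\<close>, here and in the signatures that follow.\<close>
  using not_two_half_turns_AX[where \<phi> = "(\<lambda>(e::real) (s::real) (c::real). e = 1 \<and> s = 1 \<and> (c = 1 \<or> c = -1))"] by (auto intro: bexI[of _ 1] bexI[of _ 0] bexI[of _ "-1"])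

lemma Z3_cos: "grp_Z 3 = AX (\<lambda>e s t. e = 1 \<and> s = 1 \<and> (cos t = 1 \<or> cos t = -1/2))"
  unfolding grp_Z3_eq by (rule AX_cong) (auto simp: cos_multiple_angle)

lemma sig_Z3: "signature (grp_Z 3) = [True, False, False, False, False, False, False]"
  unfolding signature_def Z3_cos has_el_AX[where \<phi> = "(\<lambda>(e::real) (s::real) (c::real). e = 1 \<and> s = 1 \<and> (c = 1 \<or> c = -1/2))"]
  using not_two_half_turns_AX[where \<phi> = "(\<lambda>(e::real) (s::real) (c::real). e = 1 \<and> s = 1 \<and> (c = 1 \<or> c = -1/2))"] by (auto intro: bexI[of _ 1] bexI[of _ 0] bexI[of _ "-1"])

lemma D2_cos: "grp_D 2 = AX (\<lambda>e s t. s = e \<and> (cos t = 1 \<or> cos t = -1))"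
  unfolding grp_D2_eq by (rule AX_cong) (auto simp: cos_multiple_angle)

lemma sig_D2: "signature (grp_D 2) = [False, True, True, False, False, False, False]"
  unfolding signature_def D2_cos has_el_AX[where \<phi> = "(\<lambda>(e::real) (s::real) (c::real). s = e \<and> (c = 1 \<or> c = -1))"]
  using two_half_turns_AX[where \<phi> = "(\<lambda>(e::real) (s::real) (c::real). s = e \<and> (c = 1 \<or> c = -1))" and c = "1" and c' = "(-1)"] by (auto intro: bexI[of _ 1] bexI[of _ 0] bexI[of _ "-1"])

lemma D3_cos: "grp_D 3 = AX (\<lambda>e s t. s = e \<and> (cos t = 1 \<or> cos t = -1/2))"
  unfolding grp_D3_eq by (rule AX_cong) (auto simp: cos_multiple_angle)

lemma sig_D3: "signature (grp_D 3) = [True, True, True, False, False, False, False]"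
  unfolding signature_def D3_cos has_el_AX[where \<phi> = "(\<lambda>(e::real) (s::real) (c::real). s = e \<and> (c = 1 \<or> c = -1/2))"]
  using two_half_turns_AX[where \<phi> = "(\<lambda>(e::real) (s::real) (c::real). s = e \<and> (c = 1 \<or> c = -1/2))" and c = "1" and c' = "(-1/2)"] by (auto intro: bexI[of _ 1] bexI[of _ 0] bexI[of _ "-1"])

lemma D2v_cos: "grp_Dv 2 = AX (\<lambda>e s t. s = 1 \<and> (cos t = 1 \<or> cos t = -1))"
  unfolding grp_D2v_eq by (rule AX_cong) (auto simp: cos_multiple_angle)

lemma sig_D2v: "signature (grp_Dv 2) = [False, False, True, True, False, False, False]"
  unfolding signature_def D2v_cos has_el_AX[where \<phi> = "(\<lambda>(e::real) (s::real) (c::real). s = 1 \<and> (c = 1 \<or> c = -1))"]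
  using not_two_half_turns_AX[where \<phi> = "(\<lambda>(e::real) (s::real) (c::real). s = 1 \<and> (c = 1 \<or> c = -1))"] by (auto intro: bexI[of _ 1] bexI[of _ 0] bexI[of _ "-1"])

lemma D3v_cos: "grp_Dv 3 = AX (\<lambda>e s t. s = 1 \<and> (if e = 1 then (cos t = 1 \<or> cos t = -1/2) else (cos t = -1 \<or> cos t = 1/2)))"
  unfolding grp_D3v_eq by (rule AX_cong) (auto simp: cos_multiple_angle)

lemma sig_D3v: "signature (grp_Dv 3) = [True, False, False, True, False, False, False]"
  unfolding signature_def D3v_cos has_el_AX[where \<phi> = "(\<lambda>(e::real) (s::real) (c::real). s = 1 \<and> (if e = 1 then (c = 1 \<or> c = -1/2) else (c = -1 \<or> c = 1/2)))"]
  using not_two_half_turns_AX[where \<phi> = "(\<lambda>(e::real) (s::real) (c::real). s = 1 \<and> (if e = 1 then (c = 1 \<or> c = -1/2) else (c = -1 \<or> c = 1/2)))"] by (auto intro: bexI[of _ 1] bexI[of _ 0] bexI[of _ "-1"])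

lemma Z4m_cos: "grp_Z4m = AX (\<lambda>e s t. e = 1 \<and> (if s = 1 then (cos t = 1 \<or> cos t = -1) else cos t = 0))"
  unfolding grp_Z4m_eq by (rule AX_cong) (auto simp: cos_multiple_angle)

lemma sig_Z4m: "signature (grp_Z4m) = [False, False, True, False, True, False, False]"
  unfolding signature_def Z4m_cos has_el_AX[where \<phi> = "(\<lambda>(e::real) (s::real) (c::real). e = 1 \<and> (if s = 1 then (c = 1 \<or> c = -1) else c = 0))"]
  using not_two_half_turns_AX[where \<phi> = "(\<lambda>(e::real) (s::real) (c::real). e = 1 \<and> (if s = 1 then (c = 1 \<or> c = -1) else c = 0))"] by (auto intro: bexI[of _ 1] bexI[of _ 0] bexI[of _ "-1"])

lemma D4h_cos: "grp_D2nh 2 = AX (\<lambda>e s t. (if s = e then (cos t = 1 \<or> cos t = -1) else cos t = 0))"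
  unfolding grp_D4h_eq by (rule AX_cong) (auto simp: cos_multiple_angle)

lemma sig_D4h: "signature (grp_D2nh 2) = [False, True, True, True, True, False, False]"
  unfolding signature_def D4h_cos has_el_AX[where \<phi> = "(\<lambda>(e::real) (s::real) (c::real). (if s = e then (c = 1 \<or> c = -1) else c = 0))"]
  using two_half_turns_AX[where \<phi> = "(\<lambda>(e::real) (s::real) (c::real). (if s = e then (c = 1 \<or> c = -1) else c = 0))" and c = "1" and c' = "(-1)"] by (auto intro: bexI[of _ 1] bexI[of _ 0] bexI[of _ "-1"])

lemma D6h_cos: "grp_D2nh 3 = AX (\<lambda>e s t. (cos t = 1 \<or> cos t = -1/2))"
  unfolding grp_D6h_eq by (rule AX_cong) (auto simp: cos_multiple_angle)

lemma sig_D6h: "signature (grp_D2nh 3) = [True, True, True, True, False, False, True]"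
  unfolding signature_def D6h_cos has_el_AX[where \<phi> = "(\<lambda>(e::real) (s::real) (c::real). (c = 1 \<or> c = -1/2))"]
  using two_half_turns_AX[where \<phi> = "(\<lambda>(e::real) (s::real) (c::real). (c = 1 \<or> c = -1/2))" and c = "1" and c' = "(-1/2)"] by (auto intro: bexI[of _ 1] bexI[of _ 0] bexI[of _ "-1"])

lemma SO2_cos: "grp_SO2 = AX (\<lambda>e s t. e = 1 \<and> s = 1)"
  unfolding grp_SO2_eq by (rule AX_cong) (auto simp: cos_multiple_angle)

lemma sig_SO2: "signature (grp_SO2) = [True, False, True, False, False, True, False]"
  unfolding signature_def SO2_cos has_el_AX[where \<phi> = "(\<lambda>(e::real) (s::real) (c::real). e = 1 \<and> s = 1)"]
  using not_two_half_turns_AX[where \<phi> = "(\<lambda>(e::real) (s::real) (c::real). e = 1 \<and> s = 1)"] by (auto intro: bexI[of _ 1] bexI[of _ 0] bexI[of _ "-1"])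

lemma O2_cos: "grp_O2 = AX (\<lambda>e s t. s = e)"
  unfolding grp_O2_eq by (rule AX_cong) (auto simp: cos_multiple_angle)

lemma sig_O2: "signature (grp_O2) = [True, True, True, False, False, True, False]"
  unfolding signature_def O2_cos has_el_AX[where \<phi> = "(\<lambda>(e::real) (s::real) (c::real). s = e)"]
  using two_half_turns_AX[where \<phi> = "(\<lambda>(e::real) (s::real) (c::real). s = e)" and c = "1" and c' = "(-1)"] by (auto intro: bexI[of _ 1] bexI[of _ 0] bexI[of _ "-1"])

lemma O2m_cos: "grp_O2m = AX (\<lambda>e s t. s = 1)"
  unfolding grp_O2m_eq by (rule AX_cong) (auto simp: cos_multiple_angle)

lemma sig_O2m: "signature (grp_O2m) = [True, False, True, True, False, True, False]"
  unfolding signature_def O2m_cos has_el_AX[where \<phi> = "(\<lambda>(e::real) (s::real) (c::real). s = 1)"]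
  using not_two_half_turns_AX[where \<phi> = "(\<lambda>(e::real) (s::real) (c::real). s = 1)"] by (auto intro: bexI[of _ 1] bexI[of _ 0] bexI[of _ "-1"])

lemma det_m3: "det (m3 a b c d e f g h i) = a * e * i + b * f * g + c * d * h - a * f * h - b * d * i - c * e * g"
  by (simp add: det_3)

lemma trace_m3: "trace (m3 a b c d e f g h i) = a + e + i"
  by (simp add: trace3)

lemma sig_Om: "signature grp_Om = [True, True, True, True, True, False, False]"
proof -
  \<comment> \<open>In order: a threefold rotation, two half turns, a plane reflection, and minus a
    quarter turn.\<close>
  have in_OM: "m3 0 1 0 0 0 1 1 0 0 \<in> OM" "m3 1 0 0 0 (-1) 0 0 0 (-1) \<in> OM" "m3 (-1) 0 0 0 1 0 0 0 (-1) \<in> OM"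
     "m3 1 0 0 0 0 1 0 1 0 \<in> OM" "m3 (-1) 0 0 0 0 1 0 (-1) 0 \<in> OM"
    unfolding OM_def by (auto simp: mat3_eq_iff)
  have pos: "has_el OM 1 0" "has_el OM 1 (-1)" "has_el OM (-1) 1" "has_el OM (-1) (-1)"
    unfolding has_el_def
    by (rule bexI[OF _ in_OM(1)], simp add: det_m3 trace_m3, rule bexI[OF _ in_OM(2)], simp add: det_m3 trace_m3,
        rule bexI[OF _ in_OM(4)], simp add: det_m3 trace_m3, rule bexI[OF _ in_OM(5)], simp add: det_m3 trace_m3)
  have two: "two_half_turns OM" unfolding two_half_turns_def
    by (rule bexI[OF _ in_OM(2)], rule bexI[OF _ in_OM(3)]) (simp add: det_m3 trace_m3 mat3_eq_iff)
  have neg: "\<not> (det g = 1 \<and> trace g = 1)" "\<not> (det g = -1 \<and> trace g = -2)" if "g \<in> OM" for g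
    using that unfolding OM_def by (auto simp: det_m3 trace_m3)
  then have "\<not> has_el OM 1 1" "\<not> has_el OM (-1) (-2)" unfolding has_el_def by blast+
  then show ?thesis using pos two by (simp add: signature_def grp_Om_eq)
qed

lemma sig_1: "signature grp_1 = [False, False, False, False, False, False, False]"
  by (simp add: signature_def has_el_def two_half_turns_def grp_1_def mat_1_m3 det_m3 trace_m3)

lemma sig_Z2m: "signature grp_Z2m = [False, False, False, True, False, False, False]"
  by (simp add: signature_def has_el_def two_half_turns_def grp_Z2m_eq mat_1_m3 det_m3 trace_m3 ax_def)

text \<open>The elements that preserve the line of \<open>e3\<close> already exhibit all seven
  features.\<close>

lemma sig_O3: "signature (carrier O3) = [True, True, True, True, True, True, True]"
proof -
  have sub: "AX (\<lambda>e s t. True) \<subseteq> carrier O3" by (auto simp: AX_def)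
  have mono: "has_el H d t \<Longrightarrow> H \<subseteq> K \<Longrightarrow> has_el K d t" "two_half_turns H \<Longrightarrow> H \<subseteq> K \<Longrightarrow> two_half_turns K" for H K d t
    unfolding has_el_def two_half_turns_def by blast+
  have "two_half_turns (AX (\<lambda>e s t. True))"
    using two_half_turns_AX[where \<phi> = "\<lambda>_ _ _. True" and c = 1 and c' = "-1"] by simp
  then show ?thesis
    unfolding signature_def using has_el_AX[where \<phi> = "\<lambda>_ _ _. True"] mono[OF _ sub]
    by (auto intro!: mono(1)[OF _ sub] bexI[of _ 0])
qed

subsection \<open>Classification of the symmetry groups\<close>

text \<open>The first ten groups are those of situation (a).\<close>

definition groups15 :: "mat3 set list" where
  "groups15 = [grp_Z2m, grp_D 2, grp_Dv 2, grp_D 3, grp_Dv 3, grp_D2nh 2, grp_D2nh 3, grp_Om, grp_O2, grp_O2m,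
     grp_1, grp_Z 3, grp_Z 2, grp_Z4m, grp_SO2]"

text \<open>Equality with a listed group is demanded only after moving the tensor, so that proofs
  may change the frame (\<open>classified_act\<close>).\<close>

definition classified :: "tensor3 \<Rightarrow> bool" where
  "classified P \<longleftrightarrow> (\<exists>g. orthogonal_matrix g \<and> sym_group (g \<star> P) \<in> set groups15)"

lemma classified_act: "orthogonal_matrix g \<Longrightarrow> classified (g \<star> P) \<Longrightarrow> classified P"
  unfolding classified_def using act_mult orthogonal_matrix_mul by metis

lemma classifiedI: "sym_group P = H \<Longrightarrow> H \<in> set groups15 \<Longrightarrow> classified P"
  unfolding classified_def using orthogonal_matrix_id by (intro exI[of _ "mat 1"]) simp

lemma mem_sym_group_act:
  assumes "orthogonal_matrix Q"
  shows "x \<in> sym_group (Q \<star> P) \<longleftrightarrow> transpose Q ** x ** Q \<in> sym_group P"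
proof
  assume "x \<in> sym_group (Q \<star> P)"
  then show "transpose Q ** x ** Q \<in> sym_group P"
    using assms by (simp add: mem_sym_group act_mult orthogonal_matrix_mul)
next
  assume a: "transpose Q ** x ** Q \<in> sym_group P"
  have x: "x = Q ** (transpose Q ** x ** Q) ** transpose Q" using assms by (simp add: matrix_mul_assoc)
  show "x \<in> sym_group (Q \<star> P)" unfolding sym_group_act[OF assms] conjugate_by_eq[OF assms]
    by (rule image_eqI[where f = "\<lambda>h. Q ** h ** transpose Q", OF x a])
qed

lemma conj_in_sym_group_act:
  assumes "orthogonal_matrix Q" "Q ** k ** transpose Q \<in> sym_group P"
  shows "k \<in> sym_group (transpose Q \<star> P)"
  using assms by (simp add: mem_sym_group_act)

text \<open>Three covariants can single out the axis: the trace vector, the Gram matrix of the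
  tensor and that of its cyclic shift. They fail simultaneously only for the zero tensor.\<close>

lemma axisymmetric_preserves_axis:
  assumes g: "g \<in> sym_group (wt a b c d 0 0 0 0 0 0)" and nz: "wt a b c d 0 0 0 0 0 0 \<noteq> 0"
  shows "\<exists>s. g *v e3 = s *\<^sub>R e3"
proof -
  let ?P = "wt a b c d 0 0 0 0 0 0"
  have gc: "g \<in> sym_group (cyc ?P)" by (rule sym_group_cyc[OF g])
  have "trace_vec ?P = (a + 2 * b) *\<^sub>R e3"
    by (simp add: vec3_eq_iff trace_vec_def trace3)
  then have tv: "(a + 2 * b) *\<^sub>R (g *v e3) = (a + 2 * b) *\<^sub>R e3"
    using sym_group_trace_vec[OF g] by (simp add: matrix_vector_mult_scaleR)
  have gm: "gram_mat (cyc ?P) = m3 (b * b + c * c + d * d) 0 0 0 (b * b + c * c + d * d) 0 0 0 (a * a + 2 * (c * c + d * d))"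
    by (simp add: mat3_eq_iff gram_mat_def inner_vec_def sum_3 cyc_def algebra_simps)
  \<comment> \<open>If all three tests fail, then \<open>a = - 2 * b\<close>, next
    \<open>c * c + d * d = 3 * b * b\<close>, and the third equation becomes
    \<open>4 * b * b = 10 * b * b\<close>.\<close>
  consider "a + 2 * b \<noteq> 0" | "2 * (c * c + d * d) \<noteq> a * a + 2 * (b * b)"
    | "b * b + c * c + d * d \<noteq> a * a + 2 * (c * c + d * d)"
  proof -
    have False if z: "a + 2 * b = 0" "2 * (c * c + d * d) = a * a + 2 * (b * b)" "b * b + c * c + d * d = a * a + 2 * (c * c + d * d)"
    proof -
      have a: "a = - 2 * b" using z(1) by simp
      have "b * b = 0" using z(2,3) a by algebra
      then have b: "b = 0" by simp
      then have "c * c + d * d = 0" using z(2) a by algebra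
      then have "c = 0" "d = 0" by (simp_all add: sum_squares_eq_zero_iff)
      then show False using a b nz by (simp add: wt_eq_0_iff)
    qed
    then show thesis using that by blast
  qed
  then show ?thesis
  proof cases
    case 1
    then have "g *v e3 = 1 *\<^sub>R e3" using tv by simp
    then show ?thesis by blast
  next
    case 2
    then show ?thesis using sym_group_wt_axis[OF g] by auto
  next
    case 3
    then show ?thesis using commute_diag_axis[OF sym_group_gram_mat[OF gc, unfolded gm]] by blast
  qed
qed

text \<open>The components \<open>a\<close>, \<open>b\<close>, \<open>c\<close> are polar (fixed
  when \<open>s = 1\<close>), while \<open>d\<close> is fixed when \<open>e * s = 1\<close>. Which
  kinds occur decides between the three groups.\<close>

lemma classified_axisymmetric:
  assumes nz: "wt a b c d 0 0 0 0 0 0 \<noteq> 0"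
  shows "classified (wt a b c d 0 0 0 0 0 0)"
proof -
  have G: "\<forall>g\<in>sym_group (wt a b c d 0 0 0 0 0 0). \<exists>s. g *v e3 = s *\<^sub>R e3"
    using axisymmetric_preserves_axis nz by blast
  consider "a = 0 \<and> b = 0 \<and> c = 0" "d \<noteq> 0" | "\<not> (a = 0 \<and> b = 0 \<and> c = 0)" "d \<noteq> 0"
    | "\<not> (a = 0 \<and> b = 0 \<and> c = 0)" "d = 0" using nz by (auto simp: wt_eq_0_iff)
  then show ?thesis
  proof cases
    case 1
    have "sym_group (wt a b c d 0 0 0 0 0 0) = grp_O2" unfolding grp_O2_eq by (rule sym_group_wt_eqI[OF G]) (use 1 in auto)
    then show ?thesis by (rule classifiedI) (simp add: groups15_def)
  next
    case 2
    have "sym_group (wt a b c d 0 0 0 0 0 0) = grp_SO2" unfolding grp_SO2_eq by (rule sym_group_wt_eqI[OF G]) (use 2 in auto)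
    then show ?thesis by (rule classifiedI) (simp add: groups15_def)
  next
    case 3
    have "sym_group (wt a b c d 0 0 0 0 0 0) = grp_O2m" unfolding grp_O2m_eq by (rule sym_group_wt_eqI[OF G]) (use 3 in auto)
    then show ?thesis by (rule classifiedI) (simp add: groups15_def)
  qed
qed

lemma det_1_rot:
  assumes h: "h \<in> sym_group P" "det h = 1"
  obtains Q t where "orthogonal_matrix Q" "ax 1 1 t \<in> sym_group (Q \<star> P)" "trace h = 1 + 2 * cos t"
proof -
  obtain n t where n: "norm n = 1" "h = rot n t" using euler_rotation[OF sym_group_orth[OF h(1)] h(2)] .
  obtain Q where Q: "orthogonal_matrix Q" "\<And>t. rot n t = Q ** ax 1 1 t ** transpose Q"
    using rot_conj_ax[OF n(1)] by metis
  have "ax 1 1 t \<in> sym_group (transpose Q \<star> P)"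
    using conj_in_sym_group_act[OF Q(1)] h(1) n(2) Q(2) by metis
  then show ?thesis using that[of "transpose Q" t] Q(1) rot_trace[OF n(1)] n(2) by simp
qed

lemma classified_generic_rotation:
  assumes P: "P \<in> Piez" "P \<noteq> 0" and h: "h \<in> sym_group P" "det h = 1" "trace h \<notin> {3, -1, 0}"
  shows "classified P"
proof -
  obtain Q t where Q: "orthogonal_matrix Q" "ax 1 1 t \<in> sym_group (Q \<star> P)" "trace h = 1 + 2 * cos t"
    using det_1_rot[OF h(1,2)] .
  \<comment> \<open>The excluded traces 3, -1, 0 belong to \<open>cos t\<close> equal to 1, -1,
    -1/2, exactly where one of the three cosines is 1.\<close>
  have c: "cos t \<noteq> 1" "cos (2 * t) \<noteq> 1" "cos (3 * t) \<noteq> 1" using h(3) Q(3) by (auto simp: cos_multiple_angle)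
  have inv: "ax 1 1 t \<star> (Q \<star> P) = Q \<star> P" using Q(2) by (simp add: mem_sym_group)
  obtain a b cc d p q where w: "Q \<star> P = wt a b cc d p q 0 0 0 0" "cos (3 * t) \<noteq> 1 \<Longrightarrow> p = 0 \<and> q = 0"
    using rotation_invariant_form[OF act_Piez[OF P(1)] inv c(1,2)] by blast
  have "Q \<star> P \<noteq> 0" using act_eq_0_iff Q(1) P(2) by blast
  then have "classified (Q \<star> P)" using classified_axisymmetric w c(3) by metis
  then show ?thesis by (rule classified_act[OF Q(1)])
qed

text \<open>A rotation by \<open>u / 3\<close> about the axis turns the weight 3 pair by
  \<open>u\<close> and leaves \<open>a\<close>, \<open>b\<close>, \<open>c\<close>, \<open>d\<close>
  alone, so the pair can be brought to a coordinate axis. The group then depends on which of the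
  polar part \<open>a\<close>, \<open>b\<close>, \<open>c\<close> and the part \<open>d\<close>
  vanish.\<close>

lemma classified_one_three_fold_axis:
  assumes ax: "\<And>g. g \<in> sym_group (wt a b c d p q 0 0 0 0) \<Longrightarrow> \<exists>s. g *v e3 = s *\<^sub>R e3"
    and pq: "p \<noteq> 0 \<or> q \<noteq> 0"
  shows "classified (wt a b c d p q 0 0 0 0)"
proof -
  let ?P = "wt a b c d p q 0 0 0 0"
  obtain r f where rf: "p = r * cos f" "q = r * sin f" using polar_Ex[of p q] by blast
  have r0: "r \<noteq> 0" using rf pq by auto
  have rotated: "ax 1 1 (u / 3) \<star> ?P = wt a b c d (r * cos (u + f)) (r * sin (u + f)) 0 0 0 0" for u
    by (simp add: ax_act_wt wt_eq_iff rf(1,2) cos_add sin_add algebra_simps)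
  have ax': "\<exists>s. g *v e3 = s *\<^sub>R e3" if "g \<in> sym_group (ax 1 1 u \<star> ?P)" for g u
  proof -
    have "transpose (ax 1 1 u) ** g ** ax 1 1 u \<in> sym_group ?P" using that by (simp add: mem_sym_group_act)
    then obtain s where "(transpose (ax 1 1 u) ** g ** ax 1 1 u) *v e3 = s *\<^sub>R e3" using ax by blast
    then have "transpose (ax 1 1 u) *v (g *v e3) = s *\<^sub>R e3"
      by (simp add: matrix_vector_mul_assoc[symmetric] ax_e3)
    then have "ax 1 1 u *v (transpose (ax 1 1 u) *v (g *v e3)) = s *\<^sub>R e3"
      by (simp add: matrix_vector_mult_scaleR ax_e3)
    then show ?thesis by auto
  qed
  \<comment> \<open>Two normal forms are needed: the half turn about \<open>e1\<close> fixes the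
    pair (r, 0), the reflection \<open>refl_plane e1\<close> fixes (0, r).\<close>
  have P1: "ax 1 1 (- f / 3) \<star> ?P = wt a b c d r 0 0 0 0 0" using rotated[of "- f"] by simp
  have P2: "ax 1 1 ((pi / 2 - f) / 3) \<star> ?P = wt a b c d 0 r 0 0 0 0" using rotated[of "pi / 2 - f"] by simp
  have G1: "\<forall>g\<in>sym_group (wt a b c d r 0 0 0 0 0). \<exists>s. g *v e3 = s *\<^sub>R e3"
    using ax'[of _ "- f / 3"] unfolding P1 by blast
  have G2: "\<forall>g\<in>sym_group (wt a b c d 0 r 0 0 0 0). \<exists>s. g *v e3 = s *\<^sub>R e3"
    using ax'[of _ "(pi / 2 - f) / 3"] unfolding P2 by blast
  have c1: "classified ?P" if "classified (wt a b c d r 0 0 0 0 0)"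
    using classified_act[of "ax 1 1 (- f / 3)" ?P] that P1 by simp
  have c2: "classified ?P" if "classified (wt a b c d 0 r 0 0 0 0)"
    using classified_act[of "ax 1 1 ((pi / 2 - f) / 3)" ?P] that P2 by simp
  consider "a = 0 \<and> b = 0 \<and> c = 0" "d \<noteq> 0" | "\<not> (a = 0 \<and> b = 0 \<and> c = 0)" "d \<noteq> 0"
    | "\<not> (a = 0 \<and> b = 0 \<and> c = 0)" "d = 0" | "a = 0 \<and> b = 0 \<and> c = 0" "d = 0" by blast
  then show ?thesis
  proof cases
    case 1
    have "sym_group (wt a b c d r 0 0 0 0 0) = grp_D 3" unfolding grp_D3_eq
      by (rule sym_group_wt_eqI[OF G1]) (use 1 r0 cos_1_imp_sin_0 in auto)
    from c1[OF classifiedI[OF this]] show ?thesis by (simp add: groups15_def)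
  next
    case 2
    have "sym_group (wt a b c d r 0 0 0 0 0) = grp_Z 3" unfolding grp_Z3_eq
      by (rule sym_group_wt_eqI[OF G1]) (use 2 r0 cos_1_imp_sin_0 in auto)
    from c1[OF classifiedI[OF this]] show ?thesis by (simp add: groups15_def)
  next
    case 3
    have "sym_group (wt a b c d 0 r 0 0 0 0) = grp_Dv 3" unfolding grp_D3v_eq
      by (rule sym_group_wt_eqI[OF G2]) (use 3 r0 cos_pm1_sin_0 in auto)
    from c2[OF classifiedI[OF this]] show ?thesis by (simp add: groups15_def)
  next
    case 4
    have "sym_group (wt a b c d r 0 0 0 0 0) = grp_D2nh 3" unfolding grp_D6h_eq
      by (rule sym_group_wt_eqI[OF G1]) (use 4 r0 cos_1_imp_sin_0 in auto)
    from c1[OF classifiedI[OF this]] show ?thesis by (simp add: groups15_def)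
  qed
qed

subsection \<open>Two threefold axes\<close>

text \<open>The axes enter only through their inner product, so the trace of a product of rotations
  measures the angle between the axes.\<close>

lemma trace_rot_mult:
  assumes n: "norm n = 1" and m: "norm m = 1"
  shows "trace (rot n t ** rot m u) = 3 * cos t * cos u + cos t * (1 - cos u) + (1 - cos t) * cos u
    - 2 * sin t * sin u * (n \<bullet> m) + (1 - cos t) * (1 - cos u) * ((n \<bullet> m) * (n \<bullet> m))"
proof -
  have "trace (rot n t ** rot m u) = 3 * cos t * cos u + cos t * (1 - cos u) * (m \<bullet> m) + (1 - cos t) * cos u * (n \<bullet> n)
    - 2 * sin t * sin u * (n \<bullet> m) + (1 - cos t) * (1 - cos u) * ((n \<bullet> m) * (n \<bullet> m))"
    unfolding rot_eq_m3[OF n] rot_eq_m3[OF m] m3_mult trace_m3 inner_vec_def sum_3 inner_real_def by algebra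
  then show ?thesis using n m by (simp add: dot_square_norm)
qed

lemma cos_sin_120: "cos (2 * pi / 3) = -1/2" "sin (2 * pi / 3) = sqrt 3 / 2"
proof -
  have "cos (2 * pi / 3) = cos (2 * (pi / 3))" "sin (2 * pi / 3) = sin (2 * (pi / 3))" by simp_all
  then show "cos (2 * pi / 3) = -1/2" "sin (2 * pi / 3) = sqrt 3 / 2"
    unfolding cos_double_cos sin_double by (simp_all add: cos_60 sin_60 power2_eq_square)
qed

lemma orthogonal_matrix_rowsI:
  assumes "f1 \<bullet> f1 = 1" "f2 \<bullet> f2 = 1" "f3 \<bullet> f3 = 1" "f1 \<bullet> f2 = 0" "f1 \<bullet> f3 = 0" "f2 \<bullet> f3 = 0"
  shows "orthogonal_matrix (vector [f1, f2, f3] :: mat3)"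
proof -
  let ?F = "vector [f1, f2, f3] :: mat3"
  have "?F ** transpose ?F = mat 1"
  proof -
    have "(?F ** transpose ?F) $ i $ j = (?F $ i) \<bullet> (?F $ j)" for i j
      by (simp add: mult3_nth inner_vec_def sum_3)
    moreover have "f2 \<bullet> f1 = 0" "f3 \<bullet> f1 = 0" "f3 \<bullet> f2 = 0" 
      using assms(4-6) inner_commute[of f2 f1] inner_commute[of f3 f1] inner_commute[of f3 f2] by simp_all
    ultimately show ?thesis unfolding mat3_eq_iff mat_1_m3 m3_nth by (simp only: vector_3 assms simp_thms)
  qed
  then show ?thesis unfolding orthogonal_matrix_def using matrix_left_right_inverse by blast
qed

text \<open>The target vectors have their sum along \<open>e1\<close> and their difference along (0,
  1, 1), so the frame is built from \<open>n + m\<close> and \<open>n - m\<close>.\<close>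

lemma tetrahedral_frame:
  assumes n: "norm (n::real^3) = 1" and m: "norm m = 1" and nm: "n \<bullet> m = -1/3"
  obtains Q where "orthogonal_matrix Q" "Q *v n = (1 / sqrt 3) *\<^sub>R vector [1, 1, 1]"
    "Q *v m = (1 / sqrt 3) *\<^sub>R vector [1, -1, -1]"
proof -
  \<comment> \<open>The factors normalize: \<open>n + m\<close> has squared norm 4/3 and
    \<open>n - m\<close> has squared norm 8/3.\<close>
  define f1 where "f1 = (sqrt 3 / 2) *\<^sub>R (n + m)"
  define f2 where "f2 = (sqrt 3 / (2 * sqrt 2)) *\<^sub>R (n - m)"
  define f3 where "f3 = cross3 f1 f2"
  have nn: "n \<bullet> n = 1" "m \<bullet> m = 1" "m \<bullet> n = -1/3" using n m nm by (simp_all add: dot_square_norm inner_commute)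
  have f11: "f1 \<bullet> f1 = 1" and f22: "f2 \<bullet> f2 = 1" and f12: "f1 \<bullet> f2 = 0"
    unfolding f1_def f2_def by (simp_all add: inner_simps nn nm field_simps)
  have f13: "f1 \<bullet> f3 = 0" "f2 \<bullet> f3 = 0" by (simp_all add: f3_def dot_cross_self)
  have f33: "f3 \<bullet> f3 = 1" unfolding f3_def dot_cross using f11 f22 f12 by (simp add: inner_commute)
  have o: "orthogonal_matrix (vector [f1, f2, f3] :: mat3)" by (rule orthogonal_matrix_rowsI[OF f11 f22 f33 f12 f13])
  have r2: "sqrt 2 * sqrt 2 = 2" "sqrt 3 * sqrt 3 = 3" by simp_all
  have nm_f: "f1 \<bullet> n = 1 / sqrt 3" "f1 \<bullet> m = 1 / sqrt 3" "f2 \<bullet> n = sqrt 2 / sqrt 3" "f2 \<bullet> m = - (sqrt 2 / sqrt 3)"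
    unfolding f1_def f2_def by (simp_all add: inner_simps nn nm field_simps)
  have "cross3 (n + m) (n - m) = - 2 *\<^sub>R cross3 n m" by (simp add: cross3_simps)
  then have "f3 = (sqrt 3 / 2 * (sqrt 3 / (2 * sqrt 2)) * - 2) *\<^sub>R cross3 n m"
    unfolding f3_def f1_def f2_def cross_mult_left cross_mult_right by simp
  then have f3nm: "f3 \<bullet> n = 0" "f3 \<bullet> m = 0" by (simp_all add: dot_cross_self)
  \<comment> \<open>An eighth of a turn about the first axis, which takes the second axis to the
    direction (0, 1, 1).\<close>
  let ?K = "vector [vector [1, 0, 0], vector [0, 1 / sqrt 2, - (1 / sqrt 2)], vector [0, 1 / sqrt 2, 1 / sqrt 2]] :: mat3"
  have k: "orthogonal_matrix ?K"
    by (rule orthogonal_matrix_rowsI) (simp_all add: inner_vec_def sum_3)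
  have F: "(vector [f1, f2, f3] :: mat3) *v x = vector [f1 \<bullet> x, f2 \<bullet> x, f3 \<bullet> x]" for x
    by (simp add: vec3_eq_iff mv3_nth inner_vec_def sum_3)
  have "(?K ** vector [f1, f2, f3]) *v n = (1 / sqrt 3) *\<^sub>R vector [1, 1, 1]"
    "(?K ** vector [f1, f2, f3]) *v m = (1 / sqrt 3) *\<^sub>R vector [1, -1, -1]"
    unfolding matrix_vector_mul_assoc[symmetric] F nm_f f3nm by (simp_all add: vec3_eq_iff mv3_nth)
  then show ?thesis using that orthogonal_matrix_mul[OF k o] by blast
qed

lemma tetrahedral_rotations:
  "rot ((1 / sqrt 3) *\<^sub>R vector [1, 1, 1]) (2 * pi / 3) = m3 0 0 1 1 0 0 0 1 0"
  "rot ((1 / sqrt 3) *\<^sub>R vector [1, -1, -1]) (2 * pi / 3) = m3 0 0 (-1) (-1) 0 0 0 1 0"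
proof -
  have n: "norm ((1 / sqrt 3) *\<^sub>R vector [1, 1, 1] :: real^3) = 1" "norm ((1 / sqrt 3) *\<^sub>R vector [1, -1, -1] :: real^3) = 1"
    by (simp_all add: norm_eq_sqrt_inner inner_vec_def sum_3)
  show "rot ((1 / sqrt 3) *\<^sub>R vector [1, 1, 1]) (2 * pi / 3) = m3 0 0 1 1 0 0 0 1 0"
    "rot ((1 / sqrt 3) *\<^sub>R vector [1, -1, -1]) (2 * pi / 3) = m3 0 0 (-1) (-1) 0 0 0 1 0"
    unfolding rot_eq_m3[OF n(1)] rot_eq_m3[OF n(2)] cos_sin_120 by (simp_all add: mat3_eq_iff field_simps)
qed

lemma act_scaleR: "g \<star> (r *\<^sub>R P) = r *\<^sub>R (g \<star> P)"
  by (simp add: vec_eq_iff act_def sum_distrib_left mult_ac)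

lemma sym_group_scaleR: "r \<noteq> 0 \<Longrightarrow> sym_group (r *\<^sub>R P) = sym_group P"
  by (auto simp: mem_sym_group act_scaleR)

text \<open>The two threefold rotations generate the diagonal half turns, which kill every component
  whose indices are not all distinct. The cyclic permutation and the symmetry of \<open>Piez\<close>
  equate the six that remain.\<close>

lemma classified_tetrahedral:
  assumes P: "P \<in> Piez" "P \<noteq> 0"
    and C1: "m3 0 0 1 1 0 0 0 1 0 \<in> sym_group P" and C2: "m3 0 0 (-1) (-1) 0 0 0 1 0 \<in> sym_group P"
  shows "classified P"
proof -
  have C1T: "m3 0 1 0 0 0 1 1 0 0 \<in> sym_group P"
  proof -
    have "transpose (m3 0 0 1 1 0 0 0 1 0) = m3 0 1 0 0 0 1 1 0 0" by (simp add: mat3_eq_iff)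
    then show ?thesis using sym_group_transpose[OF C1] by simp
  qed
  have d3: "m3 (-1) 0 0 0 (-1) 0 0 0 1 \<in> sym_group P" using sym_group_mult[OF C2 C1T] by (simp add: m3_mult)
  have d1: "m3 1 0 0 0 (-1) 0 0 0 (-1) \<in> sym_group P"
    using sym_group_mult[OF sym_group_mult[OF C1 d3] C1T] by (simp add: m3_mult)
  obtain a1 a2 a3 a4 a5 a6 b1 b2 b3 b4 b5 b6 k1 k2 k3 k4 k5 k6 where
    P_eq: "P$1 = m3 a1 a2 a3 a2 a4 a5 a3 a5 a6" "P$2 = m3 b1 b2 b3 b2 b4 b5 b3 b5 b6"
    "P$3 = m3 k1 k2 k3 k2 k4 k5 k3 k5 k6" using Piez_slices[OF P(1)] by metis
  have s: "(g \<star> P) $ i = P $ i" if "g \<in> sym_group P" for g i using that by (simp add: mem_sym_group)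
  note e = act_nth3 conj_mat_m3 P_eq m3_mult mat3_eq_iff
  have z3: "a1 = 0 \<and> a2 = 0 \<and> a4 = 0 \<and> a6 = 0" "b1 = 0 \<and> b2 = 0 \<and> b4 = 0 \<and> b6 = 0" "k3 = 0 \<and> k5 = 0"
    using s[OF d3, of 1] s[OF d3, of 2] s[OF d3, of 3] by (simp_all add: e)
  have z1: "a3 = 0" "b5 = 0" "k1 = 0 \<and> k4 = 0 \<and> k6 = 0"
    using s[OF d1, of 1] s[OF d1, of 2] s[OF d1, of 3] by (simp_all add: e)
  have z2: "a5 = k2 \<and> b3 = a5"
    using s[OF C1, of 1] s[OF C1, of 2] by (simp_all add: e z1 z3)
  have P': "P = a5 *\<^sub>R tens_Om" using z1 z2 z3 by (simp add: tensor3_eq_iff P_eq mat3_eq_iff)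
  then have "a5 \<noteq> 0" using P(2) by auto
  then have "sym_group P = grp_Om" unfolding P' by (simp add: sym_group_scaleR sym_Om)
  then show ?thesis by (rule classifiedI) (simp add: groups15_def)
qed

lemma unit_inner_pm1:
  assumes "norm (n::real^3) = 1" "norm m = 1" "n \<bullet> m = 1 \<or> n \<bullet> m = -1"
  shows "m = n \<or> m = - n"
proof -
  have "(m - n) \<bullet> (m - n) = 2 - 2 * (n \<bullet> m)" "(m + n) \<bullet> (m + n) = 2 + 2 * (n \<bullet> m)"
  proof -
    have "n \<bullet> n = 1" "m \<bullet> m = 1" using assms by (simp_all add: dot_square_norm)
    then show "(m - n) \<bullet> (m - n) = 2 - 2 * (n \<bullet> m)" "(m + n) \<bullet> (m + n) = 2 + 2 * (n \<bullet> m)"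
      by (simp_all add: inner_simps inner_commute)
  qed
  then have "m - n = 0 \<or> m + n = 0" using assms(3) by (metis add.right_inverse diff_self inner_eq_zero_iff mult_1_right mult_minus_right)
  then show ?thesis by (auto simp: add_eq_0_iff)
qed

lemma transpose_rot: "norm n = 1 \<Longrightarrow> transpose (rot n t) = rot n (- t)"
  by (simp add: rot_eq_m3 mat3_eq_iff)

lemma classified_three_fold_rotation:
  assumes P: "P \<in> Piez" "P \<noteq> 0" and gen: "\<And>h. h \<in> sym_group P \<Longrightarrow> det h = 1 \<Longrightarrow> trace h \<in> {3, -1, 0}"
    and h: "h \<in> sym_group P" "det h = 1" "trace h = 0"
  shows "classified P"
proof -
  have "\<exists>n. n \<noteq> 0 \<and> h = rot n (2 * pi / 3)"
    using rot_iff_trace[OF sym_group_orth[OF h(1)], of "2 * pi / 3"] h by (simp add: cos_sin_120)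
  then obtain n0 where "n0 \<noteq> 0" "h = rot n0 (2 * pi / 3)" by blast
  then obtain n where n: "norm n = 1" "rot n (2 * pi / 3) \<in> sym_group P"
    using h(1) by (metis norm_sgn rot_sgn)
  show ?thesis
  proof (cases "\<forall>m. norm m = 1 \<and> rot m (2 * pi / 3) \<in> sym_group P \<longrightarrow> m = n \<or> m = - n")
    case True
    obtain Q where Q: "orthogonal_matrix Q" "Q *v e3 = n" "\<And>t. rot n t = Q ** ax 1 1 t ** transpose Q"
      using rot_conj_ax[OF n(1)] by metis
    let ?P = "transpose Q \<star> P"
    have in_P: "ax 1 1 (2 * pi / 3) \<in> sym_group ?P"
      using conj_in_sym_group_act[OF Q(1)] n(2) Q(3) by metis
    have inv: "ax 1 1 (2 * pi / 3) \<star> ?P = ?P" using in_P by (simp add: mem_sym_group)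
    have cc: "cos (2 * pi / 3) \<noteq> 1" "cos (2 * (2 * pi / 3)) \<noteq> 1"
      by (simp_all only: cos_multiple_angle cos_sin_120) simp_all
    obtain a b c d p q where w: "?P = wt a b c d p q 0 0 0 0"
      using rotation_invariant_form[OF act_Piez[OF P(1)] inv cc] by metis
    \<comment> \<open>Conjugating the threefold rotation by \<open>g\<close> gives one about
      \<open>g *v e3\<close>, up to orientation. As there is only one threefold axis,
      \<open>g\<close> preserves it.\<close>
    have axis: "\<exists>s. g *v e3 = s *\<^sub>R e3" if g: "g \<in> sym_group ?P" for g
    proof -
      have go: "orthogonal_matrix g" using g by (rule sym_group_orth)
      have "g ** ax 1 1 (2 * pi / 3) ** transpose g \<in> sym_group ?P"
        by (intro sym_group_mult sym_group_transpose g in_P)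
      then have "rot (g *v e3) (det g * (2 * pi / 3)) \<in> sym_group ?P"
        using conj_rot[OF go, of e3 "2 * pi / 3"] by (simp add: rot_e3)
      then have "Q ** rot (g *v e3) (det g * (2 * pi / 3)) ** transpose Q \<in> sym_group P"
        using Q(1) by (simp add: mem_sym_group_act)
      then have r: "rot (Q *v (g *v e3)) (det Q * (det g * (2 * pi / 3))) \<in> sym_group P"
        using conj_rot[OF Q(1), of "g *v e3"] by (simp add: norm_orthogonal_mv go)
      let ?m = "Q *v (g *v e3)"
      have nm: "norm ?m = 1" by (simp add: norm_orthogonal_mv go Q(1))
      have "rot ?m (2 * pi / 3) \<in> sym_group P \<or> rot (- ?m) (2 * pi / 3) \<in> sym_group P"
        using r orthogonal_matrix_det[OF go] orthogonal_matrix_det[OF Q(1)] unfolding rot_minus by auto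
      then have "?m = n \<or> ?m = - n" using True nm by (metis minus_minus norm_minus_cancel)
      then have "Q *v (g *v e3) = Q *v e3 \<or> Q *v (g *v e3) = Q *v (- e3)"
        using Q(2) by (simp add: vec3_eq_iff mv3_nth)
      then have "g *v e3 = e3 \<or> g *v e3 = - e3" using Q(1) by (metis orth_cancel(7))
      then show ?thesis by (metis scaleR_minus1_left scaleR_one)
    qed
    have nz: "?P \<noteq> 0" using act_eq_0_iff[of "transpose Q"] Q(1) P(2) by simp
    have "classified ?P"
    proof (cases "p = 0 \<and> q = 0")
      case True then show ?thesis using classified_axisymmetric nz unfolding w by metis
    next
      case False then show ?thesis using classified_one_three_fold_axis axis unfolding w by metis
    qed
    then show ?thesis using classified_act[of "transpose Q" P] Q(1) by simp
  next
    case False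
    then obtain m where m: "norm m = 1" "rot m (2 * pi / 3) \<in> sym_group P" "m \<noteq> n" "m \<noteq> - n" by blast
    define x where "x = n \<bullet> m"
    have x1: "x \<noteq> 1" "x \<noteq> -1" using unit_inner_pm1[OF n(1) m(1)] m(3,4) by (auto simp: x_def)
    have "trace (rot n (2 * pi / 3) ** rot m (2 * pi / 3)) \<in> {3, -1, 0}"
      by (rule gen) (use n m in \<open>simp_all add: sym_group_mult det_mul rot_det\<close>)
    moreover have "trace (rot n (2 * pi / 3) ** rot m (2 * pi / 3)) = (9 * x * x - 6 * x - 3) / 4"
      unfolding trace_rot_mult[OF n(1) m(1)] cos_sin_120 x_def[symmetric] by (simp add: field_simps)
    \<comment> \<open>The three alternatives are trace 3, -1 and 0, each equation cleared of
      constant factors.\<close>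
    ultimately have "(x + 1) * (3 * x - 5) = 0 \<or> (3 * x - 1) * (3 * x - 1) = 0 \<or> (x - 1) * (3 * x + 1) = 0"
      by (auto simp: field_simps)
    moreover have "x \<le> 1" using norm_cauchy_schwarz[of n m] n(1) m(1) by (simp add: x_def)
    ultimately have x: "x = 1/3 \<or> x = -1/3" using x1 by auto
    \<comment> \<open>For \<open>x = 1/3\<close> the inverse rotation about \<open>m\<close> is the
      rotation by the same angle about \<open>- m\<close>, which changes the sign of the inner
      product.\<close>
    obtain m' where m': "norm m' = 1" "rot m' (2 * pi / 3) \<in> sym_group P" "n \<bullet> m' = -1/3"
    proof (cases "x = 1/3")
      case True
      have "rot (- m) (2 * pi / 3) \<in> sym_group P"
        using sym_group_transpose[OF m(2)] by (simp add: rot_minus transpose_rot[OF m(1)])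
      then show ?thesis using that[of "- m"] m(1) True by (simp add: x_def)
    next
      case False then show ?thesis using that[of m] m x by (simp add: x_def)
    qed
    obtain Q where Q: "orthogonal_matrix Q" "Q *v n = (1 / sqrt 3) *\<^sub>R vector [1, 1, 1]"
      "Q *v m' = (1 / sqrt 3) *\<^sub>R vector [1, -1, -1]" using tetrahedral_frame[OF n(1) m'(1,3)] .
    have in_Q: "rot (Q *v k) (2 * pi / 3) \<in> sym_group (Q \<star> P)" if k: "norm k = 1" "rot k (2 * pi / 3) \<in> sym_group P" for k
    proof -
      have nk: "norm (Q *v k) = 1" using k(1) by (simp add: norm_orthogonal_mv Q(1))
      have "Q ** rot k (2 * pi / 3) ** transpose Q \<in> sym_group (Q \<star> P)"
        unfolding sym_group_act[OF Q(1)] conjugate_by_eq[OF Q(1)] using k(2) by blast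
      then have r: "rot (Q *v k) (det Q * (2 * pi / 3)) \<in> sym_group (Q \<star> P)" by (simp add: conj_rot Q(1) k(1))
      \<comment> \<open>An improper \<open>Q\<close> reverses the angle; passing to the inverse
        rotation restores it.\<close>
      then show ?thesis using orthogonal_matrix_det[OF Q(1)] sym_group_transpose[OF r] by (auto simp: transpose_rot[OF nk])
    qed
    have "classified (Q \<star> P)"
      using classified_tetrahedral[of "Q \<star> P"] in_Q[OF n] in_Q[OF m'(1,2)] act_eq_0_iff[OF Q(1)] P
      unfolding Q(2,3) tetrahedral_rotations by simp
    then show ?thesis by (rule classified_act[OF Q(1)])
  qed
qed

subsection \<open>Groups without threefold rotations\<close>

lemma det_1_trace_3:
  assumes "orthogonal_matrix (g::mat3)" "det g = 1" "trace g = 3"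
  shows "g = mat 1"
proof -
  obtain n t where n: "norm n = 1" "g = rot n t" using euler_rotation[OF assms(1,2)] .
  then have c: "cos t = 1" using assms(3) by (simp add: rot_trace)
  obtain Q where Q: "orthogonal_matrix Q" "\<And>t. rot n t = Q ** ax 1 1 t ** transpose Q"
    using rot_conj_ax[OF n(1)] by metis
  have "ax 1 1 t = mat 1" using c cos_1_imp_sin_0[OF c] by (simp add: ax_1[symmetric] ax_eq_iff)
  then show ?thesis using n Q by simp
qed

lemma det_1_trace_minus_1:
  assumes "orthogonal_matrix (g::mat3)" "det g = 1" "trace g = -1"
  obtains Q where "orthogonal_matrix Q" "g = Q ** ax 1 1 pi ** transpose Q"
proof -
  have "\<exists>n. n \<noteq> 0 \<and> g = rot n pi" using rot_iff_trace[OF assms(1), of pi] assms by simp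
  then obtain n where "n \<noteq> 0" "g = rot n pi" by blast
  then have n: "norm (sgn n) = 1" "g = rot (sgn n) pi" by (simp_all add: norm_sgn rot_sgn)
  show ?thesis using rot_conj_ax[OF n(1)] that n(2) by metis
qed

lemma half_turn_involution:
  assumes "orthogonal_matrix (g::mat3)" "det g = 1" "trace g \<in> {3, -1}"
  shows "g ** g = mat 1"
proof (cases "trace g = 3")
  case True
  have "g = mat 1" by (rule det_1_trace_3[OF assms(1,2) True])
  then show ?thesis by simp
next
  case False
  then obtain Q where Q: "orthogonal_matrix Q" "g = Q ** ax 1 1 pi ** transpose Q"
    using det_1_trace_minus_1[of g] assms by auto
  have "ax 1 1 pi ** ax 1 1 pi = mat 1" by (simp add: ax_mult ax_1[symmetric] ax_eq_iff)
  then have "Q ** (ax 1 1 pi ** ax 1 1 pi) ** transpose Q = mat 1" using Q(1) by simp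
  moreover have "g ** g = Q ** (ax 1 1 pi ** ax 1 1 pi) ** transpose Q"
    unfolding Q(2) using Q(1) by (simp add: matrix_mul_assoc)
  ultimately show ?thesis by simp
qed

text \<open>The rotations of the symmetry group are half turns, hence they form an elementary abelian
  2-group; an improper element determines all the others up to rotations.\<close>

locale involutive =
  fixes P :: tensor3
  assumes nz: "P \<noteq> 0"
    and inv: "\<And>g. g \<in> sym_group P \<Longrightarrow> det g = 1 \<Longrightarrow> trace g \<in> {3, -1}"
begin

lemma rotate: 
  assumes Q: "orthogonal_matrix Q"
  shows "involutive (Q \<star> P)"
proof
  show "Q \<star> P \<noteq> 0" using nz act_eq_0_iff Q by blast
  fix g assume g: "g \<in> sym_group (Q \<star> P)" "det g = 1"
  have "transpose Q ** g ** Q \<in> sym_group P" using g(1) mem_sym_group_act[OF Q] by blast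
  moreover have "det (transpose Q ** g ** Q) = 1" "trace (transpose Q ** g ** Q) = trace g"
    using det_orthogonal_conj[of "transpose Q" g] trace_orthogonal_conj[of "transpose Q" g] Q g(2) by simp_all
  ultimately show "trace g \<in> {3, -1}" using inv by metis
qed

lemma square: "g \<in> sym_group P \<Longrightarrow> det g = 1 \<Longrightarrow> g ** g = mat 1"
  using half_turn_involution inv sym_group_orth by blast

text \<open>All of \<open>g\<close>, \<open>h\<close> and \<open>g ** h\<close> square to the
  identity.\<close>

lemma commute:
  assumes "g \<in> sym_group P" "det g = 1" "h \<in> sym_group P" "det h = 1"
  shows "g ** h = h ** g"
proof -
  have gg: "g ** g = mat 1" and hh: "h ** h = mat 1" using square assms by blast+
  have "(g ** h) ** (g ** h) = mat 1" using square[of "g ** h"] assms by (simp add: sym_group_mult det_mul)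
  then have "g ** ((g ** h) ** (g ** h)) ** h = g ** h" by simp
  moreover have "g ** ((g ** h) ** (g ** h)) ** h = (g ** g) ** (h ** g) ** (h ** h)" by (simp add: matrix_mul_assoc)
  ultimately show ?thesis using gg hh by simp
qed

lemma improper_coset:
  assumes "g \<in> sym_group P" "det g = -1" "h \<in> sym_group P" "det h = -1"
  obtains k where "k \<in> sym_group P" "det k = 1" "h = g ** k"
proof
  show "transpose g ** h \<in> sym_group P" using assms by (simp add: sym_group_mult sym_group_transpose)
  show "det (transpose g ** h) = 1" using assms by (simp add: det_mul)
  show "h = g ** (transpose g ** h)" using sym_group_orth[OF assms(1)] by simp
qed

lemma det_cases: "g \<in> sym_group P \<Longrightarrow> det g = 1 \<or> det g = -1"
  using orthogonal_matrix_det sym_group_orth by blast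

lemma minus_1: "- mat 1 \<notin> sym_group P"
  using minus_1_notin_sym_group[OF nz] .

text \<open>The square of an improper element is proper, hence the identity, so in a suitable frame
  the element is \<open>ax 1 (-1) v\<close> with \<open>v\<close> a multiple of pi. Odd multiples
  give \<open>- mat 1\<close>, which cannot fix the tensor; thus it is a plane reflection, and the
  coset argument leaves no second one.\<close>

lemma classified_no_half_turn:
  assumes no: "\<And>g. g \<in> sym_group P \<Longrightarrow> det g = 1 \<Longrightarrow> g = mat 1"
  shows "classified P"
proof (cases "\<exists>g. g \<in> sym_group P \<and> det g = -1")
  case False
  then have "sym_group P = grp_1" using no det_cases sym_group_one by (auto simp: grp_1_def)
  then show ?thesis by (rule classifiedI) (simp add: groups15_def)
next
  case True
  then obtain g where g: "g \<in> sym_group P" "det g = -1" by blast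
  have o: "orthogonal_matrix (- g)" and d: "det (- g) = 1"
    using g sym_group_orth by (simp_all add: orthogonal_matrix_minus3 det_minus3)
  obtain n t where n: "norm n = 1" "- g = rot n t" using euler_rotation[OF o d] .
  obtain Q where Q: "orthogonal_matrix Q" "\<And>t. rot n t = Q ** ax 1 1 t ** transpose Q"
    using rot_conj_ax[OF n(1)] by metis
  have "g = Q ** (- ax 1 1 t) ** transpose Q" using n(2) Q(2) by (metis minus_mult3 minus_minus)
  then have in_P: "ax 1 (-1) (t + pi) \<in> sym_group (transpose Q \<star> P)"
    using conj_in_sym_group_act[OF Q(1)] g(1) by (simp add: minus_ax)
  let ?P = "transpose Q \<star> P"
  interpret R: involutive ?P using rotate Q(1) by simp
  have no': "k = mat 1" if k: "k \<in> sym_group ?P" "det k = 1" for k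
  proof -
    have "Q ** k ** transpose Q \<in> sym_group P" using k(1) Q(1) by (simp add: mem_sym_group_act)
    then have "Q ** k ** transpose Q = mat 1" using no k(2) Q(1) by (simp add: det_orthogonal_conj)
    then have "Q ** k ** transpose Q = Q ** mat 1 ** transpose Q" using Q(1) by simp
    then show ?thesis by (rule conj_inj[OF Q(1)])
  qed
  have "ax 1 (-1) (t + pi) ** ax 1 (-1) (t + pi) = mat 1"
    by (rule no') (use sym_group_mult in_P in \<open>simp_all add: det_mul ax_det\<close>)
  then have "cos (2 * (t + pi)) = 1" by (simp add: ax_mult ax_1[symmetric] ax_eq_iff)
  then have c: "cos (t + pi) = 1 \<or> cos (t + pi) = -1" by (simp only: cos_multiple_angle)
  have m: "ax 1 (-1) (t + pi) \<noteq> - mat 1" using in_P R.minus_1 by metis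
  have "cos (t + pi) \<noteq> -1"
  proof
    assume a: "cos (t + pi) = -1"
    then have "sin (t + pi) = 0" using cos_pm1_sin_0 by blast
    then show False using m a by (simp add: ax_def mat_1_m3 mat3_eq_iff del: cos_periodic_pi sin_periodic_pi)
  qed
  then have "cos (t + pi) = 1" using c by blast
  then have a: "ax 1 (-1) (t + pi) = ax 1 (-1) 0" using cos_1_imp_sin_0[of "t + pi"] by (simp add: ax_eq_iff del: cos_periodic_pi sin_periodic_pi)
  have "sym_group ?P = grp_Z2m"
  proof
    show "sym_group ?P \<subseteq> grp_Z2m"
    proof
      fix h assume h: "h \<in> sym_group ?P"
      show "h \<in> grp_Z2m"
      proof (cases "det h = 1")
        case True then show ?thesis using no'[OF h] by (simp add: grp_Z2m_eq)
      next
        case False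
        then obtain k where "k \<in> sym_group ?P" "det k = 1" "h = ax 1 (-1) (t + pi) ** k"
          using R.improper_coset[OF in_P _ h] R.det_cases[OF h] by (auto simp: ax_det)
        then have "h = ax 1 (-1) (t + pi)" using no'[of k] by simp
        then show ?thesis using a by (simp add: grp_Z2m_eq)
      qed
    qed
    show "grp_Z2m \<subseteq> sym_group ?P" using in_P a sym_group_one by (auto simp: grp_Z2m_eq)
  qed
  then have "classified ?P" by (rule classifiedI) (simp add: groups15_def)
  then show ?thesis using classified_act[of "transpose Q" P] Q(1) by simp
qed

end

lemma ax_pi_m3: "ax 1 1 pi = m3 (-1) 0 0 0 (-1) 0 0 0 1"
  by (simp add: ax_def)

lemma commute_half_turn_ax:
  assumes "orthogonal_matrix g" "g ** ax 1 1 pi = ax 1 1 pi ** g"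
  obtains e s t where "sgn1 e" "sgn1 s" "g = ax e s t"
proof -
  have "g *v e3 = (g$3$3) *\<^sub>R e3" using assms(2) unfolding ax_pi_m3 by (rule commute_diag_axis) simp
  then show ?thesis using orth_preserving_e3[OF assms(1)] that by metis
qed

text \<open>An improper \<open>g\<close> conjugates the only half turn to itself, so it preserves
  the axis and is \<open>ax e s t\<close> with \<open>e * s = -1\<close>. If \<open>e = 1\<close>,
  its square is the half turn, which gives \<open>grp_Z4m\<close>, since square 1 would put
  \<open>- mat 1\<close> into the group. If \<open>e = -1\<close>, it is a reflection in a plane
  through the axis, which gives \<open>grp_Dv 2\<close>.\<close>

lemma (in involutive) classified_one_half_turn:
  assumes r: "ax 1 1 pi \<in> sym_group P"
    and one: "\<And>g. g \<in> sym_group P \<Longrightarrow> det g = 1 \<Longrightarrow> g = mat 1 \<or> g = ax 1 1 pi"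
  shows "classified P"
proof (cases "\<exists>g. g \<in> sym_group P \<and> det g = -1")
  case False
  have "sym_group P = grp_Z 2"
  proof
    show "sym_group P \<subseteq> grp_Z 2" unfolding grp_Z2_eq ax_1[symmetric]
    proof
      fix g assume "g \<in> sym_group P"
      then have "g = ax 1 1 0 \<or> g = ax 1 1 pi" using False one det_cases ax_1 by metis
      then show "g \<in> AX (\<lambda>e s t. e = 1 \<and> s = 1 \<and> cos (2 * t) = 1)" by (auto intro!: AX_I)
    qed
    have "grp_Z 2 = generate O3 {ax 1 1 pi}" by (simp add: grp_Z_def rot_e3)
    then show "grp_Z 2 \<subseteq> sym_group P" using generate_O3_subset[OF subgroup_sym_group] r by simp
  qed
  then show ?thesis by (rule classifiedI) (simp add: groups15_def)
next
  case True
  then obtain g where g: "g \<in> sym_group P" "det g = -1" by blast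
  have go: "orthogonal_matrix g" using g(1) by (rule sym_group_orth)
  have "g ** ax 1 1 pi ** transpose g \<in> sym_group P" by (intro sym_group_mult sym_group_transpose g r)
  moreover have "g ** ax 1 1 pi ** transpose g \<noteq> mat 1"
    using trace_orthogonal_conj[OF go, of "ax 1 1 pi"] by (auto simp: ax_trace trace_I)
  ultimately have "g ** ax 1 1 pi ** transpose g = ax 1 1 pi"
    using one[of "g ** ax 1 1 pi ** transpose g"] det_orthogonal_conj[OF go, of "ax 1 1 pi"] ax_det[of 1 1 pi] by linarith
  then have "g ** ax 1 1 pi = ax 1 1 pi ** g" using go by (metis orth_cancel(6))
  then obtain e s t where est: "sgn1 e" "sgn1 s" "g = ax e s t" using commute_half_turn_ax[OF go] by metis
  have es: "e * s = -1" using g(2) est by (simp add: ax_det)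
  have elems: "h \<in> {mat 1, ax 1 1 pi, g, g ** ax 1 1 pi}" if h: "h \<in> sym_group P" for h
  proof (cases "det h = 1")
    case True then show ?thesis using one h by blast
  next
    case False
    then obtain k where k: "k \<in> sym_group P" "det k = 1" "h = g ** k"
      using improper_coset[OF g h] det_cases[OF h] by blast
    then show ?thesis using one[OF k(1,2)] by auto
  qed
  have gr: "g ** ax 1 1 pi \<in> sym_group P" using sym_group_mult g r by blast
  show ?thesis
  proof (cases "e = 1")
    case e: True
    then have s: "s = -1" using es by simp
    have "g ** g = mat 1 \<or> g ** g = ax 1 1 pi" using one[of "g ** g"] g by (simp add: sym_group_mult det_mul)
    then have "cos (2 * t) = 1 \<or> cos (2 * t) = -1"
      unfolding est e s by (auto simp: ax_mult ax_1[symmetric] ax_eq_iff)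
    moreover have "cos (2 * t) \<noteq> 1"
    proof
      assume "cos (2 * t) = 1"
      then have c: "cos t = 1 \<or> cos t = -1" by (simp only: cos_multiple_angle)
      then have "sin t = 0" by (rule cos_pm1_sin_0)
      then have "g = - mat 1 \<or> g ** ax 1 1 pi = - mat 1"
        using c unfolding est e s by (auto simp: ax_mult) (simp_all add: ax_def mat_1_m3 mat3_eq_iff)
      then show False using g gr minus_1 by auto
    qed
    ultimately have "cos (2 * t) = -1" by blast
    then have ct: "cos t = 0" by (simp only: cos_multiple_angle)
    have "(sin t)\<^sup>2 = 1" using ct sin_cos_squared_add[of t] by simp
    then have st: "sin t = 1 \<or> sin t = -1" by (simp add: power2_eq_1_iff)
    have "sym_group P = grp_Z4m"
    proof
      show "sym_group P \<subseteq> grp_Z4m"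
      proof
        fix h assume "h \<in> sym_group P"
        then have "h = ax 1 1 0 \<or> h = ax 1 1 pi \<or> h = ax 1 (-1) t \<or> h = ax 1 (-1) (t + pi)"
          using elems[of h] unfolding est e s by (auto simp: ax_1 ax_mult)
        then show "h \<in> grp_Z4m" unfolding grp_Z4m_eq using ct
          by (auto intro!: AX_I simp: cos_multiple_angle)
      qed
      have "ax 1 (-1) (pi / 2 + pi) = g \<or> ax 1 (-1) (pi / 2 + pi) = g ** ax 1 1 pi"
      proof -
        define u where "u = pi / 2 + pi"
        have "cos u = 0" "sin u = -1" unfolding u_def by (simp_all only: cos_add sin_add) simp_all
        moreover have "g ** ax 1 1 pi = ax 1 (-1) (t + pi)" unfolding est e s by (simp add: ax_mult)
        ultimately show ?thesis using ct st unfolding u_def[symmetric] by (auto simp: est e s ax_eq_iff)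
      qed
      then have "ax 1 (-1) (pi / 2 + pi) \<in> sym_group P" using g gr by auto
      then show "grp_Z4m \<subseteq> sym_group P"
        unfolding grp_Z4m_def minus_rot_e3 by (intro generate_O3_subset[OF subgroup_sym_group]) simp
    qed
    then show ?thesis by (rule classifiedI) (simp add: groups15_def)
  next
    case False
    then have e: "e = -1" "s = 1" using est es by auto
    \<comment> \<open>Conjugation by the rotation by \<open>u\<close> adds \<open>2 * u\<close> to
      the angle of a reflection; this \<open>u\<close> brings \<open>t\<close> to pi, the angle of
      \<open>refl_plane e1\<close>.\<close>
    define u where "u = (pi - t) / 2"
    let ?P = "ax 1 1 u \<star> P"
    have G: "sym_group ?P = (\<lambda>h. ax 1 1 u ** h ** transpose (ax 1 1 u)) ` sym_group P"
      by (simp add: sym_group_act conjugate_by_eq)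
    have c: "ax 1 1 u ** ax e' s' x ** transpose (ax 1 1 u) = ax e' s' (x + u - e' * u)" if "sgn1 e'" for e' s' x
      using that by (simp add: ax_transpose ax_mult algebra_simps)
    have tu: "t + u + u = pi" by (simp add: u_def)
    have "sym_group P = {ax 1 1 0, ax 1 1 pi, ax (-1) 1 t, ax (-1) 1 (t - pi)}"
      using elems g(1) gr r sym_group_one unfolding est e by (auto simp: ax_1 ax_mult)
    then have "sym_group ?P = {ax 1 1 0, ax 1 1 pi, ax (-1) 1 (t + u + u), ax (-1) 1 (t - pi + u + u)}"
      unfolding G by (simp add: c)
    also have "t - pi + u + u = 0" using tu by simp
    finally have G': "sym_group ?P = {ax 1 1 0, ax 1 1 pi, ax (-1) 1 pi, ax (-1) 1 0}" unfolding tu .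
    have "sym_group ?P = grp_Dv 2"
    proof
      show "sym_group ?P \<subseteq> grp_Dv 2" unfolding G' grp_D2v_eq by (auto intro!: AX_I)
      have "grp_Dv 2 = generate O3 {ax 1 1 pi, ax (-1) 1 pi}" by (simp add: grp_Dv_def rot_e3 refl_e1)
      then show "grp_Dv 2 \<subseteq> sym_group ?P" using generate_O3_subset[OF subgroup_sym_group, of "{ax 1 1 pi, ax (-1) 1 pi}" ?P] G' by simp
    qed
    then have "classified ?P" by (rule classifiedI) (simp add: groups15_def)
    then show ?thesis using classified_act[of "ax 1 1 u" P] by simp
  qed
qed

section \<open>The Klein four-group of diagonal rotations and its improper extensions\<close>

definition diag_rotations :: "mat3 set" where
  "diag_rotations = {m3 x 0 0 0 y 0 0 0 z | x y z. sgn1 x \<and> sgn1 y \<and> sgn1 z \<and> x * y * z = 1}"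

lemma mem_diag_rotations: "g \<in> diag_rotations \<longleftrightarrow>
    g$1$2 = 0 \<and> g$1$3 = 0 \<and> g$2$1 = 0 \<and> g$2$3 = 0 \<and> g$3$1 = 0 \<and> g$3$2 = 0 \<and>
    sgn1 (g$1$1) \<and> sgn1 (g$2$2) \<and> sgn1 (g$3$3) \<and> g$1$1 * g$2$2 * g$3$3 = 1" (is "_ \<longleftrightarrow> ?R")
proof
  assume ?R
  then have "g = m3 (g$1$1) 0 0 0 (g$2$2) 0 0 0 (g$3$3)" by (simp add: mat3_eq_iff)
  then show "g \<in> diag_rotations" unfolding diag_rotations_def using \<open>?R\<close> by blast
qed (auto simp: diag_rotations_def)

lemma diag_rotations_eq: "diag_rotations =
  {mat 1, m3 (-1) 0 0 0 (-1) 0 0 0 1, m3 1 0 0 0 (-1) 0 0 0 (-1), m3 (-1) 0 0 0 1 0 0 0 (-1)}"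
proof
  show "diag_rotations \<subseteq> {mat 1, m3 (-1) 0 0 0 (-1) 0 0 0 1, m3 1 0 0 0 (-1) 0 0 0 (-1), m3 (-1) 0 0 0 1 0 0 0 (-1)}"
    unfolding diag_rotations_def mat_1_m3 by auto
qed (auto simp: mem_diag_rotations mat_1_m3)

lemma diag_rotations_D2: "diag_rotations = grp_D 2"
proof
  show "diag_rotations \<subseteq> grp_D 2"
  proof
    fix g assume "g \<in> diag_rotations"
    then obtain x y z where xyz: "sgn1 x" "sgn1 y" "sgn1 z" "x * y * z = 1" "g = m3 x 0 0 0 y 0 0 0 z"
      unfolding diag_rotations_def by blast
    then have "g = ax z z (if x = 1 then 0 else pi)" by (auto simp: ax_def)
    then show "g \<in> grp_D 2" unfolding grp_D2_eq using xyz by (auto intro!: AX_I)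
  qed
  show "grp_D 2 \<subseteq> diag_rotations"
  proof
    fix g assume "g \<in> grp_D 2"
    then obtain e t where et: "sgn1 e" "cos (2 * t) = 1" "g = ax e e t" unfolding grp_D2_eq AX_def by auto
    have c: "cos t = 1 \<or> cos t = -1" using et(2) by (simp only: cos_multiple_angle)
    then show "g \<in> diag_rotations" using et cos_pm1_sin_0[OF c]
      unfolding diag_rotations_eq mat_1_m3 by (auto simp: ax_def)
  qed
qed

text \<open>If \<open>s = e\<close> the angle is a multiple of pi and the matrix is diagonal; if
  \<open>s = - e\<close> it is an odd multiple of pi/2 and the first two axes are swapped.\<close>

lemma D4h_set: "grp_D2nh 2 = diag_rotations \<union> {m3 0 x 0 y 0 0 0 0 z | x y z. sgn1 x \<and> sgn1 y \<and> sgn1 z \<and> x * y * z = 1}"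
  (is "_ = _ \<union> ?S")
proof
  show "diag_rotations \<union> ?S \<subseteq> grp_D2nh 2"
  proof
    fix g assume "g \<in> diag_rotations \<union> ?S"
    then consider "g \<in> grp_D 2" | x y z where "sgn1 x" "sgn1 y" "sgn1 z" "x * y * z = 1" "g = m3 0 x 0 y 0 0 0 0 z"
      unfolding diag_rotations_D2 by blast
    then show "g \<in> grp_D2nh 2"
    proof cases
      case 1 then show ?thesis unfolding grp_D2_eq grp_D4h_eq AX_def by force
    next
      case 2
      then have "g = ax (- z) z (if y = 1 then pi / 2 else - (pi / 2))" by (auto simp: ax_def)
      then show ?thesis unfolding grp_D4h_eq using 2 by (auto intro!: AX_I)
    qed
  qed
  show "grp_D2nh 2 \<subseteq> diag_rotations \<union> ?S"
  proof
    fix g assume "g \<in> grp_D2nh 2"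
    then obtain e s t where et: "sgn1 e" "sgn1 s" "cos (2 * t) = e * s" "g = ax e s t" unfolding grp_D4h_eq AX_def by blast
    show "g \<in> diag_rotations \<union> ?S"
    proof (cases "s = e")
      case True
      then have "g \<in> grp_D 2" unfolding grp_D2_eq using et by (auto intro!: AX_I)
      then show ?thesis by (simp add: diag_rotations_D2)
    next
      case False
      then have s: "s = - e" using et by auto
      then have "cos (2 * t) = -1" using et by auto
      then have c: "cos t = 0" by (simp only: cos_multiple_angle)
      have "(sin t)\<^sup>2 = 1" using c sin_cos_squared_add[of t] by simp
      then have st: "sin t = 1 \<or> sin t = -1" by (simp add: power2_eq_1_iff)
      have "g = m3 0 (- e * sin t) 0 (sin t) 0 0 0 0 (- e)" using et s c by (simp add: ax_def)
      moreover have "sgn1 (- e * sin t)" "sgn1 (- e)" "- e * sin t * sin t * - e = 1" using et(1) st by auto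
      ultimately have "g \<in> ?S" using st by blast
      then show ?thesis by blast
    qed
  qed
qed

text \<open>The improper elements are the coset of the given swap, and multiplying it by the
  diagonal rotations reaches every sign pattern of product 1.\<close>

lemma (in involutive) classified_swap:
  assumes D: "\<And>g. g \<in> sym_group P \<and> det g = 1 \<longleftrightarrow> g \<in> diag_rotations"
    and g: "m3 0 x 0 y 0 0 0 0 z \<in> sym_group P" "sgn1 x" "sgn1 y" "sgn1 z" "x * y * z = 1"
  shows "classified P"
proof -
  let ?g = "m3 0 x 0 y 0 0 0 0 z"
  have dg: "det ?g = -1" using g(5) by (simp add: det_m3 algebra_simps)
  have mult: "?g ** m3 a 0 0 0 b 0 0 0 c = m3 0 (x * b) 0 (y * a) 0 0 0 0 (z * c)" for a b c by (simp add: m3_mult)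
  have "sym_group P = grp_D2nh 2"
  proof
    show "sym_group P \<subseteq> grp_D2nh 2"
    proof
      fix h assume h: "h \<in> sym_group P"
      show "h \<in> grp_D2nh 2"
      proof (cases "det h = 1")
        case True then show ?thesis using D h D4h_set by blast
      next
        case False
        then obtain k where k: "k \<in> diag_rotations" "h = ?g ** k"
          using improper_coset[OF g(1) dg h] det_cases[OF h] D by metis
        then obtain a b c where abc: "sgn1 a" "sgn1 b" "sgn1 c" "a * b * c = 1" "k = m3 a 0 0 0 b 0 0 0 c"
          unfolding diag_rotations_def by blast
        have "(x * b) * (y * a) * (z * c) = (x * y * z) * (a * b * c)" by (simp add: algebra_simps)
        then have "(x * b) * (y * a) * (z * c) = 1" using abc(4) g(5) by simp
        moreover have "sgn1 (x * b)" "sgn1 (y * a)" "sgn1 (z * c)" using abc(1-3) g(2-4) by auto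
        ultimately show ?thesis unfolding D4h_set k(2) abc(5) mult by blast
      qed
    qed
    show "grp_D2nh 2 \<subseteq> sym_group P"
    proof
      fix h assume "h \<in> grp_D2nh 2"
      then consider "h \<in> diag_rotations" | x' y' z' where "sgn1 x'" "sgn1 y'" "sgn1 z'" "x' * y' * z' = 1" "h = m3 0 x' 0 y' 0 0 0 0 z'"
        unfolding D4h_set by blast
      then show "h \<in> sym_group P"
      proof cases
        case 1 then show ?thesis using D by blast
      next
        case 2
        \<comment> \<open>The quotient of \<open>h\<close> by \<open>?g\<close>: signs are their own
          inverses, and the swap interchanges the first two entries.\<close>
        have "m3 (y * y') 0 0 0 (x * x') 0 0 0 (z * z') \<in> diag_rotations"
        proof -
          have "(y * y') * (x * x') * (z * z') = (x * y * z) * (x' * y' * z')" by (simp add: algebra_simps)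
          then have "(y * y') * (x * x') * (z * z') = 1" using 2(4) g(5) by simp
          moreover have "sgn1 (y * y')" "sgn1 (x * x')" "sgn1 (z * z')" using 2(1-3) g(2-4) by auto
          ultimately show ?thesis by (simp add: mem_diag_rotations)
        qed
        then have "?g ** m3 (y * y') 0 0 0 (x * x') 0 0 0 (z * z') \<in> sym_group P" using D sym_group_mult g(1) by blast
        moreover have "?g ** m3 (y * y') 0 0 0 (x * x') 0 0 0 (z * z') = h" 
        proof -
          have "x * (x * x') = x'" "y * (y * y') = y'" "z * (z * z') = z'" using g(2-4) by auto
          then show ?thesis unfolding mult 2(5) by (simp only:)
        qed
        ultimately show ?thesis by simp
      qed
    qed
  qed
  then show ?thesis by (rule classifiedI) (simp add: groups15_def)
qed

lemma orth_cyclic: "orthogonal_matrix (m3 0 0 1 1 0 0 0 1 0)" "orthogonal_matrix (m3 0 1 0 0 0 1 1 0 0)"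
  unfolding orthogonal_matrix_def mat3_eq_iff by (simp_all add: mult3_nth mat_1_m3)

lemma transpose_m3: "transpose (m3 a b c d e f g h i) = m3 a d g b e h c f i"
  by (simp add: mat3_eq_iff)

text \<open>Cyclic permutations of the axes normalize the diagonal rotations. Changing frame by them
  reduces the other two transpositions of axes to the one treated in
  \<open>classified_swap\<close>.\<close>

lemma (in involutive) cyclic_diag:
  assumes D: "\<And>g. g \<in> sym_group P \<and> det g = 1 \<longleftrightarrow> g \<in> diag_rotations"
    and Q: "orthogonal_matrix Q" and n: "\<And>g. transpose Q ** g ** Q \<in> diag_rotations \<longleftrightarrow> g \<in> diag_rotations"
  shows "g \<in> sym_group (Q \<star> P) \<and> det g = 1 \<longleftrightarrow> g \<in> diag_rotations"
proof -
  have "det (transpose Q ** g ** Q) = det g" using det_orthogonal_conj[of "transpose Q" g] Q by simp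
  then show ?thesis using D n mem_sym_group_act[OF Q] by metis
qed

lemma cyclic_conj_diag:
  assumes "Q = m3 0 0 1 1 0 0 0 1 0 \<or> Q = m3 0 1 0 0 0 1 1 0 0"
  shows "transpose Q ** g ** Q \<in> diag_rotations \<longleftrightarrow> g \<in> diag_rotations"
proof -
  have "transpose Q ** g ** Q = m3 (g$2$2) (g$2$3) (g$2$1) (g$3$2) (g$3$3) (g$3$1) (g$1$2) (g$1$3) (g$1$1)
      \<or> transpose Q ** g ** Q = m3 (g$3$3) (g$3$1) (g$3$2) (g$1$3) (g$1$1) (g$1$2) (g$2$3) (g$2$1) (g$2$2)"
    using assms by (auto simp: transpose_m3) (auto simp: mat3_eq_iff mult3_nth)
  then show ?thesis by (elim disjE) (auto simp: mem_diag_rotations mult_ac)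
qed

text \<open>Proper elements commute with both half turns, hence are diagonal. An improper element
  normalizes the diagonal rotations, hence is monomial: a diagonal one would bring in
  \<open>- mat 1\<close>, a transposition of axes gives \<open>grp_D2nh 2\<close>, and a 3-cycle is
  impossible since its square would be a proper element that is not diagonal.\<close>

lemma (in involutive) classified_two_half_turns:
  assumes r: "m3 (-1) 0 0 0 (-1) 0 0 0 1 \<in> sym_group P" "m3 1 0 0 0 (-1) 0 0 0 (-1) \<in> sym_group P"
  shows "classified P"
proof -
  have r3: "m3 (-1) 0 0 0 1 0 0 0 (-1) \<in> sym_group P" using sym_group_mult[OF r] by (simp add: m3_mult)
  have sub: "g \<in> sym_group P \<and> det g = 1" if "g \<in> diag_rotations" for g
    using that r r3 sym_group_one unfolding diag_rotations_eq by (auto simp: det_m3)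
  have D: "g \<in> sym_group P \<and> det g = 1 \<longleftrightarrow> g \<in> diag_rotations" for g
  proof
    assume g: "g \<in> sym_group P \<and> det g = 1"
    have "g ** m3 (-1) 0 0 0 (-1) 0 0 0 1 = m3 (-1) 0 0 0 (-1) 0 0 0 1 ** g"
      "g ** m3 1 0 0 0 (-1) 0 0 0 (-1) = m3 1 0 0 0 (-1) 0 0 0 (-1) ** g"
      using commute g r by (simp_all add: det_m3)
    then have off: "g$1$2 = 0" "g$1$3 = 0" "g$2$1 = 0" "g$2$3 = 0" "g$3$1 = 0" "g$3$2 = 0"
      unfolding mat3_eq_iff by (simp_all add: mult3_nth)
    have o: "orthogonal_matrix g" using g sym_group_orth by blast
    have sq: "sgn1 (g$1$1)" "sgn1 (g$2$2)" "sgn1 (g$3$3)"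
      using orthogonal_rows[OF o, of 1 1] orthogonal_rows[OF o, of 2 2] orthogonal_rows[OF o, of 3 3] off
      by (simp_all add: square_eq_1_iff)
    have eq: "g = m3 (g$1$1) 0 0 0 (g$2$2) 0 0 0 (g$3$3)" by (simp add: mat3_eq_iff off)
    then have "g$1$1 * g$2$2 * g$3$3 = 1" using g det_m3 by (metis (no_types) diff_zero mult_zero_left mult_zero_right add.right_neutral)
    then show "g \<in> diag_rotations" using eq sq unfolding diag_rotations_def by blast
  qed (rule sub)
  show ?thesis
  proof (cases "\<exists>g. g \<in> sym_group P \<and> det g = -1")
    case False
    then have "sym_group P = grp_D 2" unfolding diag_rotations_D2[symmetric] using D det_cases by blast
    then show ?thesis by (rule classifiedI) (simp add: groups15_def)
  next
    case True
    then obtain g where g: "g \<in> sym_group P" "det g = -1" by blast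
    have o: "orthogonal_matrix g" using g sym_group_orth by blast
    have off: "(g ** d ** transpose g) $ i $ j = 0" if "d \<in> diag_rotations" "i \<noteq> j" for d i j
    proof -
      have "g ** d ** transpose g \<in> sym_group P" "det (g ** d ** transpose g) = 1"
        using D that(1) g(1) by (auto intro: sym_group_mult sym_group_transpose simp: det_orthogonal_conj o)
      then have "g ** d ** transpose g \<in> diag_rotations" using D by blast
      then show ?thesis using that(2) exhaust_3[of i] exhaust_3[of j] unfolding diag_rotations_def by auto
    qed
    have e: "(g ** m3 a 0 0 0 b 0 0 0 c ** transpose g) $ i $ j = a * (g$i$1 * g$j$1) + b * (g$i$2 * g$j$2) + c * (g$i$3 * g$j$3)" for a b c i j
      by (simp add: mult3_nth algebra_simps)
    \<comment> \<open>Three diagonal rotations give three independent linear equations for the three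
      products belonging to rows \<open>i\<close> and \<open>j\<close>.\<close>
    have col: "g$i$k * g$j$k = 0" if "i \<noteq> j" for i j k
    proof -
      have "g$i$1 * g$j$1 + g$i$2 * g$j$2 + g$i$3 * g$j$3 = 0" "- (g$i$1 * g$j$1) - g$i$2 * g$j$2 + g$i$3 * g$j$3 = 0"
        "g$i$1 * g$j$1 - g$i$2 * g$j$2 - g$i$3 * g$j$3 = 0"
        using off[OF _ that, of "m3 1 0 0 0 1 0 0 0 1"] off[OF _ that, of "m3 (-1) 0 0 0 (-1) 0 0 0 1"]
          off[OF _ that, of "m3 1 0 0 0 (-1) 0 0 0 (-1)"] unfolding e diag_rotations_eq mat_1_m3 by simp_all
      then have "g$i$1 * g$j$1 = 0 \<and> g$i$2 * g$j$2 = 0 \<and> g$i$3 * g$j$3 = 0" by linarith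
      then show ?thesis using exhaust_3[of k] by auto
    qed
    have h: "transpose g \<in> sym_group P" "det (transpose g) = -1" using g by (simp_all add: sym_group_transpose)
    \<comment> \<open>\<open>col\<close> is about columns and \<open>monomial_forms\<close> about
      rows, hence the transpose.\<close>
    obtain x y z where xyz: "sgn1 x" "sgn1 y" "sgn1 z" and f:
      "transpose g \<in> {m3 x 0 0 0 y 0 0 0 z, m3 x 0 0 0 0 y 0 z 0, m3 0 x 0 y 0 0 0 0 z,
        m3 0 0 x 0 y 0 z 0 0, m3 0 x 0 0 0 y z 0 0, m3 0 0 x y 0 0 0 z 0}"
      using monomial_forms[of "transpose g"] o col by (simp only: transpose3_nth orthogonal_transpose index3_neq simp_thms) blast
    have sq: "transpose g ** transpose g \<in> diag_rotations"
      using D[of "transpose g ** transpose g"] h sym_group_mult by (simp add: det_mul)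
    show ?thesis using f unfolding insert_iff empty_iff
    proof (elim disjE FalseE)
      assume t: "transpose g = m3 x 0 0 0 y 0 0 0 z"
      then have p: "x * y * z = -1" using h(2) by (simp add: det_m3)
      \<comment> \<open>The negated signs have product 1, and multiplying by them produces the
        central inversion.\<close>
      have "m3 (- x) 0 0 0 (- y) 0 0 0 (- z) \<in> diag_rotations"
        using p xyz by (auto simp: mem_diag_rotations)
      then have "transpose g ** m3 (- x) 0 0 0 (- y) 0 0 0 (- z) \<in> sym_group P" using D h(1) sym_group_mult by blast
      moreover have "transpose g ** m3 (- x) 0 0 0 (- y) 0 0 0 (- z) = - mat 1"
        unfolding t using xyz by (auto simp: m3_mult mat3_eq_iff mat_1_m3)
      ultimately show ?thesis using minus_1 by simp
    next
      assume t: "transpose g = m3 0 x 0 y 0 0 0 0 z"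
      then have "x * y * z = 1" using h(2) by (simp add: det_m3 algebra_simps)
      then show ?thesis using classified_swap[OF D] h(1) t xyz by metis
    next
      assume t: "transpose g = m3 x 0 0 0 0 y 0 z 0"
      then have p: "x * y * z = 1" using h(2) by (simp add: det_m3 algebra_simps)
      let ?Q = "m3 0 1 0 0 0 1 1 0 0"
      interpret R: involutive "?Q \<star> P" using rotate orth_cyclic by blast
      have "m3 0 y 0 z 0 0 0 0 x \<in> sym_group (?Q \<star> P)"
        unfolding mem_sym_group_act[OF orth_cyclic(2)] using h(1) unfolding t by (simp add: transpose_m3 m3_mult)
      then have "classified (?Q \<star> P)"
        using R.classified_swap[OF cyclic_diag[OF D orth_cyclic(2) cyclic_conj_diag], of y z x] xyz p by (simp add: mult_ac)
      then show ?thesis by (rule classified_act[OF orth_cyclic(2)])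
    next
      assume t: "transpose g = m3 0 0 x 0 y 0 z 0 0"
      then have p: "x * y * z = 1" using h(2) by (simp add: det_m3 algebra_simps)
      let ?Q = "m3 0 0 1 1 0 0 0 1 0"
      interpret R: involutive "?Q \<star> P" using rotate orth_cyclic by blast
      have "m3 0 z 0 x 0 0 0 0 y \<in> sym_group (?Q \<star> P)"
        unfolding mem_sym_group_act[OF orth_cyclic(1)] using h(1) unfolding t by (simp add: transpose_m3 m3_mult)
      then have "classified (?Q \<star> P)"
        using R.classified_swap[OF cyclic_diag[OF D orth_cyclic(1) cyclic_conj_diag], of z x y] xyz p by (simp add: mult_ac)
      then show ?thesis by (rule classified_act[OF orth_cyclic(1)])
    next
      assume t: "transpose g = m3 0 x 0 0 0 y z 0 0"
      have "x * y = 0" using sq unfolding t m3_mult diag_rotations_def by (auto simp: mat3_eq_iff)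
      then show ?thesis using xyz by auto
    next
      assume t: "transpose g = m3 0 0 x y 0 0 0 z 0"
      have "x * z = 0" using sq unfolding t m3_mult diag_rotations_def by (auto simp: mat3_eq_iff)
      then show ?thesis using xyz by auto
    qed
  qed
qed

text \<open>A first half turn is moved to the axis \<open>e3\<close>. Any second one commutes with
  it, so its axis is horizontal and can be turned to \<open>e1\<close>.\<close>

lemma (in involutive) classified_involutive: "classified P"
proof (cases "\<exists>g. g \<in> sym_group P \<and> det g = 1 \<and> g \<noteq> mat 1")
  case False
  then show ?thesis using classified_no_half_turn by blast
next
  case True
  then obtain g where g: "g \<in> sym_group P" "det g = 1" "g \<noteq> mat 1" by blast
  then have "trace g = -1" using inv det_1_trace_3 sym_group_orth by blast
  then obtain Q where Q: "orthogonal_matrix Q" "g = Q ** ax 1 1 pi ** transpose Q"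
    using det_1_trace_minus_1[OF sym_group_orth[OF g(1)] g(2)] by metis
  let ?P = "transpose Q \<star> P"
  have oT: "orthogonal_matrix (transpose Q)" using Q(1) by simp
  interpret R: involutive ?P by (rule rotate[OF oT])
  have r: "ax 1 1 pi \<in> sym_group ?P" using conj_in_sym_group_act[OF Q(1)] g(1) Q(2) by simp
  have "classified ?P"
  proof (cases "\<forall>h. h \<in> sym_group ?P \<and> det h = 1 \<longrightarrow> h = mat 1 \<or> h = ax 1 1 pi")
    case True then show ?thesis using R.classified_one_half_turn[OF r] by blast
  next
    case False
    then obtain h where h: "h \<in> sym_group ?P" "det h = 1" "h \<noteq> mat 1" "h \<noteq> ax 1 1 pi" by blast
    have "trace h = -1" using R.inv[OF h(1,2)] det_1_trace_3[OF sym_group_orth[OF h(1)] h(2)] h(3) by blast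
    moreover obtain e s t where est: "sgn1 e" "sgn1 s" "h = ax e s t"
      using commute_half_turn_ax[OF sym_group_orth[OF h(1)]] R.commute[OF h(1,2) r] by (auto simp: ax_det)
    moreover have "e = -1 \<and> s = -1"
    proof -
      have False if "e = 1" "s = 1"
      proof -
        have "cos t = -1" using \<open>trace h = -1\<close> est that by (simp add: ax_trace)
        then have "h = ax 1 1 pi" using est that cos_pm1_sin_0[of t] by (simp add: ax_eq_iff)
        then show False using h(4) by blast
      qed
      then show ?thesis using h(2) est by (auto simp: ax_det)
    qed
    ultimately have h': "h = ax (-1) (-1) t" by simp
    \<comment> \<open>Conjugation by this rotation subtracts \<open>t\<close> from the angle of
      \<open>ax (-1) (-1) t\<close>.\<close>
    let ?R = "ax 1 1 (- t / 2)"
    have oR: "orthogonal_matrix ?R" by simp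
    interpret S: involutive "?R \<star> ?P" by (rule R.rotate[OF oR])
    have "ax 1 1 pi \<in> sym_group (?R \<star> ?P)" "ax (-1) (-1) 0 \<in> sym_group (?R \<star> ?P)"
      unfolding mem_sym_group_act[OF oR] using r h(1) unfolding h' by (simp_all add: ax_transpose ax_mult)
    then have "classified (?R \<star> ?P)" by (intro S.classified_two_half_turns) (simp_all add: ax_def)
    then show ?thesis by (rule classified_act[OF oR])
  qed
  then show ?thesis by (rule classified_act[OF oT])
qed

theorem Piez_classified:
  assumes P: "P \<in> Piez" "P \<noteq> 0"
  shows "classified P"
proof (cases "\<forall>h. h \<in> sym_group P \<and> det h = 1 \<longrightarrow> trace h \<in> {3, -1, 0}")
  case False
  then show ?thesis using classified_generic_rotation[OF P] by blast
next
  case gen: True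
  show ?thesis
  proof (cases "\<exists>h. h \<in> sym_group P \<and> det h = 1 \<and> trace h = 0")
    case True
    then show ?thesis using classified_three_fold_rotation[OF P] gen by blast
  next
    case False
    then interpret involutive P using gen P(2) by unfold_locales auto
    show ?thesis by (rule classified_involutive)
  qed
qed

subsection \<open>Order two symmetries\<close>

lemma rot_orthogonal: "n \<noteq> 0 \<Longrightarrow> orthogonal_matrix (rot n t)"
  using rot_orth[of "sgn n"] by (simp add: rot_sgn norm_sgn)

lemma ex_rot_iff_has_el: "(\<exists>n. n \<noteq> 0 \<and> rot n t \<star> P = P) \<longleftrightarrow> has_el (sym_group P) 1 (1 + 2 * cos t)"
proof -
  have "(\<exists>n. n \<noteq> 0 \<and> rot n t \<star> P = P) \<longleftrightarrow> (\<exists>g. g \<in> sym_group P \<and> (\<exists>n. n \<noteq> 0 \<and> g = rot n t))"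
    using rot_orthogonal by (auto simp: mem_sym_group)
  also have "\<dots> \<longleftrightarrow> has_el (sym_group P) 1 (1 + 2 * cos t)"
    unfolding has_el_def using rot_iff_trace sym_group_orth by blast
  finally show ?thesis .
qed

lemma minus_rot_iff_trace:
  assumes "orthogonal_matrix g"
  shows "(\<exists>n. n \<noteq> 0 \<and> g = - rot n t) \<longleftrightarrow> det g = -1 \<and> trace g = - (1 + 2 * cos t)"
proof -
  have "(\<exists>n. n \<noteq> 0 \<and> g = - rot n t) \<longleftrightarrow> (\<exists>n. n \<noteq> 0 \<and> - g = rot n t)" by (metis minus_minus)
  also have "\<dots> \<longleftrightarrow> det (- g) = 1 \<and> trace (- g) = 1 + 2 * cos t"
    by (rule rot_iff_trace) (simp add: orthogonal_matrix_minus3 assms)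
  finally show ?thesis by (auto simp: det_minus3 trace_minus3)
qed

lemma ex_minus_rot_iff_has_el:
  "(\<exists>n. n \<noteq> 0 \<and> (- rot n t) \<star> P = P) \<longleftrightarrow> has_el (sym_group P) (-1) (- (1 + 2 * cos t))"
proof -
  have "(\<exists>n. n \<noteq> 0 \<and> (- rot n t) \<star> P = P) \<longleftrightarrow> (\<exists>g. g \<in> sym_group P \<and> (\<exists>n. n \<noteq> 0 \<and> g = - rot n t))"
  proof -
    have "orthogonal_matrix (- rot n t)" if "n \<noteq> 0" for n
      using rot_orthogonal[OF that] by (simp add: orthogonal_matrix_minus3)
    then show ?thesis unfolding mem_sym_group by blast
  qed
  also have "\<dots> \<longleftrightarrow> has_el (sym_group P) (-1) (- (1 + 2 * cos t))"
    unfolding has_el_def using minus_rot_iff_trace sym_group_orth by blast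
  finally show ?thesis .
qed

lemma axial_symmetries_eq: "axial_symmetries P = {g \<in> sym_group P. det g = 1 \<and> trace g = -1}"
proof -
  have "axial_symmetries P = {g \<in> sym_group P. \<exists>n. n \<noteq> 0 \<and> g = rot n pi}"
    unfolding axial_symmetries_def using rot_orthogonal by (auto simp: mem_sym_group)
  then show ?thesis using rot_iff_trace[of _ pi] sym_group_orth by auto
qed

lemma plane_symmetries_eq: "plane_symmetries P = {g \<in> sym_group P. det g = -1 \<and> trace g = 1}"
proof -
  have "plane_symmetries P = {g \<in> sym_group P. \<exists>n. n \<noteq> 0 \<and> g = - rot n pi}"
    unfolding plane_symmetries_def refl_plane_def using rot_orthogonal by (auto simp: mem_sym_group orthogonal_matrix_minus3)
  then show ?thesis using minus_rot_iff_trace[of _ pi] sym_group_orth by auto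
qed

lemma order_two_symmetries_eq: "order_two_symmetries P = ord2 (sym_group P)"
  by (auto simp: order_two_symmetries_def axial_symmetries_eq plane_symmetries_eq ord2_def)

lemma situations_eq:
  "situation_a P \<longleftrightarrow> has_el (sym_group P) (-1) 1 \<or> two_half_turns (sym_group P)"
  "situation_b_none P \<longleftrightarrow> \<not> has_el (sym_group P) (-1) 1 \<and> \<not> has_el (sym_group P) 1 (-1)"
  "situation_b_axial P \<longleftrightarrow> \<not> has_el (sym_group P) (-1) 1 \<and> has_el (sym_group P) 1 (-1) \<and> \<not> two_half_turns (sym_group P)"
  unfolding situation_a_def situation_b_none_def situation_b_axial_def order_two_symmetries_def
    plane_symmetries_eq axial_symmetries_eq has_el_def two_half_turns_def by blast+

subsection \<open>The list of classes\<close>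

definition groups16 :: "mat3 set list" where
  "groups16 = groups15 @ [carrier O3]"

lemmas signatures = sig_Z2m sig_D2 sig_D2v sig_D3 sig_D3v sig_D4h sig_D6h sig_Om sig_O2 sig_O2m
  sig_1 sig_Z3 sig_Z2 sig_Z4m sig_SO2 sig_O3

lemma distinct_signatures: "distinct (map signature groups16)"
  by (simp add: groups16_def groups15_def signatures)

lemma signature_inj: "H \<in> set groups16 \<Longrightarrow> K \<in> set groups16 \<Longrightarrow> signature H = signature K \<Longrightarrow> H = K"
  using distinct_signatures by (simp add: distinct_map inj_on_def)

lemma distinct_classes: "distinct (map conj_class groups16)"
proof -
  have "inj_on conj_class (set groups16)"
    by (rule inj_onI) (use signature_inj signature_conj_class in blast)
  moreover have "distinct groups16" using distinct_signatures by (simp add: distinct_map)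
  ultimately show ?thesis by (simp add: distinct_map)
qed

lemma sym_group_0: "sym_group 0 = carrier O3"
  by (auto simp: mem_sym_group)

text \<open>The inversion \<open>- mat 1\<close> is central, so it lies in every conjugate of O(3),
  and no nonzero tensor is fixed by it.\<close>

lemma sym_class_eq_iff_0: "P \<in> Piez \<Longrightarrow> sym_class P = conj_class (carrier O3) \<longleftrightarrow> P = 0"
proof
  assume "sym_class P = conj_class (carrier O3)"
  then obtain g where g: "orthogonal_matrix g" "sym_group P = conjugate_by g (carrier O3)"
    unfolding sym_class_def conj_class_eq_iff by blast
  have "- mat 1 = g ** (- mat 1) ** transpose g" using g(1) by (simp add: minus_mult3)
  moreover have "- mat 1 \<in> carrier O3" by (simp add: orthogonal_matrix_minus3 orthogonal_matrix_id)
  ultimately have "- mat 1 \<in> sym_group P" unfolding g(2) conjugate_by_eq[OF g(1)] by blast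
  then show "P = 0" using minus_1_notin_sym_group by blast
qed (simp add: sym_class_def sym_group_0)

lemma sym_class_in_list:
  assumes "P \<in> Piez"
  obtains H where "H \<in> set groups16" "sym_class P = conj_class H" "P \<noteq> 0 \<Longrightarrow> H \<in> set groups15"
proof (cases "P = 0")
  case True
  then show ?thesis using that[of "carrier O3"] by (simp add: groups16_def sym_class_def sym_group_0)
next
  case False
  then obtain g where g: "orthogonal_matrix g" "sym_group (g \<star> P) \<in> set groups15"
    using Piez_classified assms unfolding classified_def by blast
  have "sym_class P = conj_class (sym_group (g \<star> P))" using sym_class_act[OF g(1)] by (simp add: sym_class_def)
  then show ?thesis using that[of "sym_group (g \<star> P)"] g(2) by (simp add: groups16_def)
qed

lemma realized:
  assumes "H \<in> set groups16"
  obtains P where "P \<in> Piez" "sym_group P = H"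
proof -
  have "0 \<in> Piez" by (simp add: Piez_def)
  then show ?thesis
    using assms that sym_Z2m sym_1 sym_Om sym_group_0
      sym_Z2[folded grp_Z2_eq] sym_Z3[folded grp_Z3_eq] sym_D2[folded grp_D2_eq] sym_D3[folded grp_D3_eq]
      sym_D2v[folded grp_D2v_eq] sym_D3v[folded grp_D3v_eq] sym_Z4m[folded grp_Z4m_eq]
      sym_D4h[folded grp_D4h_eq] sym_D6h[folded grp_D6h_eq] sym_SO2[folded grp_SO2_eq]
      sym_O2[folded grp_O2_eq] sym_O2m[folded grp_O2m_eq]
    unfolding groups16_def groups15_def by (simp only: set_append list.set Un_iff insert_iff empty_iff) (metis wt_Piez tens_Piez)
qed

lemma Piez_classes_eq: "Piez_classes = set (map conj_class groups16)"
proof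
  show "Piez_classes \<subseteq> set (map conj_class groups16)"
    unfolding Piez_classes_def using sym_class_in_list by (auto elim!: sym_class_in_list)
  show "set (map conj_class groups16) \<subseteq> Piez_classes"
  proof
    fix C assume "C \<in> set (map conj_class groups16)"
    then obtain H where H: "H \<in> set groups16" "C = conj_class H" by auto
    then obtain P where "P \<in> Piez" "sym_group P = H" using realized by blast
    then show "C \<in> Piez_classes" unfolding Piez_classes_def using H(2) by (auto simp: sym_class_def)
  qed
qed

text \<open>The signature is invariant under conjugation and injective on the list, so the class of
  a tensor can be looked up in the table of signatures.\<close>

lemma sym_class_eq_iff_signature:
  assumes "P \<in> Piez" "K \<in> set groups16"
  shows "sym_class P = conj_class K \<longleftrightarrow> signature (sym_group P) = signature K"
proof
  assume "sym_class P = conj_class K"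
  then show "signature (sym_group P) = signature K" unfolding sym_class_def by (rule signature_conj_class)
next
  assume s: "signature (sym_group P) = signature K"
  obtain H where H: "H \<in> set groups16" "sym_class P = conj_class H" using sym_class_in_list[OF assms(1)] .
  then have "signature H = signature K" using s signature_conj_class unfolding sym_class_def by metis
  then show "sym_class P = conj_class K" using signature_inj H assms(2) by metis
qed

subsection \<open>Groups generated by their order two elements\<close>

text \<open>Only the inclusion with content; the reverse one holds for every subgroup, see
  \<open>gen2_eq\<close>.\<close>

definition gen2 :: "mat3 set \<Rightarrow> bool" where
  "gen2 H \<longleftrightarrow> H \<subseteq> generate O3 (ord2 H)"

lemma gen2_eq: "subgroup H O3 \<Longrightarrow> gen2 H \<Longrightarrow> H = generate O3 (ord2 H)"
  unfolding gen2_def using generate_O3_subset[of H "ord2 H"] by (auto simp: ord2_def)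

lemma ord2_conjugate_by: "orthogonal_matrix g \<Longrightarrow> ord2 (conjugate_by g H) = conjugate_by g (ord2 H)"
  by (auto simp: ord2_def conjugate_by_eq det_orthogonal_conj trace_orthogonal_conj)

lemma generate_conjugate_by:
  assumes g: "orthogonal_matrix g" and X: "\<And>x. x \<in> X \<Longrightarrow> orthogonal_matrix x" and h: "h \<in> generate O3 X"
  shows "g ** h ** transpose g \<in> generate O3 (conjugate_by g X)"
proof -
  have s: "subgroup (generate O3 (conjugate_by g X)) O3"
    by (rule subgroup_generate_O3) (use g X in \<open>auto simp: conjugate_by_eq orthogonal_matrix_mul\<close>)
  have i: "g ** x ** transpose g \<in> generate O3 (conjugate_by g X)" if "x \<in> X" for x
    by (rule generate.incl) (use that g in \<open>auto simp: conjugate_by_eq\<close>)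
  show ?thesis using h
  proof induction
    case one then show ?case using subgroup_O3_one[OF s] g by simp
  next
    case (incl h) then show ?case by (rule i)
  next
    case (inv h)
    have "transpose (g ** h ** transpose g) = g ** transpose h ** transpose g"
      by (simp add: matrix_transpose_mul matrix_mul_assoc)
    then show ?case using subgroup_O3_transpose[OF s i[OF inv]] X[OF inv] by simp
  next
    case (eng h1 h2)
    have "(g ** h1 ** transpose g) ** (g ** h2 ** transpose g) = g ** (h1 ** h2) ** transpose g"
      using g by (simp add: matrix_mul_assoc)
    then show ?case using subgroup_O3_mult[OF s eng.IH] by simp
  qed
qed

lemma gen2_conjugate_by:
  assumes g: "orthogonal_matrix g" and H: "gen2 H" "\<And>x. x \<in> H \<Longrightarrow> orthogonal_matrix x"
  shows "gen2 (conjugate_by g H)"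
  unfolding gen2_def ord2_conjugate_by[OF g]
proof
  fix x assume "x \<in> conjugate_by g H"
  then obtain h where h: "h \<in> H" "x = g ** h ** transpose g" by (auto simp: conjugate_by_eq[OF g])
  have "h \<in> generate O3 (ord2 H)" using H(1) h(1) unfolding gen2_def by blast
  then show "x \<in> generate O3 (conjugate_by g (ord2 H))"
    unfolding h(2) by (intro generate_conjugate_by[OF g]) (use H(2) in \<open>auto simp: ord2_def\<close>)
qed

text \<open>Every \<open>ax (-1) s t\<close> has order two, and every \<open>ax 1 s t\<close> is a product of two of these.\<close>

lemma gen2_ax:
  assumes H: "subgroup H O3" and sub: "\<And>g. g \<in> H \<Longrightarrow> \<exists>e s t. sgn1 e \<and> sgn1 s \<and> g = ax e s t"
    and b: "ax (-1) s0 u \<in> H" "sgn1 s0"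
  shows "gen2 H"
  unfolding gen2_def
proof
  fix g assume g: "g \<in> H"
  then obtain e s t where est: "sgn1 e" "sgn1 s" "g = ax e s t" using sub by blast
  have o: "ax (-1) s' x \<in> ord2 H" if "ax (-1) s' x \<in> H" "sgn1 s'" for s' x
    using that by (auto simp: ord2_def ax_det ax_trace)
  show "g \<in> generate O3 (ord2 H)"
  proof (cases "e = 1")
    case True
    have gb: "g ** ax (-1) s0 u = ax (-1) (s * s0) (t + u)" using True est by (simp add: ax_mult)
    have "ax (-1) (s * s0) (t + u) \<in> H" using subgroup_O3_mult[OF H g b(1)] gb by simp
    then have "ax (-1) (s * s0) (t + u) \<in> ord2 H" "ax (-1) s0 u \<in> ord2 H" using o b est(2) by auto
    then have "ax (-1) (s * s0) (t + u) \<otimes>\<^bsub>O3\<^esub> ax (-1) s0 u \<in> generate O3 (ord2 H)"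
      by (intro generate.eng generate.incl)
    moreover have "ax (-1) (s * s0) (t + u) ** ax (-1) s0 u = g" using True est b(2) by (auto simp: ax_mult)
    ultimately show ?thesis by simp
  next
    case False
    then show ?thesis using o[of s t] g est by (auto intro: generate.incl)
  qed
qed

lemma gen2_AX:
  assumes "sym_group P = AX \<Phi>" "\<Phi> (-1) s u" "sgn1 s"
  shows "gen2 (AX \<Phi>)"
proof (rule gen2_ax)
  show "subgroup (AX \<Phi>) O3" using subgroup_sym_group assms(1) by metis
  show "\<exists>e s t. sgn1 e \<and> sgn1 s \<and> g = ax e s t" if "g \<in> AX \<Phi>" for g using that by (auto simp: AX_def)
  show "ax (-1) s u \<in> AX \<Phi>" by (rule AX_I) (use assms in auto)
qed fact

lemma gen2_Om: "gen2 grp_Om"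
proof -
  have s: "subgroup (generate O3 (ord2 OM)) O3"
    by (rule subgroup_generate_O3) (use sym_group_orth[of _ tens_Om] sym_Om grp_Om_eq in \<open>auto simp: ord2_def\<close>)
  \<comment> \<open>The product of the first two, a reflection and a half turn, is the generator
    \<open>- rot e3 (pi / 2)\<close>, which itself has order four.\<close>
  have "m3 0 (-1) 0 (-1) 0 0 0 0 1 \<in> OM" "m3 1 0 0 0 (-1) 0 0 0 (-1) \<in> OM" "m3 1 0 0 0 0 1 0 1 0 \<in> OM"
    unfolding OM_def by (auto simp: mat3_eq_iff)
  then have "m3 0 (-1) 0 (-1) 0 0 0 0 1 \<in> ord2 OM" "m3 1 0 0 0 (-1) 0 0 0 (-1) \<in> ord2 OM" "m3 1 0 0 0 0 1 0 1 0 \<in> ord2 OM"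
    by (simp_all add: ord2_def det_m3 trace_m3)
  then have i: "m3 0 (-1) 0 (-1) 0 0 0 0 1 \<in> generate O3 (ord2 OM)" "m3 1 0 0 0 (-1) 0 0 0 (-1) \<in> generate O3 (ord2 OM)"
    "m3 1 0 0 0 0 1 0 1 0 \<in> generate O3 (ord2 OM)" by (auto intro: generate.incl)
  have "m3 0 1 0 (-1) 0 0 0 0 (-1) \<in> generate O3 (ord2 OM)"
    using subgroup_O3_mult[OF s i(1,2)] by (simp add: m3_mult)
  then show ?thesis unfolding gen2_def grp_Om_eq using Om_generated[OF s _ i(3)] by blast
qed

lemma gen2_Z2m: "gen2 grp_Z2m"
proof -
  have "ax 1 (-1) 0 \<in> ord2 grp_Z2m" by (simp add: ord2_def grp_Z2m_eq ax_det ax_trace)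
  then show ?thesis unfolding gen2_def using generate.one[of O3 "ord2 grp_Z2m"] generate.incl[of _ "ord2 grp_Z2m" O3]
    by (auto simp: grp_Z2m_eq)
qed

text \<open>Up to conjugation an element is \<open>ax 1 s v\<close>, the product of
  \<open>ax (-1) s v\<close> and \<open>ax (-1) 1 0\<close>, both of order two.\<close>

lemma gen2_O3: "gen2 (carrier O3)"
  unfolding gen2_def
proof
  fix g assume "g \<in> carrier O3"
  then have g: "orthogonal_matrix g" by simp
  obtain s k where s: "sgn1 s" and k: "orthogonal_matrix k" "det k = 1" "g = s *\<^sub>R k"
  proof (cases "det g = 1")
    case True then show ?thesis using that[of 1 g] g by simp
  next
    case False
    then have "det (- g) = 1" using orthogonal_matrix_det[OF g] by (simp add: det_minus3)
    then show ?thesis using that[of "-1" "- g"] g by (simp add: orthogonal_matrix_minus3)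
  qed
  obtain n t where n: "norm n = 1" "k = rot n t" using euler_rotation[OF k(1,2)] .
  obtain Q where Q: "orthogonal_matrix Q" "\<And>t. rot n t = Q ** ax 1 1 t ** transpose Q"
    using rot_conj_ax[OF n(1)] by metis
  have "\<exists>v. g = Q ** ax 1 s v ** transpose Q"
  proof (cases "s = 1")
    case True then show ?thesis using k(3) n(2) Q(2) by (intro exI[of _ t]) simp
  next
    case False
    then have "s = -1" using s by blast
    moreover have "- (Q ** ax 1 1 t ** transpose Q) = Q ** ax 1 (-1) (t + pi) ** transpose Q"
      by (simp add: minus_ax[symmetric] minus_mult3)
    ultimately show ?thesis using k(3) n(2) Q(2) by (intro exI[of _ "t + pi"]) simp
  qed
  then obtain v where v: "g = Q ** ax 1 s v ** transpose Q" by blast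
  have "ax 1 s v = ax (-1) s v ** ax (-1) 1 0" by (simp add: ax_mult)
  then have "g = (Q ** ax (-1) s v ** transpose Q) ** (Q ** ax (-1) 1 0 ** transpose Q)"
    unfolding v using Q(1) by (simp add: matrix_mul_assoc)
  moreover have "Q ** ax (-1) s' x ** transpose Q \<in> ord2 (carrier O3)" if "sgn1 s'" for s' x
    using that Q(1) by (auto simp: ord2_def orthogonal_matrix_mul det_orthogonal_conj trace_orthogonal_conj ax_det ax_trace)
  then have "(Q ** ax (-1) s v ** transpose Q) \<otimes>\<^bsub>O3\<^esub> (Q ** ax (-1) 1 0 ** transpose Q) \<in> generate O3 (ord2 (carrier O3))"
    using s by (intro generate.eng generate.incl) simp_all
  ultimately show "g \<in> generate O3 (ord2 (carrier O3))" by simp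
qed

lemma gen2_classes_a:
  assumes "H \<in> {grp_Z2m, grp_D 2, grp_Dv 2, grp_D 3, grp_Dv 3, grp_D2nh 2, grp_D2nh 3, grp_Om, grp_O2, grp_O2m, carrier O3}"
  shows "gen2 H"
proof -
  have "gen2 (grp_D 2)" unfolding grp_D2_eq by (rule gen2_AX[where s = "-1" and u = 0, OF sym_D2]) simp_all
  moreover have "gen2 (grp_D 3)" unfolding grp_D3_eq by (rule gen2_AX[where s = "-1" and u = 0, OF sym_D3]) simp_all
  moreover have "gen2 (grp_Dv 2)" unfolding grp_D2v_eq by (rule gen2_AX[where s = 1 and u = 0, OF sym_D2v]) simp_all
  moreover have "cos (3 * pi) = -1" by (subst cos_multiple_angle) simp
  then have "gen2 (grp_Dv 3)" unfolding grp_D3v_eq by (intro gen2_AX[where s = 1 and u = pi, OF sym_D3v]) simp_all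
  moreover have "gen2 (grp_D2nh 2)" unfolding grp_D4h_eq by (rule gen2_AX[where s = "-1" and u = 0, OF sym_D4h]) simp_all
  moreover have "gen2 (grp_D2nh 3)" unfolding grp_D6h_eq by (rule gen2_AX[where s = "-1" and u = 0, OF sym_D6h]) simp_all
  moreover have "gen2 grp_O2" unfolding grp_O2_eq by (rule gen2_AX[where s = "-1" and u = 0, OF sym_O2]) simp_all
  moreover have "gen2 grp_O2m" unfolding grp_O2m_eq by (rule gen2_AX[where s = 1 and u = 0, OF sym_O2m]) simp_all
  ultimately show ?thesis using assms gen2_Om gen2_Z2m gen2_O3 by blast
qed

lemma gen2_situation_a:
  assumes P: "P \<in> Piez" and a: "has_el (sym_group P) (-1) 1 \<or> two_half_turns (sym_group P)"
  shows "gen2 (sym_group P)"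
proof -
  obtain H where H: "H \<in> set groups16" "sym_class P = conj_class H" using sym_class_in_list[OF P] .
  then have "signature (sym_group P) = signature H" unfolding sym_class_def by (intro signature_conj_class) simp
  then have a': "has_el H (-1) 1 \<or> two_half_turns H" using a by (simp add: signature_def)
  have "H \<in> {grp_Z2m, grp_D 2, grp_Dv 2, grp_D 3, grp_Dv 3, grp_D2nh 2, grp_D2nh 3, grp_Om, grp_O2, grp_O2m, carrier O3}"
  proof -
    have "H \<notin> {grp_1, grp_Z 3, grp_Z 2, grp_Z4m, grp_SO2}"
      using a' sig_1 sig_Z3 sig_Z2 sig_Z4m sig_SO2 unfolding signature_def by auto
    then show ?thesis using H(1) unfolding groups16_def groups15_def by auto
  qed
  then have "gen2 H" by (rule gen2_classes_a)
  moreover obtain g where g: "orthogonal_matrix g" "sym_group P = conjugate_by g H"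
    using H(2) unfolding sym_class_def conj_class_eq_iff by blast
  moreover obtain R where "sym_group R = H" using realized[OF H(1)] by blast
  then have "orthogonal_matrix x" if "x \<in> H" for x using that sym_group_orth by blast
  ultimately show ?thesis using gen2_conjugate_by by metis
qed

section \<open>Which classes the order two symmetries characterize\<close>

lemma ord2_determines:
  assumes "ord2 H = ord2 K"
  shows "has_el H (-1) 1 = has_el K (-1) 1" "two_half_turns H = two_half_turns K"
proof -
  have "has_el H (-1) 1 = has_el (ord2 H) (-1) 1" "two_half_turns H = two_half_turns (ord2 H)" for H
    unfolding has_el_def two_half_turns_def ord2_def by blast+
  then show "has_el H (-1) 1 = has_el K (-1) 1" "two_half_turns H = two_half_turns K" using assms by metis+
qed

text \<open>After moving \<open>Q\<close> by the inverse of \<open>h\<close> the order two elements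
  of the two groups coincide. Situation (a) depends on these elements alone, so it passes from
  \<open>P'\<close> to the moved tensor; both groups are then generated by the same set and are
  equal.\<close>

lemma characterized_situation_a:
  assumes P: "P \<in> Piez" and a: "situation_a P"
  shows "characterized_by_order_two (sym_class P)"
  unfolding characterized_by_order_two_def
proof (intro ballI impI)
  fix P' Q assume P': "P' \<in> Piez" and Q: "Q \<in> Piez" and c: "sym_class P' = sym_class P"
    and "\<exists>h\<in>carrier O3. order_two_symmetries Q = conjugate_by h (order_two_symmetries P')"
  then obtain h where h: "orthogonal_matrix h" "ord2 (sym_group Q) = conjugate_by h (ord2 (sym_group P'))"
    unfolding order_two_symmetries_eq by auto
  let ?Q = "transpose h \<star> Q"
  have "ord2 (sym_group ?Q) = conjugate_by (transpose h) (ord2 (sym_group Q))"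
    using h(1) by (simp add: sym_group_act ord2_conjugate_by)
  also have "\<dots> = ord2 (sym_group P')" unfolding h(2) using h(1) by (simp add: conjugate_by_compose)
  finally have eq: "ord2 (sym_group ?Q) = ord2 (sym_group P')" .
  have "signature (sym_group P') = signature (sym_group P)"
    using c unfolding sym_class_def by (rule signature_conj_class)
  then have aP': "has_el (sym_group P') (-1) 1 \<or> two_half_turns (sym_group P')"
    using a unfolding situations_eq by (simp add: signature_def)
  then have "has_el (sym_group ?Q) (-1) 1 \<or> two_half_turns (sym_group ?Q)" using ord2_determines[OF eq] by simp
  then have "gen2 (sym_group ?Q)" using gen2_situation_a[of ?Q] Q by simp
  moreover have "gen2 (sym_group P')" using gen2_situation_a[OF P' aP'] .
  ultimately have "sym_group ?Q = sym_group P'" using gen2_eq[OF subgroup_sym_group] eq by metis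
  then have "sym_class ?Q = sym_class P'" by (simp add: sym_class_def)
  then show "sym_class Q = sym_class P" using sym_class_act[of "transpose h" Q] h(1) c by simp
qed

text \<open>Tensors realizing \<open>H\<close> and \<open>K\<close> have the same order two
  symmetries in the same frame, yet their signatures differ.\<close>

lemma not_characterized:
  assumes "H \<in> set groups16" "K \<in> set groups16" "H \<noteq> K" "ord2 H = ord2 K"
  shows "\<not> characterized_by_order_two (conj_class H)"
proof
  assume c: "characterized_by_order_two (conj_class H)"
  obtain P Q where PQ: "P \<in> Piez" "sym_group P = H" "Q \<in> Piez" "sym_group Q = K"
    using realized[OF assms(1)] realized[OF assms(2)] by metis
  have "order_two_symmetries Q = conjugate_by (mat 1) (order_two_symmetries P)"
    unfolding order_two_symmetries_eq PQ using assms(4) by simp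
  moreover have "mat 1 \<in> carrier O3" by (simp add: orthogonal_matrix_id)
  ultimately have "sym_class Q = conj_class H"
    using c PQ unfolding characterized_by_order_two_def sym_class_def by blast
  then have "signature K = signature H" unfolding sym_class_def PQ by (rule signature_conj_class)
  then show False using signature_inj assms by metis
qed

lemma ord2_b: "ord2 grp_1 = {}" "ord2 (grp_Z 3) = {}" "ord2 (grp_Z 2) = {ax 1 1 pi}" "ord2 grp_Z4m = {ax 1 1 pi}"
  "ord2 grp_SO2 = {ax 1 1 pi}"
proof -
  show "ord2 grp_1 = {}" "ord2 (grp_Z 3) = {}"
    using sig_1 sig_Z3 unfolding signature_def has_el_def ord2_def by auto
  have single: "ord2 (AX (\<lambda>e s t. \<phi> e s (cos t))) = {ax 1 1 pi}"
    if "\<not> has_el (AX (\<lambda>e s t. \<phi> e s (cos t))) (-1) 1" "\<And>c. \<not> \<phi> (-1) (-1) c" "\<phi> 1 1 (-1)" for \<phi>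
  proof
    show "ord2 (AX (\<lambda>e s t. \<phi> e s (cos t))) \<subseteq> {ax 1 1 pi}"
      using that(1) AX_half_turn[where \<phi> = \<phi>] that(2) unfolding ord2_def has_el_def by blast
    show "{ax 1 1 pi} \<subseteq> ord2 (AX (\<lambda>e s t. \<phi> e s (cos t)))"
      using that(3) by (auto simp: ord2_def ax_det ax_trace intro!: AX_I)
  qed
  show "ord2 (grp_Z 2) = {ax 1 1 pi}"
    using single[of "\<lambda>e s c. e = 1 \<and> s = 1 \<and> (c = 1 \<or> c = -1)"] sig_Z2 unfolding Z2_cos signature_def by simp
  show "ord2 grp_Z4m = {ax 1 1 pi}"
    using single[of "\<lambda>e s c. e = 1 \<and> (if s = 1 then c = 1 \<or> c = -1 else c = 0)"] sig_Z4m unfolding Z4m_cos signature_def by simp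
  show "ord2 grp_SO2 = {ax 1 1 pi}"
    using single[of "\<lambda>e s c. e = 1 \<and> s = 1"] sig_SO2 unfolding SO2_cos signature_def by simp
qed

lemma not_characterized_situation_b:
  assumes P: "P \<in> Piez" and a: "\<not> situation_a P"
  shows "\<not> characterized_by_order_two (sym_class P)"
proof -
  obtain H where H: "H \<in> set groups16" "sym_class P = conj_class H" using sym_class_in_list[OF P] .
  then have "signature (sym_group P) = signature H" unfolding sym_class_def by (intro signature_conj_class) simp
  then have a': "\<not> has_el H (-1) 1" "\<not> two_half_turns H" using a unfolding situations_eq by (simp_all add: signature_def)
  have "H \<notin> {grp_Z2m, grp_D 2, grp_Dv 2, grp_D 3, grp_Dv 3, grp_D2nh 2, grp_D2nh 3, grp_Om, grp_O2, grp_O2m, carrier O3}"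
  proof
    assume "H \<in> {grp_Z2m, grp_D 2, grp_Dv 2, grp_D 3, grp_Dv 3, grp_D2nh 2, grp_D2nh 3, grp_Om, grp_O2, grp_O2m, carrier O3}"
    then have "signature H ! 3 \<or> signature H ! 1"
      unfolding insert_iff empty_iff by (elim disjE) (simp_all add: signatures)
    then show False using a' by (simp add: signature_def)
  qed
  then have "H \<in> {grp_1, grp_Z 3, grp_Z 2, grp_Z4m, grp_SO2}"
    using H(1) unfolding groups16_def groups15_def by auto
  moreover have "signature grp_1 \<noteq> signature (grp_Z 3)" "signature (grp_Z 2) \<noteq> signature grp_Z4m"
    "signature grp_SO2 \<noteq> signature (grp_Z 2)"
    by (simp_all add: signatures)
  then have "grp_1 \<noteq> grp_Z 3" "grp_Z 2 \<noteq> grp_Z4m" "grp_SO2 \<noteq> grp_Z 2" by auto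
  moreover have "grp_1 \<in> set groups16" "grp_Z 3 \<in> set groups16" "grp_Z 2 \<in> set groups16"
    "grp_Z4m \<in> set groups16" "grp_SO2 \<in> set groups16"
    by (simp_all add: groups16_def groups15_def)
  ultimately have "\<exists>K\<in>set groups16. H \<noteq> K \<and> ord2 H = ord2 K"
    unfolding insert_iff empty_iff using ord2_b by metis
  then show ?thesis unfolding H(2) using not_characterized[OF H(1)] by blast
qed

lemma characterized_iff: "P \<in> Piez \<Longrightarrow> characterized_by_order_two (sym_class P) \<longleftrightarrow> situation_a P"
  using characterized_situation_a not_characterized_situation_b by blast

lemma rotation_axis_iff:
  assumes P: "P \<in> Piez"
  shows "sym_class P = conj_class grp_SO2 \<Longrightarrow> \<exists>n. n \<noteq> 0 \<and> (\<forall>\<theta>. rot n \<theta> \<star> P = P)"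
    and "\<exists>n. n \<noteq> 0 \<and> (\<forall>\<theta>. rot n \<theta> \<star> P = P) \<Longrightarrow> has_el (sym_group P) 1 1"
proof -
  assume "sym_class P = conj_class grp_SO2"
  then obtain g where g: "orthogonal_matrix g" "sym_group P = conjugate_by g grp_SO2"
    unfolding sym_class_def conj_class_eq_iff by blast
  have "rot (g *v e3) \<theta> \<in> sym_group P" for \<theta>
  proof -
    have "g ** rot e3 (det g * \<theta>) ** transpose g = rot (g *v e3) (det g * (det g * \<theta>))"
      by (rule conj_rot[OF g(1)]) simp
    moreover have "det g * (det g * \<theta>) = \<theta>" using orthogonal_matrix_det[OF g(1)] by auto
    ultimately have "rot (g *v e3) \<theta> = g ** rot e3 (det g * \<theta>) ** transpose g" by simp
    then show ?thesis unfolding g(2) conjugate_by_eq[OF g(1)] grp_SO2_def by blast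
  qed
  moreover have "g *v e3 \<noteq> 0" using norm_orthogonal_mv[OF g(1), of e3] by auto
  ultimately show "\<exists>n. n \<noteq> 0 \<and> (\<forall>\<theta>. rot n \<theta> \<star> P = P)" by (auto simp: mem_sym_group)
next
  assume "\<exists>n. n \<noteq> 0 \<and> (\<forall>\<theta>. rot n \<theta> \<star> P = P)"
  \<comment> \<open>Only the quarter turn is kept, whose trace is 1; among the groups with a unique
    axial symmetry and no plane symmetry only SO(2) contains one.\<close>
  then show "has_el (sym_group P) 1 1" using ex_rot_iff_has_el[of "pi / 2" P] by auto
qed

text \<open>Every \<open>ax (-1) s t\<close> has order two, and its first entry \<open>cos t\<close>
  runs through a whole interval.\<close>

lemma infinite_order_two_0: "infinite (plane_symmetries 0)" "infinite (axial_symmetries 0)"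
proof -
  have inf: "infinite ((\<lambda>t. ax (-1) s t) ` UNIV)" if "sgn1 s" for s
  proof
    assume "finite ((\<lambda>t. ax (-1) s t) ` UNIV)"
    then have "finite ((\<lambda>g. g$1$1) ` (\<lambda>t. ax (-1) s t) ` UNIV)" by (rule finite_imageI)
    moreover have "{-1..1} \<subseteq> (\<lambda>g. g$1$1) ` (\<lambda>t. ax (-1) s t) ` UNIV"
    proof
      fix x :: real assume "x \<in> {-1..1}"
      then have "x = (ax (-1) s (arccos x))$1$1" by (simp add: ax_def)
      then show "x \<in> (\<lambda>g. g$1$1) ` (\<lambda>t. ax (-1) s t) ` UNIV" by blast
    qed
    ultimately have "finite {-1..1::real}" by (rule finite_subset[rotated])
    then show False using infinite_Icc[of "-1" "1::real"] by simp
  qed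
  have "(\<lambda>t. ax (-1) 1 t) ` UNIV \<subseteq> plane_symmetries 0" "(\<lambda>t. ax (-1) (-1) t) ` UNIV \<subseteq> axial_symmetries 0"
    unfolding plane_symmetries_eq axial_symmetries_eq by (auto simp: mem_sym_group ax_det ax_trace)
  then show "infinite (plane_symmetries 0)" "infinite (axial_symmetries 0)"
    using inf[of 1] inf[of "-1"] finite_subset by blast+
qed

lemma classes_a_eq: "classes_a = set (map conj_class (take 10 groups16))"
  by (auto simp: classes_a_def groups16_def groups15_def)

lemma card_classes: "card (set (map conj_class groups16)) = 16" "card classes_a = 10"
  "card (classes_a \<union> {conj_class (carrier O3)}) = 11"
proof -
  have "distinct (take 10 (map conj_class groups16))" using distinct_classes by (rule distinct_take)
  then have d: "distinct (map conj_class (take 10 groups16))" by (simp only: take_map)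
  have l: "length groups16 = 16" by (simp add: groups16_def groups15_def)
  then show "card (set (map conj_class groups16)) = 16" using distinct_card[OF distinct_classes] by simp
  show a: "card classes_a = 10"
    unfolding classes_a_eq using distinct_card[OF d] l by simp
  have "conj_class (carrier O3) \<notin> classes_a"
  proof
    assume "conj_class (carrier O3) \<in> classes_a"
    then obtain H where H: "H \<in> set (take 10 groups16)" "conj_class (carrier O3) = conj_class H"
      unfolding classes_a_eq by auto
    then have "signature H = signature (carrier O3)" using signature_conj_class by metis
    then show False using H(1) by (auto simp: groups16_def groups15_def signatures)
  qed
  moreover have "finite classes_a" by (simp add: classes_a_def)
  ultimately show "card (classes_a \<union> {conj_class (carrier O3)}) = 11" using a by simp
qed

section \<open>Assembly from the table of signatures\<close>

theorem mainTheorem2: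
  shows
    "Piez_classes = classes_a \<union> classes_b_none \<union> classes_b_axial \<union> {conj_class (carrier O3)}
     \<and> card Piez_classes = 16
     \<and> {C \<in> Piez_classes. characterized_by_order_two C} = classes_a \<union> {conj_class (carrier O3)}
     \<and> card {C \<in> Piez_classes. characterized_by_order_two C} = 11
     \<and> card classes_a = 10
     \<and> (\<forall>P\<in>Piez. P \<noteq> 0 \<longrightarrow>
          (situation_a P \<noteq> (situation_b_none P \<or> situation_b_axial P))
          \<comment> \<open>(a)\<close>
          \<and> (situation_a P \<longleftrightarrow> sym_class P \<in> classes_a)
          \<and> (situation_a P \<longrightarrow> characterized_by_order_two (sym_class P))
          \<comment> \<open>(b)\<close>
          \<and> (situation_b_none P \<longleftrightarrow> sym_class P \<in> classes_b_none)
          \<and> (situation_b_axial P \<longleftrightarrow> sym_class P \<in> classes_b_axial)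
          \<and> (situation_b_none P \<or> situation_b_axial P
               \<longrightarrow> \<not> characterized_by_order_two (sym_class P))
          \<and> (situation_b_none P \<longrightarrow>
               (sym_class P = conj_class (grp_Z 3)
                  \<longleftrightarrow> (\<exists>n. n \<noteq> 0 \<and> rot n (2 * pi / 3) \<star> P = P))
             \<and> (sym_class P = conj_class grp_1
                  \<longleftrightarrow> \<not> (\<exists>n. n \<noteq> 0 \<and> rot n (2 * pi / 3) \<star> P = P)))
          \<and> (situation_b_axial P \<longrightarrow>
               (sym_class P = conj_class grp_Z4m
                  \<longleftrightarrow> (\<exists>n. n \<noteq> 0 \<and> (- rot n (pi / 2)) \<star> P = P))
             \<and> (sym_class P = conj_class grp_SO2
                  \<longleftrightarrow> (\<exists>n. n \<noteq> 0 \<and> (\<forall>\<theta>. rot n \<theta> \<star> P = P)))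
             \<and> (sym_class P = conj_class (grp_Z 2)
                  \<longleftrightarrow> \<not> (\<exists>n. n \<noteq> 0 \<and> (- rot n (pi / 2)) \<star> P = P)
                      \<and> \<not> (\<exists>n. n \<noteq> 0 \<and> (\<forall>\<theta>. rot n \<theta> \<star> P = P)))))
     \<and> (\<forall>P\<in>Piez. sym_class P = conj_class (carrier O3) \<longleftrightarrow> P = 0)
     \<and> infinite (plane_symmetries 0) \<and> infinite (axial_symmetries 0)"
proof -
  have mem: "H \<in> set groups16" if "H \<in> {grp_Z2m, grp_D 2, grp_Dv 2, grp_D 3, grp_Dv 3, grp_D2nh 2, grp_D2nh 3, grp_Om,
      grp_O2, grp_O2m, grp_1, grp_Z 3, grp_Z 2, grp_Z4m, grp_SO2, carrier O3}" for H
    using that by (auto simp: groups16_def groups15_def)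
  note eq_iff = sym_class_eq_iff_signature[OF _ mem]
  have in_a: "sym_class P \<in> classes_a \<longleftrightarrow> signature (sym_group P) \<in> signature ` {grp_Z2m, grp_D 2, grp_Dv 2, grp_D 3,
      grp_Dv 3, grp_D2nh 2, grp_D2nh 3, grp_Om, grp_O2, grp_O2m}" if "P \<in> Piez" for P
    unfolding classes_a_def using eq_iff[OF that] by simp
  have in_b: "sym_class P \<in> classes_b_none \<longleftrightarrow> signature (sym_group P) \<in> signature ` {grp_1, grp_Z 3}"
    "sym_class P \<in> classes_b_axial \<longleftrightarrow> signature (sym_group P) \<in> signature ` {grp_Z 2, grp_Z4m, grp_SO2}" if "P \<in> Piez" for P
    unfolding classes_b_none_def classes_b_axial_def using eq_iff[OF that] by simp_all
  have sigs: "signature (sym_group P) \<in> signature ` set groups15" if P: "P \<in> Piez" "P \<noteq> 0" for P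
  proof -
    obtain H where H: "H \<in> set groups16" "sym_class P = conj_class H" "H \<in> set groups15"
      using sym_class_in_list[OF P(1)] P(2) by metis
    then show ?thesis using sym_class_eq_iff_signature[OF P(1) H(1)] by blast
  qed
  \<comment> \<open>Positions in the signature: 0 threefold rotation, 1 two half turns, 2 half turn,
    3 plane reflection, 4 minus a quarter turn, 5 quarter turn.\<close>
  have sit: "situation_a P \<longleftrightarrow> signature (sym_group P) ! 3 \<or> signature (sym_group P) ! 1"
    "situation_b_none P \<longleftrightarrow> \<not> signature (sym_group P) ! 3 \<and> \<not> signature (sym_group P) ! 2"
    "situation_b_axial P \<longleftrightarrow> \<not> signature (sym_group P) ! 3 \<and> signature (sym_group P) ! 2 \<and> \<not> signature (sym_group P) ! 1" for P
    unfolding situations_eq by (simp_all add: signature_def)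
  have three: "(\<exists>n. n \<noteq> 0 \<and> rot n (2 * pi / 3) \<star> P = P) \<longleftrightarrow> signature (sym_group P) ! 0" for P
    unfolding ex_rot_iff_has_el cos_sin_120 by (simp add: signature_def)
  have four: "(\<exists>n. n \<noteq> 0 \<and> (- rot n (pi / 2)) \<star> P = P) \<longleftrightarrow> signature (sym_group P) ! 4" for P
    unfolding ex_minus_rot_iff_has_el by (simp add: signature_def)
  have all: "(\<exists>n. n \<noteq> 0 \<and> (\<forall>\<theta>. rot n \<theta> \<star> P = P)) \<longleftrightarrow> sym_class P = conj_class grp_SO2"
    if P: "P \<in> Piez" "P \<noteq> 0" "situation_b_axial P" for P
  proof
    assume "\<exists>n. n \<noteq> 0 \<and> (\<forall>\<theta>. rot n \<theta> \<star> P = P)"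
    then have "signature (sym_group P) ! 5" using rotation_axis_iff(2)[OF P(1)] by (simp add: signature_def)
    then have "signature (sym_group P) = signature grp_SO2"
      using sigs[OF P(1,2)] P(3) unfolding sit by (auto simp: groups15_def signatures)
    then show "sym_class P = conj_class grp_SO2" using eq_iff[OF P(1)] by simp
  qed (rule rotation_axis_iff(1)[OF P(1)])
  have classes: "set (map conj_class groups16) = classes_a \<union> classes_b_none \<union> classes_b_axial \<union> {conj_class (carrier O3)}"
    by (auto simp: classes_a_def classes_b_none_def classes_b_axial_def groups16_def groups15_def)
  have a_iff: "situation_a P \<longleftrightarrow> sym_class P \<in> classes_a" if "P \<in> Piez" "P \<noteq> 0" for P
    using sigs[OF that] unfolding in_a[OF that(1)] sit by (auto simp: groups15_def signatures)
  have a_0: "situation_a 0" unfolding sit sym_group_0 sig_O3 by simp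
  have char: "{C \<in> Piez_classes. characterized_by_order_two C} = classes_a \<union> {conj_class (carrier O3)}"
  proof (intro Set.set_eqI iffI)
    fix C assume "C \<in> {C \<in> Piez_classes. characterized_by_order_two C}"
    then obtain P where P: "P \<in> Piez" "C = sym_class P" "situation_a P"
      unfolding Piez_classes_def using characterized_iff by auto
    then show "C \<in> classes_a \<union> {conj_class (carrier O3)}"
      using a_iff[of P] sym_class_eq_iff_0[of P] by blast
  next
    fix C assume C: "C \<in> classes_a \<union> {conj_class (carrier O3)}"
    then have "C \<in> Piez_classes" unfolding Piez_classes_eq classes by blast
    then obtain P where P: "P \<in> Piez" "C = sym_class P" unfolding Piez_classes_def by blast
    have "situation_a P" using C a_iff[OF P(1)] a_0 sym_class_eq_iff_0[OF P(1)] unfolding P(2) by blast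
    then show "C \<in> {C \<in> Piez_classes. characterized_by_order_two C}"
      using \<open>C \<in> Piez_classes\<close> characterized_iff[OF P(1)] P(2) by blast
  qed
  show ?thesis
  proof (intro conjI, goal_cases)
    case 1 show ?case using Piez_classes_eq classes by simp
  next
    case 2 show ?case using Piez_classes_eq card_classes(1) by simp
  next
    case 3 show ?case by (rule char)
  next
    case 4 show ?case unfolding char by (rule card_classes(3))
  next
    case 5 show ?case by (rule card_classes(2))
  next
    case 6
    show ?case
    proof (intro ballI impI, goal_cases)
      case P: (1 P)
      have eqs: "sym_class P = conj_class (grp_Z 3) \<longleftrightarrow> signature (sym_group P) = signature (grp_Z 3)"
        "sym_class P = conj_class grp_1 \<longleftrightarrow> signature (sym_group P) = signature grp_1"
        "sym_class P = conj_class grp_Z4m \<longleftrightarrow> signature (sym_group P) = signature grp_Z4m"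
        "sym_class P = conj_class grp_SO2 \<longleftrightarrow> signature (sym_group P) = signature grp_SO2"
        "sym_class P = conj_class (grp_Z 2) \<longleftrightarrow> signature (sym_group P) = signature (grp_Z 2)"
        by (simp_all add: eq_iff[OF P(1)])
      \<comment> \<open>By \<open>sigs\<close> the signature is one of fifteen explicit lists, so
        each of these claims is a finite check.\<close>
      have dichotomy: "situation_a P \<noteq> (situation_b_none P \<or> situation_b_axial P)"
        and none: "situation_b_none P \<longleftrightarrow> sym_class P \<in> classes_b_none"
        and axial: "situation_b_axial P \<longleftrightarrow> sym_class P \<in> classes_b_axial"
        and z3: "situation_b_none P \<longrightarrow> (sym_class P = conj_class (grp_Z 3) \<longleftrightarrow> signature (sym_group P) ! 0) \<and>
          (sym_class P = conj_class grp_1 \<longleftrightarrow> \<not> signature (sym_group P) ! 0)"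
        and z4: "situation_b_axial P \<longrightarrow> (sym_class P = conj_class grp_Z4m \<longleftrightarrow> signature (sym_group P) ! 4) \<and>
          (sym_class P = conj_class (grp_Z 2) \<longleftrightarrow> \<not> signature (sym_group P) ! 4 \<and> sym_class P \<noteq> conj_class grp_SO2)"
        using sigs[OF P] unfolding in_b[OF P(1)] sit eqs by (auto simp: groups15_def signatures)
      show ?case
        using dichotomy a_iff[OF P] characterized_iff[OF P(1)] none axial z3 z4 all[OF P] unfolding three four by argo
    qed
  next
    case 7 show ?case using sym_class_eq_iff_0 by blast
  qed (rule infinite_order_two_0)+
qed

end
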